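(* Fix $(\zeta,\eta)\in\Lambda\times\Xi$ and assume hypotheses H(A), H(B), H(F), H(G), H(W), H($\ell$) and H($\varphi$) spelled out in the context. Then there exists $w^*\in\mathcal W_{ad}$ such that $$m_{\zeta,\eta}(w^* )+\mathcal R(w^* )=\inf_{w\in\mathcal W_{ad}}\{m_{\zeta,\eta}(w)+\mathcal R(w)\}.$$
   Context: **Setting.** $E,H,Y$ are real separable Hilbert spaces with norms $\|\cdot\|_E,\|\cdot\|,\|\cdot\|_Y$ ($\langle\cdot,\cdot\rangle$ is the inner product of $H$), $I=[0,b]$ with $b>0$, $(\Lambda,d_\Lambda)$ and $(\Xi,d_\Xi)$ are metric spaces, $\Lambda\times\Xi$ has the product metric. Spaces $C(I,\cdot)$ carry the sup norm. $\operatorname{Haus}$ is the Hausdorff metric between sets; for a set $S$ in a normed space $\|S\|:=\sup_{s\in S}\|s\|$. A multifunction $\Phi$ on $I$ is measurable if $\{t:\Phi(t)\subset O\}$ is Lebesgue measurable for every open $O$. A set $S\subset H$ is ball-relatively compact if its intersection with every closed ball centered at $0$ is relatively compact. For a maximal monotone $B:D(B)\subset H\rightrightarrows H$, $B^0(v)$ is the minimal-norm element of $B(v)$. The pseudo-distance of maximal monotone operators is $$\operatorname{dis}(B_1,B_2)=\sup\Big\{\tfrac{\langle y-y',x'-x\rangle}{1+\|y\|+\|y'\|}: x\in D(B_1),y\in B_1(x),x'\in D(B_2),y'\in B_2(x')\Big\}\in[0,\infty].$$ **Data.** Linear operators $A_\zeta:D(A_\zeta)\subset E\to E$ ($\zeta\in\Lambda$);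 maximal monotone operators $B(t,u,\eta):D(B(t,u,\eta))\subset H\rightrightarrows H$ ($(t,u,\eta)\in I\times H\times\Xi$); multifunctions $F:I\times E\times H\times\Lambda\rightrightarrows E$, $G:I\times E\times H\times\Xi\rightrightarrows H$, $W:I\rightrightarrows Y$; a bounded linear operator $\mathcal B:Y\to E$; maps $x_0:\Lambda\to E$, $u_0:\Xi\to H$ with $u_0(\eta)\in D(B(0,u_0(\eta),\eta))$; functions $\ell:I\times E\times H\times\Lambda\times\Xi\to\mathbb R$, $\varphi:E\times H\times\Lambda\times\Xi\to\mathbb R$. **H(A).** Each $A_\zeta$ generates a $C_0$-semigroup $\{T_\zeta(t)\}_{t\ge0}$ on $E$ with $T_\zeta(t)$ compact for all $t>0$; for every bounded $D\subset\Lambda$ there is $M_D>0$ with $\sup_{t\in I}\|T_\zeta(t)\|_{\mathcal L(E)}\le M_D$ for all $\zeta\in D$; whenever $\zeta_n\to\zeta$, $\sup_{t\in I}\|T_{\zeta_n}(t)x-T_\zeta(t)x\|_E\to0$ for every $x\in E$, and $\sup_{t\in[\delta,b]}\|T_{\zeta_n}(t)-T_\zeta(t)\|_{\mathcal L(E)}\to0$ for every $0<\delta<b$. **H(B).** (i) There are $\theta\in W^{1,2}(I,\mathbb R)$, $\lambda\in[0,1)$, $\lambda'>0$ with $\operatorname{dis}(B(t,u,\eta_1),B(s,v,\eta_2))\le|\theta(t)-\theta(s)|+\lambda\|u-v\|+\lambda' d_\Xi(\eta_1,\eta_2)$ for all $t,s\in I$, $u,v\in H$, $\eta_1,\eta_2\in\Xi$.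 (ii) There is $M_B>0$ with $\|B^0(t,u,\eta)v\|\le M_B(1+\|u\|+\|v\|)$ for all $t\in I$, $u\in H$, $\eta\in\Xi$, $v\in D(B(t,u,\eta))$. (iii) For every bounded $\Omega\subset H\times\Xi$, $\bigcup_{t\in I,(u,\eta)\in\Omega}D(B(t,u,\eta))$ is ball-relatively compact in $H$. (iv) For every bounded $D\subset\Xi$ and $r>0$ there is $\varrho_D\in L^1(I,\mathbb R_+)$ with $\langle v_1-v_2,u_1-u_2\rangle\ge-\varrho_D(t)\|u_1-u_2\|^2$ for all $t\in I$, $\|u_1\|,\|u_2\|\le r$, $\eta_1,\eta_2\in D$, $v_i\in B(t,u_i,\eta_i)(u_i)$. **H(F).** $F$ has nonempty weakly compact convex values and: (i) $t\mapsto F(t,x,u,\zeta)$ is measurable for all $(x,u,\zeta)$; (ii) for every bounded $D\subset\Lambda$ there is $k_D\in L^1(I,\mathbb R_+)$ with $\operatorname{Haus}(F(t,x,u,\zeta),F(t,y,v,\zeta))\le k_D(t)(\|x-y\|_E+\|u-v\|)$ for all $(x,u),(y,v)$, $\zeta\in D$, a.e. $t$; (iii) for every bounded $D\subset\Lambda$ there is $M_F>0$ with $\|F(t,x,u,\zeta)\|_E\le M_F(1+\|x\|_E+\|u\|)$ for a.e. $t$ and all $(x,u,\zeta)\in E\times H\times D$; (iv) $\operatorname{Haus}(F(t,x,u,\zeta_1),F(t,x,u,\zeta_2))\le\gamma_1(d_\Lambda(\zeta_1,\zeta_2))\rho_1(t,\|x\|_E,\|u\|)$ for all $(x,u)$,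 $\zeta_1,\zeta_2$, a.e. $t$, where $\gamma_1(r)\to0$ as $r\to0^+$ and for every bounded $S\subset L^2(I,E)\times L^2(I,H)$ there is $\omega_S\in L^1(I,\mathbb R_+)$ with $\rho_1(t,\|x(t)\|_E,\|u(t)\|)\le\omega_S(t)$ for a.e. $t$ and all $(x,u)\in S$. **H(G).** $G$ has nonempty weakly compact convex values and: (i) $t\mapsto G(t,x,u,\eta)$ is measurable; (ii) for every bounded $D\subset\Xi$ there is $l_D\in L^1(I,\mathbb R_+)$ with $\operatorname{Haus}(G(t,x,u,\eta),G(t,y,v,\eta))\le l_D(t)(\|x-y\|_E+\|u-v\|)$ for all $(x,u),(y,v)$, $\eta\in D$, a.e. $t$; (iii) for every bounded $D\subset\Xi$ there is $M_G>0$ with $\|G(t,x,u,\eta)\|\le M_G(1+\|x\|_E+\|u\|)$ for a.e. $t$ and all $(x,u,\eta)\in E\times H\times D$; (iv) $\operatorname{Haus}(G(t,x,u,\eta_1),G(t,x,u,\eta_2))\le\gamma_2(d_\Xi(\eta_1,\eta_2))\rho_2(t,\|x\|_E,\|u\|)$ for all $(x,u)$, $\eta_1,\eta_2$, a.e. $t$, where $\gamma_2(r)\to0$ as $r\to0^+$ and for every bounded $Q\subset C(I,E)\times C(I,H)$ there is $\omega_Q\in L^1(I,\mathbb R_+)$ with $\rho_2(t,\|x(t)\|_E,\|u(t)\|)\le\omega_Q(t)$ for a.e. $t$ and all $(x,u)\in Q$. **H(W).** $W$ is measurable with nonempty closed convex values, and there is $\phi_W\in L^2(I,\mathbb R_+)$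 with $\sup_{v\in W(t)}\|v\|_Y\le\phi_W(t)$ for a.e. $t$. **H($\ell$).** (i) $t\mapsto\ell(t,x,u,\zeta,\eta)$ is measurable for all $(x,u,\zeta,\eta)$. (ii) For a.e. $t$, all $x,y\in E$ and all $(u,\zeta,\eta)$, $|\ell(t,x,u,\zeta,\eta)-\ell(t,y,u,\zeta,\eta)|\le(1+\max\{\|x\|_E,\|y\|_E\})\,\kappa(t,\|x-y\|_E)$, where $\kappa:I\times\mathbb R_+\to\mathbb R_+$ is Carath\'eodory, $\kappa(t,0)=0$ for a.e. $t$, and for each $R>0$ there is $\beta_R\in L^1(I,\mathbb R_+)$ with $\sup_{0\le r\le R}\kappa(t,r)\le\beta_R(t)$ for a.e. $t$. (iii) For a.e. $t$ and all $(x,\zeta,\eta)$, $u\mapsto\ell(t,x,u,\zeta,\eta)$ is convex. (iv) For every bounded $D\subset\Lambda\times\Xi$ there is $\vartheta_D\in L^1(I,\mathbb R_+)$ with $|\ell(t,0,u,\zeta,\eta)|\le\vartheta_D(t)(1+\|u\|)$ for a.e. $t$, all $u\in H$, $(\zeta,\eta)\in D$. (v) For a.e. $t$, $(x,u,\zeta,\eta)\mapsto\ell(t,x,u,\zeta,\eta)$ is continuous. **H($\varphi$).** $\varphi$ is continuous. **Controls and controlled solution sets.** $\mathcal W_{ad}=\{w\in L^2(I,Y):w(t)\in W(t)\text{ for a.e. }t\in I\}$. For $w\in\mathcal W_{ad}$, $\mathcal S_{\zeta,\eta}(w)$ is the set of mild solutions of $\dot x\in A_\zeta x+F(t,x,u,\zeta)+\mathcal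 Bw(t)$, $\dot u\in-B(t,u,\eta)(u)+G(t,x,u,\eta)$, $x(0)=x_0(\zeta)$, $u(0)=u_0(\eta)$, i.e. pairs $(x,u)\in C(I,E)\times W^{1,2}(I,H)$ with $u(0)=u_0(\eta)$ for which there are integrable $f:I\to E$, $g:I\to H$ such that, for a.e. $t\in I$, $f(t)\in F(t,x(t),u(t),\zeta)$, $g(t)\in G(t,x(t),u(t),\eta)$, $-\dot u(t)+g(t)\in B(t,u(t),\eta)(u(t))$ (in particular $u(t)\in D(B(t,u(t),\eta))$), and for all $t\in I$, $x(t)=T_\zeta(t)x_0(\zeta)+\int_0^tT_\zeta(t-s)(f(s)+\mathcal Bw(s))\,ds$. **Costs.** $\mathcal J_{\zeta,\eta}(x,u)=\int_0^b\ell(t,x(t),u(t),\zeta,\eta)\,dt+\varphi(x(b),u(b),\zeta,\eta)$; $m_{\zeta,\eta}(w)=\inf_{(x,u)\in\mathcal S_{\zeta,\eta}(w)}\mathcal J_{\zeta,\eta}(x,u)$; $\mathcal R(w)=\frac12\int_0^b\|w(t)\|_Y^2\,dt$. *)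

theory Defs
  imports "HOL-Analysis.Analysis"
begin

text \<open>
  Conventions.  The time interval is \<^term>\<open>{0..b}\<close>; functions on it are total functions on the reals
  whose values outside \<^term>\<open>{0..b}\<close> are never used, and elements of Lebesgue spaces are represented by
  functions (not by classes).  Suprema, infima and set distances that may be infinite are taken in
  \<^typ>\<open>ereal\<close>.  In a condition that holds for a.e. t and for all values of other variables, the
  exceptional null set does not depend on those variables, except in the integral bound on the
  modulus inside \<open>HF\<close>, where the variables range over elements of Lebesgue spaces.
\<close>

subsection \<open>Function spaces on the interval\<close>

abbreviation leb :: "real \<Rightarrow> real measure" where
  "leb b \<equiv> lebesgue_on {0..b}"

definition L1_nonneg :: "real \<Rightarrow> (real \<Rightarrow> real) \<Rightarrow> bool" where
  "L1_nonneg b k \<longleftrightarrow> integrable (leb b) k \<and> (\<forall>t\<in>{0..b}. 0 \<le> k t)"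

definition in_L2 :: "real \<Rightarrow> (real \<Rightarrow> 'a::{real_normed_vector, second_countable_topology}) \<Rightarrow> bool" where
  "in_L2 b w \<longleftrightarrow> w \<in> borel_measurable (leb b) \<and> integrable (leb b) (\<lambda>t. (norm (w t))\<^sup>2)"

definition L2_norm :: "real \<Rightarrow> (real \<Rightarrow> 'a::real_normed_vector) \<Rightarrow> real" where
  "L2_norm b w = sqrt (\<integral>t. (norm (w t))\<^sup>2 \<partial>leb b)"

text \<open>
  An element of $W^{1,2}$, always taken as its continuous representative, is the primitive of its
  derivative \<open>v\<close>, which is square integrable and determined up to a null set.
\<close>

definition has_W12_derivative ::
    "real \<Rightarrow> (real \<Rightarrow> 'a::{banach, second_countable_topology}) \<Rightarrow> (real \<Rightarrow> 'a) \<Rightarrow> bool" where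
  "has_W12_derivative b u v \<longleftrightarrow>
     in_L2 b v \<and> (\<forall>t\<in>{0..b}. u t = u 0 + (\<integral>s. v s \<partial>lebesgue_on {0..t}))"

definition in_W12 :: "real \<Rightarrow> (real \<Rightarrow> 'a::{banach, second_countable_topology}) \<Rightarrow> bool" where
  "in_W12 b u \<longleftrightarrow> (\<exists>v. has_W12_derivative b u v)"

definition bounded_in_L2 ::
    "real \<Rightarrow> ((real \<Rightarrow> 'e::{real_normed_vector, second_countable_topology})
      \<times> (real \<Rightarrow> 'h::{real_normed_vector, second_countable_topology})) set \<Rightarrow> bool" where
  "bounded_in_L2 b S \<longleftrightarrow>
     (\<forall>(x, u)\<in>S. in_L2 b x \<and> in_L2 b u) \<and>
     (\<exists>R. \<forall>(x, u)\<in>S. L2_norm b x \<le> R \<and> L2_norm b u \<le> R)"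

definition bounded_in_C ::
    "real \<Rightarrow> ((real \<Rightarrow> 'e::real_normed_vector) \<times> (real \<Rightarrow> 'h::real_normed_vector)) set \<Rightarrow> bool" where
  "bounded_in_C b Q \<longleftrightarrow>
     (\<forall>(x, u)\<in>Q. continuous_on {0..b} x \<and> continuous_on {0..b} u) \<and>
     (\<exists>R. \<forall>(x, u)\<in>Q. \<forall>t\<in>{0..b}. norm (x t) \<le> R \<and> norm (u t) \<le> R)"


subsection \<open>Sets and multifunctions\<close>

definition Haus :: "'a::metric_space set \<Rightarrow> 'a set \<Rightarrow> ereal" where
  "Haus A B = max (SUP a\<in>A. ereal (infdist a B)) (SUP b\<in>B. ereal (infdist b A))"

definition set_norm :: "'a::real_normed_vector set \<Rightarrow> ereal" where
  "set_norm S = (SUP s\<in>S. ereal (norm s))"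

definition weak_topology :: "'a::real_normed_vector topology" where
  "weak_topology = pullback_topology UNIV (\<lambda>x (f :: 'a \<Rightarrow>\<^sub>L real). blinfun_apply f x) euclidean"

definition measurable_multi :: "real \<Rightarrow> (real \<Rightarrow> 'a::topological_space set) \<Rightarrow> bool" where
  "measurable_multi b \<Phi> \<longleftrightarrow> (\<forall>U. open U \<longrightarrow> {t\<in>{0..b}. \<Phi> t \<subseteq> U} \<in> sets lebesgue)"

definition relatively_compact :: "'a::topological_space set \<Rightarrow> bool" where
  "relatively_compact S \<longleftrightarrow> compact (closure S)"

definition ball_relatively_compact :: "'a::real_normed_vector set \<Rightarrow> bool" where
  "ball_relatively_compact S \<longleftrightarrow> (\<forall>r. relatively_compact (S \<inter> cball 0 r))"


subsection \<open>Semigroups\<close>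

definition linear_operator_on :: "'a::real_vector set \<Rightarrow> ('a \<Rightarrow> 'a) \<Rightarrow> bool" where
  "linear_operator_on D A \<longleftrightarrow> subspace D \<and>
     (\<forall>x\<in>D. \<forall>y\<in>D. A (x + y) = A x + A y) \<and> (\<forall>c. \<forall>x\<in>D. A (c *\<^sub>R x) = c *\<^sub>R A x)"

definition C0_semigroup :: "(real \<Rightarrow> 'a::real_normed_vector \<Rightarrow>\<^sub>L 'a) \<Rightarrow> bool" where
  "C0_semigroup T \<longleftrightarrow> T 0 = id_blinfun \<and>
     (\<forall>s\<ge>0. \<forall>t\<ge>0. T (s + t) = T s o\<^sub>L T t) \<and>
     (\<forall>x. ((\<lambda>t. blinfun_apply (T t) x) \<longlongrightarrow> x) (at_right 0))"

definition generates ::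
    "'a::real_normed_vector set \<Rightarrow> ('a \<Rightarrow> 'a) \<Rightarrow> (real \<Rightarrow> 'a \<Rightarrow>\<^sub>L 'a) \<Rightarrow> bool" where
  "generates D A T \<longleftrightarrow> C0_semigroup T \<and>
     D = {x. \<exists>y. ((\<lambda>h. (1 / h) *\<^sub>R (blinfun_apply (T h) x - x)) \<longlongrightarrow> y) (at_right 0)} \<and>
     (\<forall>x\<in>D. ((\<lambda>h. (1 / h) *\<^sub>R (blinfun_apply (T h) x - x)) \<longlongrightarrow> A x) (at_right 0))"

definition compact_operator :: "('a::real_normed_vector \<Rightarrow>\<^sub>L 'b::real_normed_vector) \<Rightarrow> bool" where
  "compact_operator K \<longleftrightarrow> (\<forall>S. bounded S \<longrightarrow> relatively_compact (blinfun_apply K ` S))"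


subsection \<open>Maximal monotone operators\<close>

definition op_dom :: "('a \<Rightarrow> 'b set) \<Rightarrow> 'a set" where
  "op_dom B = {x. B x \<noteq> {}}"

definition monotone_operator :: "('h::real_inner \<Rightarrow> 'h set) \<Rightarrow> bool" where
  "monotone_operator B \<longleftrightarrow> (\<forall>x x'. \<forall>y\<in>B x. \<forall>y'\<in>B x'. 0 \<le> (y - y') \<bullet> (x - x'))"

definition maximal_monotone :: "('h::real_inner \<Rightarrow> 'h set) \<Rightarrow> bool" where
  "maximal_monotone B \<longleftrightarrow> monotone_operator B \<and>
     (\<forall>C. monotone_operator C \<and> (\<forall>x. B x \<subseteq> C x) \<longrightarrow> C = B)"

definition minimal_section :: "('h::real_inner \<Rightarrow> 'h set) \<Rightarrow> 'h \<Rightarrow> 'h" where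
  "minimal_section B v = (THE y. y \<in> B v \<and> (\<forall>z\<in>B v. norm y \<le> norm z))"

definition dis :: "('h::real_inner \<Rightarrow> 'h set) \<Rightarrow> ('h \<Rightarrow> 'h set) \<Rightarrow> ereal" where
  "dis B1 B2 = Sup {ereal (((y - y') \<bullet> (x' - x)) / (1 + norm y + norm y')) | x y x' y'.
     x \<in> op_dom B1 \<and> y \<in> B1 x \<and> x' \<in> op_dom B2 \<and> y' \<in> B2 x'}"


subsection \<open>Hypotheses\<close>

definition HA ::
    "real \<Rightarrow> ('l::metric_space \<Rightarrow> 'e::{real_inner, banach, second_countable_topology} set) \<Rightarrow>
     ('l \<Rightarrow> 'e \<Rightarrow> 'e) \<Rightarrow> ('l \<Rightarrow> real \<Rightarrow> 'e \<Rightarrow>\<^sub>L 'e) \<Rightarrow> bool" where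
  "HA b domA A T \<longleftrightarrow>
     (\<forall>\<zeta>. generates (domA \<zeta>) (A \<zeta>) (T \<zeta>) \<and> (\<forall>t>0. compact_operator (T \<zeta> t))) \<and>
     (\<forall>D. bounded D \<longrightarrow> (\<exists>M>0. \<forall>\<zeta>\<in>D. \<forall>t\<in>{0..b}. norm (T \<zeta> t) \<le> M)) \<and>
     (\<forall>\<zeta>s \<zeta>. \<zeta>s \<longlonglongrightarrow> \<zeta> \<longrightarrow>
        (\<forall>x. uniform_limit {0..b} (\<lambda>n t. blinfun_apply (T (\<zeta>s n) t) x)
               (\<lambda>t. blinfun_apply (T \<zeta> t) x) sequentially) \<and>
        (\<forall>\<delta>. 0 < \<delta> \<and> \<delta> < b \<longrightarrow>
           uniform_limit {\<delta>..b} (\<lambda>n t. T (\<zeta>s n) t) (\<lambda>t. T \<zeta> t) sequentially))"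

definition HB ::
    "real \<Rightarrow> (real \<Rightarrow> 'h::{real_inner, banach, second_countable_topology} \<Rightarrow> 'k::metric_space \<Rightarrow>
       'h \<Rightarrow> 'h set) \<Rightarrow> bool" where
  "HB b B \<longleftrightarrow>
     (\<exists>(\<theta> :: real \<Rightarrow> real) (lam :: real) (lam' :: real).
        in_W12 b \<theta> \<and> 0 \<le> lam \<and> lam < 1 \<and> 0 < lam' \<and>
        (\<forall>t\<in>{0..b}. \<forall>s\<in>{0..b}. \<forall>u v \<eta>1 \<eta>2.
           dis (B t u \<eta>1) (B s v \<eta>2)
             \<le> ereal (\<bar>\<theta> t - \<theta> s\<bar> + lam * norm (u - v) + lam' * dist \<eta>1 \<eta>2))) \<and>
     (\<exists>M>0. \<forall>t\<in>{0..b}. \<forall>u \<eta>. \<forall>v\<in>op_dom (B t u \<eta>).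
        norm (minimal_section (B t u \<eta>) v) \<le> M * (1 + norm u + norm v)) \<and>
     (\<forall>\<Omega>. bounded \<Omega> \<longrightarrow>
        ball_relatively_compact (\<Union>t\<in>{0..b}. \<Union>(u, \<eta>)\<in>\<Omega>. op_dom (B t u \<eta>))) \<and>
     (\<forall>D. bounded D \<longrightarrow> (\<forall>r>0. \<exists>\<rho>. L1_nonneg b \<rho> \<and>
        (\<forall>t\<in>{0..b}. \<forall>u1 u2. \<forall>\<eta>1\<in>D. \<forall>\<eta>2\<in>D. norm u1 \<le> r \<and> norm u2 \<le> r \<longrightarrow>
           (\<forall>v1\<in>B t u1 \<eta>1 u1. \<forall>v2\<in>B t u2 \<eta>2 u2.
              (v1 - v2) \<bullet> (u1 - u2) \<ge> - \<rho> t * (norm (u1 - u2))\<^sup>2))))"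

definition HF ::
    "real \<Rightarrow> (real \<Rightarrow> 'e::{real_inner, banach, second_countable_topology} \<Rightarrow>
       'h::{real_inner, banach, second_countable_topology} \<Rightarrow> 'l::metric_space \<Rightarrow> 'e set) \<Rightarrow> bool" where
  "HF b F \<longleftrightarrow>
     (\<forall>t\<in>{0..b}. \<forall>x u \<zeta>.
        F t x u \<zeta> \<noteq> {} \<and> compactin weak_topology (F t x u \<zeta>) \<and> convex (F t x u \<zeta>)) \<and>
     (\<forall>x u \<zeta>. measurable_multi b (\<lambda>t. F t x u \<zeta>)) \<and>
     (\<forall>D. bounded D \<longrightarrow> (\<exists>k. L1_nonneg b k \<and>
        (AE t in leb b. \<forall>x u y v. \<forall>\<zeta>\<in>D.
           Haus (F t x u \<zeta>) (F t y v \<zeta>) \<le> ereal (k t * (norm (x - y) + norm (u - v)))))) \<and>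
     (\<forall>D. bounded D \<longrightarrow> (\<exists>M>0. AE t in leb b. \<forall>x u. \<forall>\<zeta>\<in>D.
        set_norm (F t x u \<zeta>) \<le> ereal (M * (1 + norm x + norm u)))) \<and>
     (\<exists>(\<gamma> :: real \<Rightarrow> real) (\<rho> :: real \<Rightarrow> real \<Rightarrow> real \<Rightarrow> real).
        (\<gamma> \<longlongrightarrow> 0) (at_right 0) \<and>
        (AE t in leb b. \<forall>x u \<zeta>1 \<zeta>2.
           Haus (F t x u \<zeta>1) (F t x u \<zeta>2) \<le> ereal (\<gamma> (dist \<zeta>1 \<zeta>2) * \<rho> t (norm x) (norm u))) \<and>
        (\<forall>S :: ((real \<Rightarrow> 'e) \<times> (real \<Rightarrow> 'h)) set. bounded_in_L2 b S \<longrightarrow>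
           (\<exists>\<omega>. L1_nonneg b \<omega> \<and>
              (\<forall>(x, u)\<in>S. AE t in leb b. \<rho> t (norm (x t)) (norm (u t)) \<le> \<omega> t))))"

definition HG ::
    "real \<Rightarrow> (real \<Rightarrow> 'e::{real_inner, banach, second_countable_topology} \<Rightarrow>
       'h::{real_inner, banach, second_countable_topology} \<Rightarrow> 'k::metric_space \<Rightarrow> 'h set) \<Rightarrow> bool" where
  "HG b G \<longleftrightarrow>
     (\<forall>t\<in>{0..b}. \<forall>x u \<eta>.
        G t x u \<eta> \<noteq> {} \<and> compactin weak_topology (G t x u \<eta>) \<and> convex (G t x u \<eta>)) \<and>
     (\<forall>x u \<eta>. measurable_multi b (\<lambda>t. G t x u \<eta>)) \<and>
     (\<forall>D. bounded D \<longrightarrow> (\<exists>l. L1_nonneg b l \<and>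
        (AE t in leb b. \<forall>x u y v. \<forall>\<eta>\<in>D.
           Haus (G t x u \<eta>) (G t y v \<eta>) \<le> ereal (l t * (norm (x - y) + norm (u - v)))))) \<and>
     (\<forall>D. bounded D \<longrightarrow> (\<exists>M>0. AE t in leb b. \<forall>x u. \<forall>\<eta>\<in>D.
        set_norm (G t x u \<eta>) \<le> ereal (M * (1 + norm x + norm u)))) \<and>
     (\<exists>(\<gamma> :: real \<Rightarrow> real) (\<rho> :: real \<Rightarrow> real \<Rightarrow> real \<Rightarrow> real).
        (\<gamma> \<longlongrightarrow> 0) (at_right 0) \<and>
        (AE t in leb b. \<forall>x u \<eta>1 \<eta>2.
           Haus (G t x u \<eta>1) (G t x u \<eta>2) \<le> ereal (\<gamma> (dist \<eta>1 \<eta>2) * \<rho> t (norm x) (norm u))) \<and>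
        (\<forall>Q :: ((real \<Rightarrow> 'e) \<times> (real \<Rightarrow> 'h)) set. bounded_in_C b Q \<longrightarrow>
           (\<exists>\<omega>. L1_nonneg b \<omega> \<and>
              (AE t in leb b. \<forall>(x, u)\<in>Q. \<rho> t (norm (x t)) (norm (u t)) \<le> \<omega> t))))"

definition HW ::
    "real \<Rightarrow> (real \<Rightarrow> 'y::{real_inner, banach, second_countable_topology} set) \<Rightarrow> bool" where
  "HW b W \<longleftrightarrow>
     measurable_multi b W \<and>
     (\<forall>t\<in>{0..b}. W t \<noteq> {} \<and> closed (W t) \<and> convex (W t)) \<and>
     (\<exists>\<phi> :: real \<Rightarrow> real. in_L2 b \<phi> \<and> (\<forall>t\<in>{0..b}. 0 \<le> \<phi> t) \<and>
        (AE t in leb b. set_norm (W t) \<le> ereal (\<phi> t)))"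

definition Caratheodory :: "real \<Rightarrow> (real \<Rightarrow> real \<Rightarrow> real) \<Rightarrow> bool" where
  "Caratheodory b \<kappa> \<longleftrightarrow>
     (\<forall>r\<ge>0. (\<lambda>t. \<kappa> t r) \<in> borel_measurable (leb b)) \<and>
     (AE t in leb b. continuous_on {0..} (\<kappa> t))"

definition Hl ::
    "real \<Rightarrow> (real \<Rightarrow> 'e::{real_inner, banach, second_countable_topology} \<Rightarrow>
       'h::{real_inner, banach, second_countable_topology} \<Rightarrow> 'l::metric_space \<Rightarrow> 'k::metric_space \<Rightarrow>
       real) \<Rightarrow> bool" where
  "Hl b l \<longleftrightarrow>
     (\<forall>x u \<zeta> \<eta>. (\<lambda>t. l t x u \<zeta> \<eta>) \<in> borel_measurable (leb b)) \<and>
     (\<exists>\<kappa>. (\<forall>t\<in>{0..b}. \<forall>r\<ge>0. 0 \<le> \<kappa> t r) \<and> Caratheodory b \<kappa> \<and>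
        (AE t in leb b. \<kappa> t 0 = 0) \<and>
        (\<forall>R>0. \<exists>\<beta>. L1_nonneg b \<beta> \<and> (AE t in leb b. \<forall>r\<in>{0..R}. \<kappa> t r \<le> \<beta> t)) \<and>
        (AE t in leb b. \<forall>x y u \<zeta> \<eta>.
           \<bar>l t x u \<zeta> \<eta> - l t y u \<zeta> \<eta>\<bar> \<le> (1 + max (norm x) (norm y)) * \<kappa> t (norm (x - y)))) \<and>
     (AE t in leb b. \<forall>x \<zeta> \<eta>. convex_on UNIV (\<lambda>u. l t x u \<zeta> \<eta>)) \<and>
     (\<forall>D. bounded D \<longrightarrow> (\<exists>\<theta>. L1_nonneg b \<theta> \<and>
        (AE t in leb b. \<forall>u. \<forall>(\<zeta>, \<eta>)\<in>D. \<bar>l t 0 u \<zeta> \<eta>\<bar> \<le> \<theta> t * (1 + norm u)))) \<and>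
     (AE t in leb b. continuous_on UNIV (\<lambda>(x, u, \<zeta>, \<eta>). l t x u \<zeta> \<eta>))"


subsection \<open>The control problem\<close>

definition admissible_controls ::
    "real \<Rightarrow> (real \<Rightarrow> 'y::{real_inner, banach, second_countable_topology} set) \<Rightarrow> (real \<Rightarrow> 'y) set" where
  "admissible_controls b W = {w. in_L2 b w \<and> (AE t in leb b. w t \<in> W t)}"

definition mild_solutions ::
    "real \<Rightarrow> ('l::metric_space \<Rightarrow> real \<Rightarrow> 'e::{real_inner, banach, second_countable_topology} \<Rightarrow>\<^sub>L 'e) \<Rightarrow>
     (real \<Rightarrow> 'h::{real_inner, banach, second_countable_topology} \<Rightarrow> 'k::metric_space \<Rightarrow> 'h \<Rightarrow> 'h set) \<Rightarrow>
     (real \<Rightarrow> 'e \<Rightarrow> 'h \<Rightarrow> 'l \<Rightarrow> 'e set) \<Rightarrow> (real \<Rightarrow> 'e \<Rightarrow> 'h \<Rightarrow> 'k \<Rightarrow> 'h set) \<Rightarrow>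
     ('y::{real_inner, banach, second_countable_topology} \<Rightarrow>\<^sub>L 'e) \<Rightarrow>
     ('l \<Rightarrow> 'e) \<Rightarrow> ('k \<Rightarrow> 'h) \<Rightarrow> 'l \<Rightarrow> 'k \<Rightarrow> (real \<Rightarrow> 'y) \<Rightarrow>
     ((real \<Rightarrow> 'e) \<times> (real \<Rightarrow> 'h)) set" where
  "mild_solutions b T B F G Bop x0 u0 \<zeta> \<eta> w =
     {(x, u). continuous_on {0..b} x \<and> u 0 = u0 \<eta> \<and>
        (\<exists>u' f g. has_W12_derivative b u u' \<and> integrable (leb b) f \<and> integrable (leb b) g \<and>
           (AE t in leb b. f t \<in> F t (x t) (u t) \<zeta> \<and> g t \<in> G t (x t) (u t) \<eta> \<and>
              - u' t + g t \<in> B t (u t) \<eta> (u t)) \<and>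
           (\<forall>t\<in>{0..b}. x t = blinfun_apply (T \<zeta> t) (x0 \<zeta>) +
              (\<integral>s. blinfun_apply (T \<zeta> (t - s)) (f s + blinfun_apply Bop (w s)) \<partial>lebesgue_on {0..t})))}"

definition cost ::
    "real \<Rightarrow> (real \<Rightarrow> 'e \<Rightarrow> 'h \<Rightarrow> 'l \<Rightarrow> 'k \<Rightarrow> real) \<Rightarrow> ('e \<Rightarrow> 'h \<Rightarrow> 'l \<Rightarrow> 'k \<Rightarrow> real) \<Rightarrow>
     'l \<Rightarrow> 'k \<Rightarrow> (real \<Rightarrow> 'e) \<Rightarrow> (real \<Rightarrow> 'h) \<Rightarrow> real" where
  "cost b l \<phi> \<zeta> \<eta> x u = (\<integral>t. l t (x t) (u t) \<zeta> \<eta> \<partial>leb b) + \<phi> (x b) (u b) \<zeta> \<eta>"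

text \<open>The infimum is \<open>\<infinity>\<close> if there is no solution.\<close>

definition min_cost ::
    "real \<Rightarrow> ('l::metric_space \<Rightarrow> real \<Rightarrow> 'e::{real_inner, banach, second_countable_topology} \<Rightarrow>\<^sub>L 'e) \<Rightarrow>
     (real \<Rightarrow> 'h::{real_inner, banach, second_countable_topology} \<Rightarrow> 'k::metric_space \<Rightarrow> 'h \<Rightarrow> 'h set) \<Rightarrow>
     (real \<Rightarrow> 'e \<Rightarrow> 'h \<Rightarrow> 'l \<Rightarrow> 'e set) \<Rightarrow> (real \<Rightarrow> 'e \<Rightarrow> 'h \<Rightarrow> 'k \<Rightarrow> 'h set) \<Rightarrow>
     ('y::{real_inner, banach, second_countable_topology} \<Rightarrow>\<^sub>L 'e) \<Rightarrow>
     ('l \<Rightarrow> 'e) \<Rightarrow> ('k \<Rightarrow> 'h) \<Rightarrow>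
     (real \<Rightarrow> 'e \<Rightarrow> 'h \<Rightarrow> 'l \<Rightarrow> 'k \<Rightarrow> real) \<Rightarrow> ('e \<Rightarrow> 'h \<Rightarrow> 'l \<Rightarrow> 'k \<Rightarrow> real) \<Rightarrow>
     'l \<Rightarrow> 'k \<Rightarrow> (real \<Rightarrow> 'y) \<Rightarrow> ereal" where
  "min_cost b T B F G Bop x0 u0 l \<phi> \<zeta> \<eta> w =
     (INF (x, u)\<in>mild_solutions b T B F G Bop x0 u0 \<zeta> \<eta> w. ereal (cost b l \<phi> \<zeta> \<eta> x u))"

definition control_cost :: "real \<Rightarrow> (real \<Rightarrow> 'y::real_normed_vector) \<Rightarrow> real" where
  "control_cost b w = 1/2 * (\<integral>t. (norm (w t))\<^sup>2 \<partial>leb b)"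

end

theory Submission
  imports Defs
begin

text \<open>
  Direct method on triples (control, state \<open>x\<close>, state \<open>u\<close>). Comparing the monotone inclusion at time
  \<open>s\<close> with the minimal sections at earlier times bounds \<open>u'\<close> pointwise, so a Gronwall argument bounds
  all trajectories uniformly. Compactness of the semigroup and of the domains gives, along a
  subsequence of a minimizing sequence, strong pointwise convergence of the states. The
  velocities \<open>(f, w, g, u')\<close> need not converge, but convex combinations of their tails converge almost
  everywhere; convexity of the values of \<open>F\<close>, \<open>G\<close>, \<open>W\<close> and maximal monotonicity identify the limit as a
  trajectory. The cost of the states converges by dominated convergence and the control cost is
  convex, so the limit is optimal. If no control admits a solution the infimum is infinite, and one
  only needs an admissible control; the selection of minimal norm of \<open>W\<close> is one.
\<close>


subsection \<open>Elements of minimal norm and measurable selections\<close>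

lemma norm_diff_square_midpoint:
  fixes x y :: "'a::real_inner"
  shows "(norm (x - y))\<^sup>2 = 2 * (norm x)\<^sup>2 + 2 * (norm y)\<^sup>2 - 4 * (norm ((1/2) *\<^sub>R x + (1/2) *\<^sub>R y))\<^sup>2"
  by (simp add: power2_norm_eq_inner inner_diff_left inner_diff_right inner_add_left
      inner_add_right inner_commute algebra_simps)

lemma infdist_0_le_norm: "y \<in> S \<Longrightarrow> infdist 0 S \<le> norm y" for y :: "'a::real_normed_vector"
  using infdist_le[of y S 0] by simp

lemma convex_norm_diff_square_le:
  fixes S :: "'a::real_inner set"
  assumes "convex S" "x \<in> S" "y \<in> S"
  shows "(norm (x - y))\<^sup>2 \<le> 2 * (norm x)\<^sup>2 + 2 * (norm y)\<^sup>2 - 4 * (infdist 0 S)\<^sup>2"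
proof -
  have "(1/2) *\<^sub>R x + (1/2) *\<^sub>R y \<in> S"
    using assms by (intro convexD) auto
  then have "(infdist 0 S)\<^sup>2 \<le> (norm ((1/2) *\<^sub>R x + (1/2) *\<^sub>R y))\<^sup>2"
    by (intro power_mono infdist_0_le_norm infdist_nonneg)
  then show ?thesis
    by (simp add: norm_diff_square_midpoint)
qed

lemma infdist_less_imp_dist_less:
  assumes "infdist x S < e" "S \<noteq> {}"
  obtains y where "y \<in> S" "dist x y < e"
  using assms by (metis bdd_below_image_dist cINF_less_iff infdist_notempty)

lemma convex_minimizing_sequence_Cauchy:
  fixes z :: "nat \<Rightarrow> 'a::real_inner"
  assumes "convex S" "\<And>n. z n \<in> S" and lim: "(\<lambda>n. norm (z n)) \<longlonglongrightarrow> infdist 0 S"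
  shows "Cauchy z"
proof (rule CauchyI)
  fix e :: real assume e: "0 < e"
  have "(\<lambda>n. (norm (z n))\<^sup>2) \<longlonglongrightarrow> (infdist 0 S)\<^sup>2"
    by (intro tendsto_intros lim)
  then have "\<forall>\<^sub>F n in sequentially. (norm (z n))\<^sup>2 < (infdist 0 S)\<^sup>2 + e\<^sup>2 / 4"
    by (rule order_tendstoD) (use e in auto)
  then obtain N where N: "\<And>n. n \<ge> N \<Longrightarrow> (norm (z n))\<^sup>2 < (infdist 0 S)\<^sup>2 + e\<^sup>2 / 4"
    by (auto simp: eventually_sequentially)
  have "norm (z m - z n) < e" if "m \<ge> N" "n \<ge> N" for m n
  proof -
    have "(norm (z m - z n))\<^sup>2 \<le> 2 * (norm (z m))\<^sup>2 + 2 * (norm (z n))\<^sup>2 - 4 * (infdist 0 S)\<^sup>2"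
      using assms by (intro convex_norm_diff_square_le) auto
    also have "\<dots> < e\<^sup>2"
      using N[OF that(1)] N[OF that(2)] by linarith
    finally show ?thesis
      using e by (simp add: power2_less_imp_less)
  qed
  then show "\<exists>M. \<forall>m\<ge>M. \<forall>n\<ge>M. norm (z m - z n) < e"
    by blast
qed

lemma LIMSEQ_inverse_Suc: "(\<lambda>n. 1 / real (Suc n)) \<longlonglongrightarrow> 0"
  by (rule LIMSEQ_Suc[OF lim_1_over_n])

lemma closed_convex_infdist_0_attained:
  fixes S :: "'a::{real_inner, banach} set"
  assumes S: "closed S" "convex S" "S \<noteq> {}"
  shows "\<exists>!p. p \<in> S \<and> norm p = infdist 0 S"
proof -
  have "\<exists>z\<in>S. dist 0 z < infdist 0 S + 1 / real (Suc n)" for n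
    by (rule infdist_less_imp_dist_less[of 0 S "infdist 0 S + 1 / real (Suc n)"]) (use S in auto)
  then obtain z where z: "\<And>n. z n \<in> S" "\<And>n. norm (z n) < infdist 0 S + 1 / real (Suc n)"
    unfolding dist_0_norm by metis
  have norm_z: "(\<lambda>n. norm (z n)) \<longlonglongrightarrow> infdist 0 S"
  proof (rule tendsto_sandwich[OF _ _ tendsto_const])
    show "(\<lambda>n. infdist 0 S + 1 / real (Suc n)) \<longlonglongrightarrow> infdist 0 S"
      using tendsto_add[OF tendsto_const LIMSEQ_inverse_Suc] by simp
    show "\<forall>\<^sub>F n in sequentially. infdist 0 S \<le> norm (z n)"
      using z(1) by (intro always_eventually allI infdist_0_le_norm)
    show "\<forall>\<^sub>F n in sequentially. norm (z n) \<le> infdist 0 S + 1 / real (Suc n)"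
      by (intro always_eventually allI less_imp_le z(2))
  qed
  obtain p where p: "z \<longlonglongrightarrow> p"
    using convex_minimizing_sequence_Cauchy[OF S(2) z(1) norm_z]
    by (auto simp: Cauchy_convergent_iff convergent_def)
  have "p \<in> S \<and> norm p = infdist 0 S"
    using closed_sequentially[OF S(1) z(1) p] LIMSEQ_unique[OF tendsto_norm[OF p] norm_z] by simp
  moreover have "x = y" if "x \<in> S \<and> norm x = infdist 0 S" "y \<in> S \<and> norm y = infdist 0 S" for x y
    using convex_norm_diff_square_le[OF S(2), of x y] that by simp
  ultimately show ?thesis
    by blast
qed

definition min_norm_element :: "'a::real_normed_vector set \<Rightarrow> 'a" where
  "min_norm_element S = (THE p. p \<in> S \<and> (\<forall>z\<in>S. norm p \<le> norm z))"

lemma min_norm_element: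
  fixes S :: "'a::{real_inner, banach} set"
  assumes S: "closed S" "convex S" "S \<noteq> {}"
  shows "min_norm_element S \<in> S" "norm (min_norm_element S) = infdist 0 S"
proof -
  obtain p where p: "p \<in> S" "norm p = infdist 0 S"
    using closed_convex_infdist_0_attained[OF S] by blast
  have "x = p" if x: "x \<in> S \<and> (\<forall>z\<in>S. norm x \<le> norm z)" for x
  proof -
    have "norm x = infdist 0 S"
      using x p infdist_0_le_norm[of x S] by (intro antisym) auto
    then show ?thesis
      using x p closed_convex_infdist_0_attained[OF S] by blast
  qed
  moreover have "p \<in> S \<and> (\<forall>z\<in>S. norm p \<le> norm z)"
    using p infdist_0_le_norm by metis
  ultimately have "min_norm_element S = p"
    unfolding min_norm_element_def by (intro the_equality) blast+
  with p show "min_norm_element S \<in> S" "norm (min_norm_element S) = infdist 0 S"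
    by simp_all
qed

lemma tendsto_min_norm_element:
  fixes S :: "'a::{real_inner, banach} set"
  assumes S: "closed S" "convex S" "S \<noteq> {}"
    and near: "(\<lambda>n. infdist (y n) S) \<longlonglongrightarrow> 0" and norm_y: "(\<lambda>n. norm (y n)) \<longlonglongrightarrow> infdist 0 S"
  shows "y \<longlonglongrightarrow> min_norm_element S"
proof -
  have "\<exists>z\<in>S. dist (y n) z < infdist (y n) S + 1 / real (Suc n)" for n
    by (rule infdist_less_imp_dist_less[of "y n" S "infdist (y n) S + 1 / real (Suc n)"])
      (use S in auto)
  then obtain z where z: "\<And>n. z n \<in> S" "\<And>n. dist (y n) (z n) < infdist (y n) S + 1 / real (Suc n)"
    by metis
  have "(\<lambda>n. infdist (y n) S + 1 / real (Suc n)) \<longlonglongrightarrow> 0"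
    using tendsto_add[OF near LIMSEQ_inverse_Suc] by simp
  then have yz: "(\<lambda>n. y n - z n) \<longlonglongrightarrow> 0"
    by (rule Lim_null_comparison[rotated])
      (use z(2) in \<open>auto simp: dist_norm intro!: always_eventually less_imp_le\<close>)
  have "(\<lambda>n. norm (z n) - norm (y n)) \<longlonglongrightarrow> 0"
    by (rule Lim_null_comparison[OF always_eventually tendsto_norm_zero[OF yz]])
      (use norm_triangle_ineq3[of "z _" "y _"] in \<open>simp add: norm_minus_commute\<close>)
  from tendsto_add[OF norm_y this] have "(\<lambda>n. norm (z n)) \<longlonglongrightarrow> infdist 0 S"
    by simp
  then have "(\<lambda>n. 2 * (norm (z n))\<^sup>2 - 2 * (infdist 0 S)\<^sup>2) \<longlonglongrightarrow> 2 * (infdist 0 S)\<^sup>2 - 2 * (infdist 0 S)\<^sup>2"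
    by (intro tendsto_intros)
  then have excess: "(\<lambda>n. 2 * (norm (z n))\<^sup>2 - 2 * (infdist 0 S)\<^sup>2) \<longlonglongrightarrow> 0"
    by simp
  have "(norm (z n - min_norm_element S))\<^sup>2 \<le> 2 * (norm (z n))\<^sup>2 - 2 * (infdist 0 S)\<^sup>2" for n
    using convex_norm_diff_square_le[OF S(2) z(1)[of n] min_norm_element(1)[OF S]]
    unfolding min_norm_element(2)[OF S] by linarith
  then have "(\<lambda>n. (norm (z n - min_norm_element S))\<^sup>2) \<longlonglongrightarrow> 0"
    by (intro tendsto_sandwich[OF _ _ tendsto_const excess] always_eventually allI) simp_all
  then have "(\<lambda>n. sqrt ((norm (z n - min_norm_element S))\<^sup>2)) \<longlonglongrightarrow> sqrt 0"
    by (rule tendsto_real_sqrt)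
  then have "z \<longlonglongrightarrow> min_norm_element S"
    by (simp add: LIM_zero_iff tendsto_norm_zero_iff)
  from tendsto_add[OF yz this] show ?thesis
    by simp
qed

lemma borel_measurable_infdist_multi:
  fixes \<Phi> :: "real \<Rightarrow> 'a::metric_space set"
  assumes \<Phi>: "measurable_multi b \<Phi>" "\<And>t. t \<in> {0..b} \<Longrightarrow> \<Phi> t \<noteq> {}"
  shows "(\<lambda>t. infdist y (\<Phi> t)) \<in> borel_measurable (leb b)"
proof (rule borel_measurableI_ge)
  fix r :: real
  define e where "e n = r - 1 / real (Suc n)" for n
  have "r \<le> infdist y (\<Phi> t) \<longleftrightarrow> (\<forall>n. \<Phi> t \<subseteq> - cball y (e n))" if t: "t \<in> {0..b}" for t
  proof
    assume r_le: "r \<le> infdist y (\<Phi> t)"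
    have "e n < dist y z" if "z \<in> \<Phi> t" for n z
    proof -
      have "e n < r" by (simp add: e_def)
      then show ?thesis using infdist_le[OF that, of y] r_le by linarith
    qed
    then show "\<forall>n. \<Phi> t \<subseteq> - cball y (e n)"
      by (meson ComplI linorder_not_le mem_cball subsetI)
  next
    assume "\<forall>n. \<Phi> t \<subseteq> - cball y (e n)"
    then have "e n \<le> dist y z" if "z \<in> \<Phi> t" for n z
      using that by (metis ComplD linear mem_cball subsetD)
    then have "e n \<le> infdist y (\<Phi> t)" for n
      using \<Phi>(2)[OF t] by (auto simp: infdist_notempty intro!: cINF_greatest)
    moreover have "e \<longlonglongrightarrow> r"
      unfolding e_def using tendsto_diff[OF tendsto_const LIMSEQ_inverse_Suc, of r] by simp
    ultimately show "r \<le> infdist y (\<Phi> t)"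
      by (intro LIMSEQ_le_const2) auto
  qed
  then have "{t \<in> space (leb b). r \<le> infdist y (\<Phi> t)} = (\<Inter>n. {t \<in> {0..b}. \<Phi> t \<subseteq> - cball y (e n)})"
    by auto
  also have "\<dots> \<in> sets lebesgue"
    using \<Phi>(1) closed_cball unfolding measurable_multi_def by (intro sets.countable_INT) auto
  finally show "{t \<in> space (leb b). r \<le> infdist y (\<Phi> t)} \<in> sets (leb b)"
    by (auto simp: sets_restrict_space_iff)
qed

lemma tendsto_min_norm_element_inverse_Suc:
  fixes S :: "'a::{real_inner, banach} set"
  assumes S: "closed S" "convex S" "S \<noteq> {}"
    and near: "\<And>n. infdist (y n) S < 1 / real (Suc n)"
    and norm_y: "\<And>n. norm (y n) < infdist 0 S + 1 / real (Suc n)"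
  shows "y \<longlonglongrightarrow> min_norm_element S"
proof (rule tendsto_min_norm_element[OF S])
  have "infdist 0 S - 1 / real (Suc n) \<le> norm (y n)" for n
    using infdist_triangle[of 0 S "y n"] near[of n] by simp
  then have "\<bar>norm (y n) - infdist 0 S\<bar> \<le> 1 / real (Suc n)" for n
    using norm_y[of n] by (auto simp: abs_le_iff algebra_simps less_imp_le)
  then have "(\<lambda>n. norm (y n) - infdist 0 S) \<longlonglongrightarrow> 0"
    by (intro Lim_null_comparison[OF _ LIMSEQ_inverse_Suc]) (auto intro!: always_eventually)
  then show "(\<lambda>n. norm (y n)) \<longlonglongrightarrow> infdist 0 S"
    by (simp add: LIM_zero_iff)
  show "(\<lambda>n. infdist (y n) S) \<longlonglongrightarrow> 0"
    by (rule Lim_null_comparison[OF _ LIMSEQ_inverse_Suc])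
      (use near[THEN less_imp_le] in \<open>auto simp: infdist_nonneg intro!: always_eventually\<close>)
qed

lemma countable_dense_sequence:
  "\<exists>d :: nat \<Rightarrow> 'a::{metric_space, second_countable_topology}. \<forall>x. \<forall>e>0. \<exists>i. dist (d i) x < e"
proof -
  obtain D :: "'a set" where D: "countable D" "\<And>U. open U \<Longrightarrow> U \<noteq> {} \<Longrightarrow> \<exists>d\<in>D. d \<in> U"
    using countable_dense_setE by metis
  have "\<exists>i. dist (from_nat_into D i) x < e" if "e > 0" for x e
  proof -
    have "\<exists>d\<in>D. d \<in> ball x e"
      using that by (intro D(2)) auto
    then show ?thesis
      using from_nat_into_surj[OF D(1)] by (metis dist_commute mem_ball)
  qed
  then show ?thesis
    by blast
qed

lemma borel_measurable_min_norm_element: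
  fixes \<Phi> :: "real \<Rightarrow> 'a::{real_inner, banach, second_countable_topology} set"
  assumes \<Phi>: "measurable_multi b \<Phi>"
    and convex_values: "\<And>t. t \<in> {0..b} \<Longrightarrow> closed (\<Phi> t) \<and> convex (\<Phi> t) \<and> \<Phi> t \<noteq> {}"
  shows "(\<lambda>t. min_norm_element (\<Phi> t)) \<in> borel_measurable (leb b)"
proof -
  obtain d :: "nat \<Rightarrow> 'a" where dense: "\<forall>x. \<forall>e>0. \<exists>i. dist (d i) x < e"
    using countable_dense_sequence by (rule exE)
  have [measurable]: "(\<lambda>t. infdist y (\<Phi> t)) \<in> borel_measurable (leb b)" for y
    using convex_values by (intro borel_measurable_infdist_multi[OF \<Phi>]) auto
  define almost_min where "almost_min n t i \<longleftrightarrow> infdist (d i) (\<Phi> t) < 1 / real (Suc n)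
      \<and> norm (d i) < infdist 0 (\<Phi> t) + 1 / real (Suc n)" for n t i
  define q where "q n t = d (LEAST i. almost_min n t i)" for n t
  have almost_min_ex: "\<exists>i. almost_min n t i" if t: "t \<in> {0..b}" for n t
  proof -
    note p = min_norm_element[of "\<Phi> t"]
    obtain i where i: "dist (d i) (min_norm_element (\<Phi> t)) < 1 / real (Suc n)"
      using dense[rule_format, of "1 / real (Suc n)"] by auto
    then have "infdist (d i) (\<Phi> t) < 1 / real (Suc n)"
      using infdist_le p(1) convex_values[OF t] by (meson le_less_trans)
    moreover have "norm (d i) < infdist 0 (\<Phi> t) + 1 / real (Suc n)"
      using i norm_triangle_ineq2[of "d i" "min_norm_element (\<Phi> t)"] p(2) convex_values[OF t]
      by (auto simp: dist_norm)
    ultimately show ?thesis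
      by (auto simp: almost_min_def)
  qed
  have q_measurable: "q n \<in> borel_measurable (leb b)" for n
  proof -
    have [measurable]: "Measurable.pred (leb b) (\<lambda>t. almost_min n t i)" for i
      unfolding almost_min_def by measurable
    have "(\<lambda>t. LEAST i. almost_min n t i) \<in> measurable (leb b) (count_space UNIV)"
      by measurable
    then show ?thesis
      unfolding q_def by (rule measurable_compose) simp
  qed
  have q_tendsto: "(\<lambda>n. q n t) \<longlonglongrightarrow> min_norm_element (\<Phi> t)" if t: "t \<in> {0..b}" for t
  proof (rule tendsto_min_norm_element_inverse_Suc)
    have "almost_min n t (LEAST i. almost_min n t i)" for n
      using almost_min_ex[OF t] by (rule LeastI_ex)
    then show "infdist (q n t) (\<Phi> t) < 1 / real (Suc n)"
      "norm (q n t) < infdist 0 (\<Phi> t) + 1 / real (Suc n)" for n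
      unfolding almost_min_def q_def by blast+
  qed (use convex_values[OF t] in auto)
  show ?thesis
    by (rule borel_measurable_LIMSEQ_metric[of q]) (use q_measurable q_tendsto in auto)
qed


subsection \<open>Monotone operators, Hausdorff distance, weak topology\<close>

lemma maximal_monotone_mem_iff:
  assumes B: "maximal_monotone B"
  shows "v \<in> B u \<longleftrightarrow> (\<forall>z. \<forall>y\<in>B z. 0 \<le> (v - y) \<bullet> (u - z))"
proof
  assume "v \<in> B u"
  then show "\<forall>z. \<forall>y\<in>B z. 0 \<le> (v - y) \<bullet> (u - z)"
    using B unfolding maximal_monotone_def monotone_operator_def by blast
next
  assume related: "\<forall>z. \<forall>y\<in>B z. 0 \<le> (v - y) \<bullet> (u - z)"
  define C where "C = B (u := insert v (B u))"
  have "0 \<le> (y - v) \<bullet> (z - u)" if "y \<in> B z" for y z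
    using related that by (metis inner_minus_left inner_minus_right minus_diff_eq minus_minus)
  then have "monotone_operator C"
    using B related unfolding maximal_monotone_def monotone_operator_def
    by (auto simp: C_def split: if_splits)
  moreover have "\<forall>x. B x \<subseteq> C x"
    by (auto simp: C_def)
  ultimately have "C = B"
    using B unfolding maximal_monotone_def by blast
  then show "v \<in> B u"
    by (metis C_def fun_upd_same insertI1)
qed

lemma maximal_monotone_closed_convex:
  assumes "maximal_monotone B"
  shows "closed (B u)" "convex (B u)"
proof -
  have inner_diff: "(v - y) \<bullet> (u - z) = (u - z) \<bullet> v - (u - z) \<bullet> y" for v y z
    by (metis inner_commute inner_diff_right)
  have halfspaces: "B u = (\<Inter>z. \<Inter>y\<in>B z. {v. (u - z) \<bullet> v \<ge> (u - z) \<bullet> y})"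
    by (rule set_eqI, subst maximal_monotone_mem_iff[OF assms]) (simp add: inner_diff)
  show "closed (B u)"
    unfolding halfspaces by (intro closed_INT ballI closed_halfspace_ge)
  show "convex (B u)"
    unfolding halfspaces by (intro convex_INT convex_halfspace_ge)
qed

lemma minimal_section_mem:
  fixes B :: "'h::{real_inner, banach} \<Rightarrow> 'h set"
  assumes "maximal_monotone B" "v \<in> op_dom B"
  shows "minimal_section B v \<in> B v"
proof -
  have "minimal_section B v = min_norm_element (B v)"
    by (simp add: minimal_section_def min_norm_element_def)
  also have "\<dots> \<in> B v"
    using maximal_monotone_closed_convex[OF assms(1)] assms(2)
    by (intro min_norm_element) (auto simp: op_dom_def)
  finally show ?thesis .
qed

lemma dis_leD:
  assumes "dis B1 B2 \<le> ereal c" "y \<in> B1 x" "y' \<in> B2 x'"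
  shows "(y - y') \<bullet> (x' - x) \<le> (1 + norm y + norm y') * c"
proof -
  have "ereal (((y - y') \<bullet> (x' - x)) / (1 + norm y + norm y')) \<le> dis B1 B2"
    unfolding dis_def using assms(2,3) by (intro Sup_upper) (force simp: op_dom_def)
  then have "((y - y') \<bullet> (x' - x)) / (1 + norm y + norm y') \<le> c"
    using assms(1) by (metis ereal_less_eq(3) order_trans)
  moreover have "1 + norm y + norm y' > 0"
    by (simp add: add_pos_nonneg)
  ultimately show ?thesis
    by (simp add: pos_divide_le_eq mult.commute)
qed

lemma set_norm_leD: "set_norm S \<le> ereal c \<Longrightarrow> s \<in> S \<Longrightarrow> norm s \<le> c"
  unfolding set_norm_def by (auto simp: SUP_le_iff)

lemma Haus_leD:
  assumes "Haus A B \<le> ereal c" "a \<in> A"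
  shows "infdist a B \<le> c"
proof -
  have "ereal (infdist a B) \<le> (SUP a\<in>A. ereal (infdist a B))"
    using assms(2) by (rule SUP_upper)
  also have "\<dots> \<le> Haus A B"
    by (simp add: Haus_def)
  also note assms(1)
  finally show ?thesis
    by simp
qed

lemma Hausdorff_weak_topology: "Hausdorff_space (weak_topology :: 'a::real_inner topology)"
proof -
  let ?eval = "\<lambda>x (f :: 'a \<Rightarrow>\<^sub>L real). blinfun_apply f x"
  have "inj ?eval"
  proof (rule injI)
    fix x y assume eval_eq: "?eval x = ?eval y"
    have "(x - y) \<bullet> x = (x - y) \<bullet> y"
      using fun_cong[OF eval_eq, of "blinfun_inner_right (x - y)"] by simp
    then have "(x - y) \<bullet> (x - y) = 0"
      by (simp add: inner_diff_right)
    then show "x = y"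
      by simp
  qed
  moreover have "continuous_map weak_topology euclidean ?eval"
    using continuous_map_pullback[OF continuous_map_id, of UNIV ?eval euclidean]
    unfolding weak_topology_def by simp
  moreover have "Hausdorff_space (euclidean :: (('a \<Rightarrow>\<^sub>L real) \<Rightarrow> real) topology)"
    by (simp add: Hausdorff_space_product_topology flip: euclidean_product_topology)
  ultimately show ?thesis
    by (meson Hausdorff_space_injective_preimage inj_on_subset subset_UNIV)
qed

lemma weakly_compact_imp_closed:
  fixes C :: "'a::real_inner set"
  assumes "compactin weak_topology C"
  shows "closed C"
proof -
  have "closedin weak_topology C"
    using assms compactin_imp_closedin Hausdorff_weak_topology by blast
  moreover have "continuous_map euclidean weak_topology (\<lambda>x::'a. x)"
    unfolding weak_topology_def
  proof (rule continuous_map_pullback')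
    show "continuous_map euclidean euclidean ((\<lambda>x (f :: 'a \<Rightarrow>\<^sub>L real). blinfun_apply f x) \<circ> (\<lambda>x. x))"
      by (auto simp: o_def intro!: continuous_on_coordinatewise_then_product continuous_intros)
  qed auto
  ultimately have "closedin euclidean {x \<in> topspace euclidean. x \<in> C}"
    by (rule closedin_continuous_map_preimage[rotated])
  then show ?thesis
    by simp
qed


subsection \<open>Integrals over intervals\<close>

lemma integrable_lebesgue_on_subset:
  fixes f :: "'a::euclidean_space \<Rightarrow> 'b::{banach, second_countable_topology}"
  assumes "integrable (lebesgue_on S) f" "T \<subseteq> S" "S \<in> sets lebesgue" "T \<in> sets lebesgue"
  shows "integrable (lebesgue_on T) f"
  using set_integrable_subset[of lebesgue S f T] assms
  by (simp add: integrable_restrict_space set_integrable_def)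

lemma integral_lebesgue_on_subset:
  fixes f :: "'a::euclidean_space \<Rightarrow> 'b::{banach, second_countable_topology}"
  assumes "T \<subseteq> S" "S \<in> sets lebesgue" "T \<in> sets lebesgue"
  shows "(\<integral>x. f x \<partial>lebesgue_on T) = (\<integral>x. indicator T x *\<^sub>R f x \<partial>lebesgue_on S)"
proof -
  have "(\<lambda>x. indicator S x *\<^sub>R (indicator T x *\<^sub>R f x)) = (\<lambda>x. indicator T x *\<^sub>R f x)"
    using assms by (auto simp: fun_eq_iff indicator_def)
  then show ?thesis
    using assms by (simp add: integral_restrict_space)
qed

lemma integral_lebesgue_on_combine:
  fixes f :: "real \<Rightarrow> 'a::{banach, second_countable_topology}"
  assumes f: "integrable (lebesgue_on {a..b}) f" and between: "a \<le> c" "c \<le> b"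
  shows "(\<integral>x. f x \<partial>lebesgue_on {a..b}) = (\<integral>x. f x \<partial>lebesgue_on {a..c}) + (\<integral>x. f x \<partial>lebesgue_on {c..b})"
proof -
  have "(LINT x:{a..c} \<union> {c..b}|lebesgue. f x) = (LINT x:{a..c}|lebesgue. f x) + (LINT x:{c..b}|lebesgue. f x)"
  proof (rule set_integral_Un_AE)
    show "AE x in lebesgue. \<not> (x \<in> {a..c} \<and> x \<in> {c..b})"
      by (rule AE_I'[of "{c}"]) auto
    show "set_integrable lebesgue {a..c} f" "set_integrable lebesgue {c..b} f"
      using integrable_lebesgue_on_subset[OF f, of "{a..c}"] integrable_lebesgue_on_subset[OF f, of "{c..b}"] between
      by (auto simp: integrable_restrict_space set_integrable_def)
  qed auto
  moreover have "{a..c} \<union> {c..b} = {a..b}"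
    using between by auto
  ultimately show ?thesis
    by (simp add: integral_restrict_space set_lebesgue_integral_def)
qed

lemma integral_norm_bound_AE:
  fixes f :: "'a \<Rightarrow> 'b::{banach, second_countable_topology}"
  assumes "integrable M g" "AE x in M. norm (f x) \<le> g x"
  shows "norm (\<integral>x. f x \<partial>M) \<le> (\<integral>x. g x \<partial>M)"
proof (cases "integrable M f")
  case True
  have "norm (\<integral>x. f x \<partial>M) \<le> (\<integral>x. norm (f x) \<partial>M)"
    by simp
  also have "\<dots> \<le> (\<integral>x. g x \<partial>M)"
    using True assms by (intro integral_mono_AE) auto
  finally show ?thesis .
next
  case False
  have "AE x in M. 0 \<le> g x"
    using assms(2) by eventually_elim (use norm_ge_zero order_trans in blast)
  then show ?thesis
    using False by (simp add: not_integrable_integral_eq integral_nonneg_AE)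
qed

lemma AE_lebesgue_on_iff:
  "S \<in> sets lebesgue \<Longrightarrow> (AE t in lebesgue_on S. P t) \<longleftrightarrow> (AE t in lebesgue. t \<in> S \<longrightarrow> P t)"
  by (rule AE_restrict_space_iff) simp

lemma AE_lebesgue_on_subset:
  assumes "AE t in lebesgue_on S. P t" "T \<subseteq> S" "S \<in> sets lebesgue" "T \<in> sets lebesgue"
  shows "AE t in lebesgue_on T. P t"
  using assms by (auto simp: AE_lebesgue_on_iff elim!: eventually_mono)

lemma AE_lebesgue_on_mem: "AE t in lebesgue_on S. t \<in> S"
  by (rule AE_I2) simp

lemma AE_interval_neq: "AE t in lebesgue_on {a..b::real}. t \<noteq> c"
proof -
  have "AE t in lebesgue. t \<noteq> c"
    by (rule AE_I'[of "{c}"]) auto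
  then show ?thesis
    by (auto simp: AE_lebesgue_on_iff elim!: eventually_mono)
qed

lemma integral_lebesgue_on_singleton [simp]: "(\<integral>x. f x \<partial>lebesgue_on {a :: real}) = 0"
proof (rule integral_eq_zero_AE)
  show "AE x in lebesgue_on {a}. f x = 0"
    using AE_lebesgue_on_mem[of "{a}"] AE_interval_neq[of a a a, unfolded atLeastAtMost_singleton]
    by eventually_elim simp
qed

lemma integral_interval_affine_le:
  fixes \<alpha> p :: "real \<Rightarrow> real"
  assumes \<alpha>: "integrable (lebesgue_on {a..b}) \<alpha>" "AE s in lebesgue_on {a..b}. 0 \<le> \<alpha> s"
    and p: "integrable (lebesgue_on {a..b}) p" and t: "a \<le> t" "t \<le> b"
  shows "(\<integral>s. \<alpha> s + c * p s \<partial>lebesgue_on {a..t})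
    \<le> (\<integral>s. \<alpha> s \<partial>lebesgue_on {a..b}) + c * (\<integral>s. p s \<partial>lebesgue_on {a..t})"
proof -
  have "0 \<le> (\<integral>s. \<alpha> s \<partial>lebesgue_on {t..b})"
    using t by (intro integral_nonneg_AE AE_lebesgue_on_subset[OF \<alpha>(2)]) auto
  then have "(\<integral>s. \<alpha> s \<partial>lebesgue_on {a..t}) \<le> (\<integral>s. \<alpha> s \<partial>lebesgue_on {a..b})"
    using integral_lebesgue_on_combine[OF \<alpha>(1) t] by simp
  moreover have "integrable (lebesgue_on {a..t}) \<alpha>" "integrable (lebesgue_on {a..t}) p"
    using t by (auto intro: integrable_lebesgue_on_subset[OF \<alpha>(1)] integrable_lebesgue_on_subset[OF p])
  then have "(\<integral>s. \<alpha> s + c * p s \<partial>lebesgue_on {a..t})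
      = (\<integral>s. \<alpha> s \<partial>lebesgue_on {a..t}) + c * (\<integral>s. p s \<partial>lebesgue_on {a..t})"
    by simp
  ultimately show ?thesis
    by simp
qed

lemma AE_interval_closure:
  fixes a b :: real
  assumes "AE t in lebesgue_on {a..b}. P t" "a < b"
  shows "{a..b} \<subseteq> closure {t \<in> {a<..<b}. P t}"
proof -
  have "AE t\<in>{a<..<b} in lebesgue. t \<in> closure {t \<in> {a<..<b}. P t}"
    using assms(1) by (auto simp: AE_lebesgue_on_iff elim!: eventually_mono intro: closure_subset[THEN subsetD])
  then have "{a<..<b} \<subseteq> closure {t \<in> {a<..<b}. P t}"
    by (intro subsetI mem_closed_if_AE_lebesgue_open[OF open_greaterThanLessThan closed_closure])
  then have "closure {a<..<b} \<subseteq> closure {t \<in> {a<..<b}. P t}"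
    by (simp add: closure_minimal)
  then show ?thesis
    using assms(2) by simp
qed

lemma AE_interval_at_left_within_nontrivial:
  fixes a b :: real
  assumes "AE t in lebesgue_on {a..b}. P t" "a < s" "s \<le> b"
  shows "at s within {t \<in> {a<..<s}. P t} \<noteq> bot"
proof -
  have "AE t in lebesgue_on {a..s}. P t"
    using assms by (intro AE_lebesgue_on_subset[OF assms(1)]) auto
  then have "s \<in> closure {t \<in> {a<..<s}. P t}"
    using AE_interval_closure assms(2) by fastforce
  moreover have "{t \<in> {a<..<s}. P t} - {s} = {t \<in> {a<..<s}. P t}"
    by auto
  ultimately show ?thesis
    by (simp add: trivial_limit_within islimpt_in_closure)
qed

lemma AE_interval_continuous_closed:
  fixes f :: "real \<Rightarrow> 'a::topological_space"
  assumes f: "continuous_on {a..b} f" and K: "closed K" and ae: "AE t in lebesgue_on {a..b}. f t \<in> K"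
    and "a < b" "t \<in> {a..b}"
  shows "f t \<in> K"
proof -
  have "closed ({a..b} \<inter> f -` K)"
    by (rule continuous_closed_preimage[OF f _ K]) simp
  then have "closure {t \<in> {a<..<b}. f t \<in> K} \<subseteq> {a..b} \<inter> f -` K"
    by (intro closure_minimal) auto
  then show ?thesis
    using AE_interval_closure[OF ae \<open>a < b\<close>] \<open>t \<in> {a..b}\<close> by blast
qed

lemma integral_interval_eq_diff:
  fixes f :: "real \<Rightarrow> 'a::{banach, second_countable_topology}"
  assumes "integrable (lebesgue_on {a..b}) f" "a \<le> s" "s \<le> t" "t \<le> b"
  shows "(\<integral>x. f x \<partial>lebesgue_on {s..t}) = (\<integral>x. f x \<partial>lebesgue_on {a..t}) - (\<integral>x. f x \<partial>lebesgue_on {a..s})"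
proof -
  have "integrable (lebesgue_on {a..t}) f"
    using assms by (intro integrable_lebesgue_on_subset[OF assms(1)]) auto
  from integral_lebesgue_on_combine[OF this assms(2,3)] show ?thesis
    by simp
qed

lemma integral_interval_tendsto_0:
  fixes f :: "real \<Rightarrow> real"
  assumes f: "integrable (lebesgue_on {a..b}) f"
  shows "a \<le> t \<Longrightarrow> t < b \<Longrightarrow> ((\<lambda>s. \<integral>x. f x \<partial>lebesgue_on {t..s}) \<longlongrightarrow> 0) (at_right t)"
    and "a < t \<Longrightarrow> t \<le> b \<Longrightarrow> ((\<lambda>s. \<integral>x. f x \<partial>lebesgue_on {s..t}) \<longlongrightarrow> 0) (at_left t)"
proof -
  define \<Phi> where "\<Phi> t = (\<integral>x. f x \<partial>lebesgue_on {a..t})" for t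
  have \<Phi>: "continuous_on {a..b} \<Phi>"
    unfolding \<Phi>_def by (rule indefinite_integral_continuous_real[OF f])
  have \<Phi>_diff: "(\<integral>x. f x \<partial>lebesgue_on {s..t}) = \<Phi> t - \<Phi> s" if "a \<le> s" "s \<le> t" "t \<le> b" for s t
    unfolding \<Phi>_def by (rule integral_interval_eq_diff[OF f that])
  show "((\<lambda>s. \<integral>x. f x \<partial>lebesgue_on {t..s}) \<longlongrightarrow> 0) (at_right t)" if t: "a \<le> t" "t < b"
  proof (rule Lim_transform_eventually)
    have "(\<Phi> \<longlongrightarrow> \<Phi> t) (at_right t)"
      using continuous_on_subset[OF \<Phi>, of "{t..b}"] t by (intro continuous_on_Icc_at_rightD) auto
    then show "((\<lambda>s. \<Phi> s - \<Phi> t) \<longlongrightarrow> 0) (at_right t)"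
      by (simp add: LIM_zero)
    show "\<forall>\<^sub>F s in at_right t. \<Phi> s - \<Phi> t = (\<integral>x. f x \<partial>lebesgue_on {t..s})"
      unfolding eventually_at_right_field using \<Phi>_diff t by (intro exI[of _ b]) auto
  qed
  show "((\<lambda>s. \<integral>x. f x \<partial>lebesgue_on {s..t}) \<longlongrightarrow> 0) (at_left t)" if t: "a < t" "t \<le> b"
  proof (rule Lim_transform_eventually)
    have "(\<Phi> \<longlongrightarrow> \<Phi> t) (at_left t)"
      using continuous_on_subset[OF \<Phi>, of "{a..t}"] t by (intro continuous_on_Icc_at_leftD) auto
    then show "((\<lambda>s. \<Phi> t - \<Phi> s) \<longlongrightarrow> 0) (at_left t)"
      using tendsto_diff[OF tendsto_const, of \<Phi> "\<Phi> t" _ "\<Phi> t"] by simp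
    show "\<forall>\<^sub>F s in at_left t. \<Phi> t - \<Phi> s = (\<integral>x. f x \<partial>lebesgue_on {s..t})"
      unfolding eventually_at_left_field using \<Phi>_diff t by (intro exI[of _ a]) auto
  qed
qed


subsection \<open>Square integrable functions and primitives\<close>

lemma in_L2_integrable:
  fixes v :: "real \<Rightarrow> 'a::{banach, second_countable_topology}"
  assumes "in_L2 b v"
  shows "integrable (leb b) v"
proof -
  interpret finite_measure "leb b"
    by (rule finite_measure_lebesgue_on) simp
  have "integrable (leb b) (\<lambda>t. norm (v t))"
    by (rule square_integrable_imp_integrable) (use assms in \<open>auto simp: in_L2_def\<close>)
  then show ?thesis
    using assms by (simp add: in_L2_def integrable_norm_iff)
qed

lemma in_L2_dominated:
  fixes v :: "real \<Rightarrow> 'a::{real_normed_vector, second_countable_topology}"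
  assumes v: "v \<in> borel_measurable (leb b)" and "in_L2 b m" "AE t in leb b. norm (v t) \<le> m t"
  shows "in_L2 b v"
proof -
  have "integrable (leb b) (\<lambda>t. (norm (v t))\<^sup>2)"
  proof (rule Bochner_Integration.integrable_bound)
    show "integrable (leb b) (\<lambda>t. (m t)\<^sup>2)"
      using assms(2) by (simp add: in_L2_def)
    show "AE t in leb b. norm ((norm (v t))\<^sup>2) \<le> norm ((m t)\<^sup>2)"
      using assms(3) by eventually_elim (simp add: power_mono)
  qed (use v in measurable)
  with v show ?thesis
    by (simp add: in_L2_def)
qed

lemma in_L2_add:
  fixes v w :: "real \<Rightarrow> 'a::{real_normed_vector, second_countable_topology}"
  assumes "in_L2 b v" "in_L2 b w"
  shows "in_L2 b (\<lambda>t. v t + w t)"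
proof -
  have "integrable (leb b) (\<lambda>t. (norm (v t + w t))\<^sup>2)"
  proof (rule Bochner_Integration.integrable_bound)
    show "integrable (leb b) (\<lambda>t. 2 * (norm (v t))\<^sup>2 + 2 * (norm (w t))\<^sup>2)"
      using assms by (auto simp: in_L2_def)
    have "(norm (v t + w t))\<^sup>2 \<le> 2 * (norm (v t))\<^sup>2 + 2 * (norm (w t))\<^sup>2" for t
    proof -
      have "(norm (v t + w t))\<^sup>2 \<le> (norm (v t) + norm (w t))\<^sup>2"
        by (intro power_mono norm_triangle_ineq) simp
      then show ?thesis
        using sum_squares_bound[of "norm (v t)" "norm (w t)"] by (simp add: power2_sum)
    qed
    then show "AE t in leb b. norm ((norm (v t + w t))\<^sup>2) \<le> norm (2 * (norm (v t))\<^sup>2 + 2 * (norm (w t))\<^sup>2)"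
      by simp
  qed (use assms in \<open>auto simp: in_L2_def\<close>)
  then show ?thesis
    using assms by (auto simp: in_L2_def)
qed

lemma in_L2_mult_left: "in_L2 b v \<Longrightarrow> in_L2 b (\<lambda>t. c * v t :: real)"
  by (auto simp: in_L2_def power_mult_distrib)

lemma in_L2_const: "in_L2 b (\<lambda>t. c)"
proof -
  interpret finite_measure "leb b"
    by (rule finite_measure_lebesgue_on) simp
  show ?thesis
    by (simp add: in_L2_def)
qed

lemma in_L2_norm: "in_L2 b v \<Longrightarrow> in_L2 b (\<lambda>t. norm (v t))"
  by (auto simp: in_L2_def)

lemma has_W12_derivative_integrable: "has_W12_derivative b u v \<Longrightarrow> integrable (leb b) v"
  by (simp add: has_W12_derivative_def in_L2_integrable)

lemma has_W12_derivative_diff: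
  assumes u: "has_W12_derivative b u v" and st: "0 \<le> s" "s \<le> t" "t \<le> b"
  shows "u t - u s = (\<integral>x. v x \<partial>lebesgue_on {s..t})"
proof -
  have "\<forall>t\<in>{0..b}. u t = u 0 + (\<integral>s. v s \<partial>lebesgue_on {0..t})"
    using u unfolding has_W12_derivative_def by blast
  then have "u t = u 0 + (\<integral>x. v x \<partial>lebesgue_on {0..t})" "u s = u 0 + (\<integral>x. v x \<partial>lebesgue_on {0..s})"
    using st by (meson atLeastAtMost_iff order_trans)+
  then show ?thesis
    using integral_interval_eq_diff[OF has_W12_derivative_integrable[OF u] st] by simp
qed

lemma has_W12_derivative_norm_diff_le:
  assumes u: "has_W12_derivative b u v" and st: "0 \<le> s" "s \<le> t" "t \<le> b"
    and m: "integrable (leb b) m" "AE x in leb b. norm (v x) \<le> m x"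
  shows "norm (u t - u s) \<le> (\<integral>x. m x \<partial>lebesgue_on {s..t})"
  unfolding has_W12_derivative_diff[OF u st]
  using st by (intro integral_norm_bound_AE integrable_lebesgue_on_subset[OF m(1)]
      AE_lebesgue_on_subset[OF m(2)]) auto

lemma continuous_on_dist_le:
  fixes f :: "'a::metric_space \<Rightarrow> 'b::metric_space" and g :: "'a \<Rightarrow> 'c::metric_space"
  assumes "continuous_on S g" "\<And>s t. s \<in> S \<Longrightarrow> t \<in> S \<Longrightarrow> dist (f s) (f t) \<le> dist (g s) (g t)"
  shows "continuous_on S f"
  using assms unfolding continuous_on_iff by (meson le_less_trans)

lemma has_W12_derivative_continuous:
  assumes u: "has_W12_derivative b u v"
  shows "continuous_on {0..b} u"
proof (rule continuous_on_dist_le)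
  define V where "V t = (\<integral>x. norm (v x) \<partial>lebesgue_on {0..t})" for t
  have nv: "integrable (leb b) (\<lambda>x. norm (v x))"
    using has_W12_derivative_integrable[OF u] by simp
  then show "continuous_on {0..b} V"
    unfolding V_def by (rule indefinite_integral_continuous_real)
  have dist_le: "dist (u s) (u t) \<le> dist (V s) (V t)" if "0 \<le> s" "s \<le> t" "t \<le> b" for s t
    using has_W12_derivative_norm_diff_le[OF u that nv] integral_interval_eq_diff[OF nv that]
    by (simp add: dist_norm norm_minus_commute V_def)
  show "dist (u s) (u t) \<le> dist (V s) (V t)" if "s \<in> {0..b}" "t \<in> {0..b}" for s t
    using dist_le[of s t] dist_le[of t s] that by (cases "s \<le> t") (auto simp: dist_commute)
qed

lemma has_W12_derivative_right_equicontinuous: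
  assumes u: "\<And>i. has_W12_derivative b (u i) (v i)"
    and m: "integrable (leb b) m" "\<And>i. AE x in leb b. norm (v i x) \<le> m x"
    and t: "0 \<le> t" "t < b"
  shows "uniform_limit UNIV (\<lambda>s i. u i s) (\<lambda>i. u i t) (at_right t)"
proof (rule uniform_limitI)
  fix e :: real assume "e > 0"
  then have "\<forall>\<^sub>F s in at_right t. (\<integral>x. m x \<partial>lebesgue_on {t..s}) < e"
    by (intro order_tendstoD(2)[OF integral_interval_tendsto_0(1)[OF m(1) t]])
  moreover have "\<forall>\<^sub>F s in at_right t. s \<in> {t<..<b}"
    using t by (intro eventually_at_rightI[of _ b]) auto
  ultimately show "\<forall>\<^sub>F s in at_right t. \<forall>i\<in>UNIV. dist (u i s) (u i t) < e"
  proof eventually_elim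
    case (elim s)
    then show ?case
      using has_W12_derivative_norm_diff_le[OF u _ _ _ m, of t s] t
      by (auto simp: dist_norm intro: le_less_trans)
  qed
qed


subsection \<open>Lebesgue differentiation from the left\<close>

definition interval_average :: "(real \<Rightarrow> 'a::{banach, second_countable_topology}) \<Rightarrow> real \<Rightarrow> real \<Rightarrow> 'a" where
  "interval_average v r s = (1 / (s - r)) *\<^sub>R (\<integral>x. v x \<partial>lebesgue_on {r..s})"

lemma AE_lebesgue_uminus:
  assumes "AE x in lebesgue. P x"
  shows "AE x in lebesgue. P (- x :: real)"
proof -
  obtain N where N: "N \<in> null_sets lebesgue" "\<And>x. x \<notin> N \<Longrightarrow> P x"
    using assms unfolding completion.AE_iff_null_sets by auto
  have "negligible (uminus ` N)"
    using N(1) by (intro negligible_differentiable_image_negligible)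
      (auto simp: negligible_iff_null_sets differentiable_on_def intro!: derivative_intros)
  then have "uminus ` N \<in> null_sets lebesgue"
    by (simp add: negligible_iff_null_sets)
  from AE_not_in[OF this] show ?thesis
    by eventually_elim (use N(2) in force)
qed

lemma AE_right_average:
  fixes g :: "real \<Rightarrow> real"
  assumes "\<And>p q. g integrable_on {p..q}"
  shows "AE s in lebesgue. ((\<lambda>h. integral {s..s + h} g / h) \<longlongrightarrow> g s) (at_right 0)"
proof -
  obtain N where N: "negligible N" "\<And>x e. x \<notin> N \<Longrightarrow> 0 < e \<Longrightarrow>
      \<exists>d>0. \<forall>h. 0 < h \<and> h < d \<longrightarrow> norm (integral (cbox x (x + h *\<^sub>R One)) g /\<^sub>R h ^ DIM(real) - g x) < e"
    using integrable_ccontinuous_explicit[of g] assms by (metis box_real(2))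
  have "((\<lambda>h. integral {s..s + h} g / h) \<longlongrightarrow> g s) (at_right 0)" if "s \<notin> N" for s
  proof (rule tendstoI)
    fix e :: real assume "e > 0"
    show "\<forall>\<^sub>F h in at_right 0. dist (integral {s..s + h} g / h) (g s) < e"
      using N(2)[OF that \<open>e > 0\<close>]
      by (auto simp: eventually_at_right_field dist_norm divide_inverse mult.commute)
  qed
  moreover have "AE s in lebesgue. s \<notin> N"
    using N(1) by (intro AE_not_in) (simp add: negligible_iff_null_sets)
  ultimately show ?thesis
    by (auto elim!: eventually_mono)
qed

lemma interval_average_eq_integral_reflected:
  fixes f :: "real \<Rightarrow> real"
  assumes f: "integrable (lebesgue_on {a..b}) f" and g: "\<And>x. x \<in> {a..b} \<Longrightarrow> g (- x) = f x"
    and h: "0 < h" "a \<le> s - h" "s \<le> b"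
  shows "interval_average f (s - h) s = integral {- s..- s + h} g / h"
proof -
  have "integral {- s..- (s - h)} g = integral {- s..- (s - h)} (\<lambda>x. f (- x))"
  proof (rule Henstock_Kurzweil_Integration.integral_cong)
    show "g x = f (- x)" if "x \<in> {- s..- (s - h)}" for x
      using that h g[of "- x"] by simp
  qed
  also have "\<dots> = integral {s - h..s} f"
    by (rule Henstock_Kurzweil_Integration.integral_reflect_real)
  also have "\<dots> = (\<integral>x. f x \<partial>lebesgue_on {s - h..s})"
    using h by (intro lebesgue_integral_eq_integral[symmetric] integrable_lebesgue_on_subset[OF f]) auto
  finally show ?thesis
    by (simp add: interval_average_def)
qed

lemma AE_left_average_real:
  fixes f :: "real \<Rightarrow> real"
  assumes f: "integrable (lebesgue_on {a..b}) f"
  shows "AE s in lebesgue_on {a..b}. ((\<lambda>r. interval_average f r s) \<longlongrightarrow> f s) (at_left s)"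
proof -
  define g where "g x = indicator {a..b} (- x) * f (- x)" for x
  have g_reflected: "g (- x) = f x" if "x \<in> {a..b}" for x
    using that by (simp add: g_def)
  have "integrable lebesgue (\<lambda>x. indicator {a..b} x * f x)"
    using f by (simp add: integrable_restrict_space)
  then have "integrable lebesgue g"
    using lebesgue_integrable_real_affine_iff[of "-1" "\<lambda>x. indicator {a..b} x * f x" 0]
    unfolding g_def by simp
  then have "g integrable_on {p..q}" for p q
    using integrable_on_lebesgue integrable_on_subinterval by blast
  then have "AE s in lebesgue. ((\<lambda>h. integral {- s..- s + h} g / h) \<longlongrightarrow> g (- s)) (at_right 0)"
    by (intro AE_lebesgue_uminus AE_right_average)
  then have "AE s in lebesgue_on {a..b}. ((\<lambda>h. integral {- s..- s + h} g / h) \<longlongrightarrow> g (- s)) (at_right 0)"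
    by (auto simp: AE_lebesgue_on_iff elim!: eventually_mono)
  with AE_lebesgue_on_mem AE_interval_neq[where c = a] show ?thesis
  proof eventually_elim
    case (elim s)
    then have s: "a < s" "s \<le> b" by auto
    have "((\<lambda>h. interval_average f (s - h) s) \<longlongrightarrow> f s) (at_right 0)"
    proof (rule Lim_transform_eventually)
      show "((\<lambda>h. integral {- s..- s + h} g / h) \<longlongrightarrow> f s) (at_right 0)"
        using elim by (simp add: g_reflected)
      show "\<forall>\<^sub>F h in at_right 0. integral {- s..- s + h} g / h = interval_average f (s - h) s"
        unfolding eventually_at_right_field
        using interval_average_eq_integral_reflected[OF f g_reflected] s by (intro exI[of _ "s - a"]) auto
    qed
    then show ?case
      by (simp add: filterlim_at_left_to_right filterlim_at_right_to_0[of _ _ "- s"])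
  qed
qed

lemma norm_interval_average_minus_le:
  fixes v :: "real \<Rightarrow> 'a::{banach, second_countable_topology}"
  assumes v: "integrable (lebesgue_on {r..s}) v" and "r < s"
  shows "norm (interval_average v r s - c) \<le> interval_average (\<lambda>x. norm (v x - c)) r s"
proof -
  interpret finite_measure "lebesgue_on {r..s}"
    by (rule finite_measure_lebesgue_on) simp
  have "(\<integral>x. c \<partial>lebesgue_on {r..s}) = (s - r) *\<^sub>R c"
    using \<open>r < s\<close> by (simp add: measure_restrict_space)
  then have "interval_average v r s - c = interval_average (\<lambda>x. v x - c) r s"
    using v \<open>r < s\<close>
    by (simp add: interval_average_def scaleR_diff_right Bochner_Integration.integral_diff
        del: lebesgue_integral_const)
  also have "norm \<dots> \<le> interval_average (\<lambda>x. norm (v x - c)) r s"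
    using \<open>r < s\<close> by (auto simp: interval_average_def intro!: divide_right_mono integral_norm_bound)
  finally show ?thesis .
qed

text \<open>The scalar theorem, applied to the distances of \<open>v\<close> from a countable dense set.\<close>

lemma AE_left_average:
  fixes v :: "real \<Rightarrow> 'a::{banach, second_countable_topology}"
  assumes v: "integrable (lebesgue_on {a..b}) v"
  shows "AE s in lebesgue_on {a..b}. ((\<lambda>r. interval_average v r s) \<longlongrightarrow> v s) (at_left s)"
proof -
  interpret finite_measure "lebesgue_on {a..b}"
    by (rule finite_measure_lebesgue_on) simp
  obtain d :: "nat \<Rightarrow> 'a" where dense: "\<forall>x. \<forall>e>0. \<exists>i. dist (d i) x < e"
    using countable_dense_sequence by (rule exE)
  have "AE s in lebesgue_on {a..b}. \<forall>i.
      ((\<lambda>r. interval_average (\<lambda>x. norm (v x - d i)) r s) \<longlongrightarrow> norm (v s - d i)) (at_left s)"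
    unfolding AE_all_countable by (intro allI AE_left_average_real) (use v in simp)
  with AE_lebesgue_on_mem AE_interval_neq[where c = a] show ?thesis
  proof eventually_elim
    case (elim s)
    then have s: "a < s" "s \<le> b" by auto
    show ?case
    proof (rule tendstoI)
      fix e :: real assume e: "e > 0"
      then obtain i where i: "dist (d i) (v s) < e / 2"
        using dense half_gt_zero by blast
      have "\<forall>\<^sub>F r in at_left s. interval_average (\<lambda>x. norm (v x - d i)) r s < e / 2"
        by (rule order_tendstoD(2)[OF elim(3)[rule_format]]) (use i in \<open>simp add: dist_norm norm_minus_commute\<close>)
      moreover have "\<forall>\<^sub>F r in at_left s. r \<in> {a<..<s}"
        using s by (intro eventually_at_leftI[of a]) auto
      ultimately show "\<forall>\<^sub>F r in at_left s. dist (interval_average v r s) (v s) < e"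
      proof eventually_elim
        case (elim r)
        then have "integrable (lebesgue_on {r..s}) v"
          using s by (intro integrable_lebesgue_on_subset[OF v]) auto
        then have "dist (interval_average v r s) (d i) < e / 2"
          using norm_interval_average_minus_le[of r s v "d i"] elim by (simp add: dist_norm)
        then show ?case
          using i dist_triangle[of "interval_average v r s" "v s" "d i"] by linarith
      qed
    qed
  qed
qed

lemma has_W12_derivative_left_derivative:
  assumes u: "has_W12_derivative b u v"
  shows "AE s in leb b. ((\<lambda>r. (1 / (s - r)) *\<^sub>R (u s - u r)) \<longlongrightarrow> v s) (at_left s)"
  using AE_lebesgue_on_mem AE_interval_neq[where c = 0] AE_left_average[OF has_W12_derivative_integrable[OF u]]
proof eventually_elim
  case (elim s)
  have "\<forall>\<^sub>F r in at_left s. interval_average v r s = (1 / (s - r)) *\<^sub>R (u s - u r)"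
    unfolding eventually_at_left_field interval_average_def
    using elim has_W12_derivative_diff[OF u, of _ s] by (intro exI[of _ 0]) auto
  with elim(3) show ?case
    by (rule Lim_transform_eventually)
qed


subsection \<open>Gronwall's inequality\<close>

lemma integral_lebesgue_has_real_derivative:
  fixes p :: "real \<Rightarrow> real"
  assumes p: "continuous_on {a..b} p" and t: "a < t" "t < b"
  shows "((\<lambda>t. \<integral>s. p s \<partial>lebesgue_on {a..t}) has_real_derivative p t) (at t)"
proof -
  have integral_eq: "integral {a..t} p = (\<integral>s. p s \<partial>lebesgue_on {a..t})" if "t \<in> {a..b}" for t
    using that
    by (intro lebesgue_integral_eq_integral[symmetric] continuous_imp_integrable_real continuous_on_subset[OF p])
      auto
  have "((\<lambda>t. integral {a..t} p) has_real_derivative p t) (at t within {a..b})"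
    using t by (intro integral_has_real_derivative p) auto
  then have "((\<lambda>t. \<integral>s. p s \<partial>lebesgue_on {a..t}) has_real_derivative p t) (at t within {a..b})"
    by (rule has_field_derivative_transform_within[OF _ zero_less_one]) (use t integral_eq in auto)
  then show ?thesis
    using t by (simp add: at_within_Icc_at)
qed

lemma gronwall_integral:
  fixes p :: "real \<Rightarrow> real"
  assumes p: "continuous_on {0..b} p" and c_nonneg: "0 \<le> c"
    and p_le: "\<And>t. t \<in> {0..b} \<Longrightarrow> p t \<le> a + c * (\<integral>s. p s \<partial>lebesgue_on {0..t})"
    and t: "t \<in> {0..b}"
  shows "p t \<le> a * exp (c * t)"
proof -
  define P where "P t = (\<integral>s. p s \<partial>lebesgue_on {0..t})" for t
  have P_deriv: "(P has_real_derivative p s) (at s)" if "0 < s" "s < b" for s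
    unfolding P_def by (rule integral_lebesgue_has_real_derivative[OF p that])
  define q where "q s = (a + c * P s) * exp (- c * s)" for s
  have "q t \<le> q 0"
  proof (rule DERIV_nonpos_imp_decreasing_open[of 0 t q])
    show "continuous_on {0..t} q"
      unfolding q_def P_def using t
      by (intro continuous_intros indefinite_integral_continuous_real continuous_imp_integrable_real
          continuous_on_subset[OF p]) auto
    fix s assume s: "0 < s" "s < t"
    show "\<exists>y. DERIV q s :> y \<and> y \<le> 0"
    proof (intro exI conjI)
      show "DERIV q s :> (c * p s) * exp (- c * s) + (exp (- c * s) * - c) * (a + c * P s)"
        unfolding q_def using s t by (auto intro!: derivative_eq_intros P_deriv)
      have "c * p s * exp (- c * s) \<le> c * (a + c * P s) * exp (- c * s)"
        using c_nonneg p_le[of s] s t by (intro mult_right_mono mult_left_mono) (auto simp: P_def)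
      then show "(c * p s) * exp (- c * s) + (exp (- c * s) * - c) * (a + c * P s) \<le> 0"
        by (simp add: algebra_simps)
    qed
  qed (use t in simp)
  also have "q 0 = a"
    by (simp add: q_def P_def)
  finally have "q t * exp (c * t) \<le> a * exp (c * t)"
    by (intro mult_right_mono) auto
  moreover have "q t * exp (c * t) = a + c * P t"
    by (simp add: q_def exp_minus)
  ultimately show ?thesis
    using p_le[OF t] by (simp add: P_def)
qed


subsection \<open>Velocity bound for state-dependent monotone inclusions\<close>

lemma dis_difference_quotient_bound:
  fixes x x' D :: "'h::real_inner"
  assumes dis: "dis B B' \<le> ereal (\<bar>h * e\<bar> + lam * norm (x - x'))"
    and Y: "Y \<in> B x" and y: "y \<in> B' x'" "norm y \<le> C"
    and D: "x - x' = h *\<^sub>R D" and h: "0 < h" and lam: "0 \<le> lam"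
  shows "- (Y \<bullet> D) \<le> C * norm D + (1 + norm Y + C) * (\<bar>e\<bar> + lam * norm D)"
proof -
  have "x' - x = - (h *\<^sub>R D)"
    using D by (metis minus_diff_eq)
  then have "h * (- ((Y - y) \<bullet> D)) \<le> (1 + norm Y + norm y) * (\<bar>h * e\<bar> + lam * norm (h *\<^sub>R D))"
    using dis_leD[OF dis Y y(1)] unfolding D by simp
  also have "\<dots> = h * ((1 + norm Y + norm y) * (\<bar>e\<bar> + lam * norm D))"
    using h by (simp add: abs_mult algebra_simps)
  finally have "- ((Y - y) \<bullet> D) \<le> (1 + norm Y + norm y) * (\<bar>e\<bar> + lam * norm D)"
    using h by (simp only: mult_le_cancel_left_pos)
  also have "\<dots> \<le> (1 + norm Y + C) * (\<bar>e\<bar> + lam * norm D)"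
    using y(2) lam by (intro mult_right_mono) auto
  finally have "- (Y \<bullet> D) \<le> - (y \<bullet> D) + (1 + norm Y + C) * (\<bar>e\<bar> + lam * norm D)"
    by (simp add: inner_diff_left)
  moreover have "- (y \<bullet> D) \<le> norm y * norm D"
    using Cauchy_Schwarz_ineq2[of y D] by linarith
  moreover have "norm y * norm D \<le> C * norm D"
    using y(2) by (intro mult_right_mono) auto
  ultimately show ?thesis
    by linarith
qed

lemma quadratic_inequality_bound:
  fixes N S \<kappa> :: real
  assumes "\<kappa> * N\<^sup>2 \<le> 2 * N * S + S\<^sup>2" "0 < \<kappa>" "\<kappa> \<le> 1" "0 \<le> N" "0 \<le> S"
  shows "N \<le> 3 / \<kappa> * S"
proof (rule ccontr)
  assume "\<not> N \<le> 3 / \<kappa> * S"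
  then have S_small: "3 * S < \<kappa> * N"
    using assms by (simp add: field_simps)
  have "\<kappa> * N \<le> N"
    using assms by (simp add: mult_left_le_one_le)
  then have "S \<le> N" "0 < N"
    using S_small assms by linarith+
  have "2 * N * S + S\<^sup>2 \<le> N * (3 * S)"
    using mult_right_mono[OF \<open>S \<le> N\<close> assms(5)] by (simp add: power2_eq_square)
  also have "\<dots> < N * (\<kappa> * N)"
    using S_small \<open>0 < N\<close> by (rule mult_strict_left_mono)
  finally show False
    using assms(1) by (simp add: power2_eq_square mult.left_commute)
qed

lemma absorb_quadratic_inequality:
  fixes N a c \<tau> lam :: real
  assumes ineq: "N\<^sup>2 \<le> a * N + c * N + (1 + (N + a) + c) * (\<tau> + lam * N)"
    and nonneg: "0 \<le> N" "0 \<le> a" "0 \<le> c" "0 \<le> \<tau>" and lam: "0 \<le> lam" "lam < 1"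
  shows "N \<le> 3 / (1 - lam) * (1 + a + c + \<tau>)"
proof -
  define S where "S = 1 + a + c + \<tau>"
  have "(1 - lam) * N\<^sup>2 \<le> N * (a + c + \<tau>) + lam * (N * (1 + a + c)) + (1 + a + c) * \<tau>"
    using ineq by (simp add: algebra_simps power2_eq_square)
  moreover have "N * (a + c + \<tau>) \<le> N * S"
    unfolding S_def using nonneg by (intro mult_left_mono) auto
  moreover have "lam * (N * (1 + a + c)) \<le> N * S"
  proof -
    have "lam * (N * (1 + a + c)) \<le> N * (1 + a + c)"
      using nonneg lam by (intro mult_left_le_one_le) auto
    also have "\<dots> \<le> N * S"
      unfolding S_def using nonneg by (intro mult_left_mono) auto
    finally show ?thesis .
  qed
  moreover have "(1 + a + c) * \<tau> \<le> S * S"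
    unfolding S_def using nonneg by (intro mult_mono) auto
  ultimately have "(1 - lam) * N\<^sup>2 \<le> 2 * N * S + S\<^sup>2"
    by (simp add: power2_eq_square)
  then show ?thesis
    unfolding S_def using lam nonneg by (intro quadratic_inequality_bound) auto
qed

lemma norm_le_absorb_inner_inequality:
  fixes v g :: "'h::real_inner"
  assumes ineq: "- ((- v + g) \<bullet> v) \<le> c * norm v + (1 + norm (- v + g) + c) * (\<tau> + lam * norm v)"
    and nonneg: "0 \<le> c" "0 \<le> \<tau>" and lam: "0 \<le> lam" "lam < 1"
  shows "norm v \<le> 3 / (1 - lam) * (1 + norm g + c + \<tau>)"
proof -
  have "norm (- v + g) \<le> norm v + norm g"
    using norm_triangle_ineq[of "- v" g] by simp
  then have "(1 + norm (- v + g) + c) * (\<tau> + lam * norm v) \<le> (1 + (norm v + norm g) + c) * (\<tau> + lam * norm v)"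
    using nonneg lam by (intro mult_right_mono) auto
  moreover have "- ((- v + g) \<bullet> v) = (norm v)\<^sup>2 - g \<bullet> v"
    by (simp add: inner_diff_left power2_norm_eq_inner)
  moreover have "g \<bullet> v \<le> norm g * norm v"
    by (rule norm_cauchy_schwarz)
  ultimately have "(norm v)\<^sup>2 \<le> norm g * norm v + c * norm v + (1 + (norm v + norm g) + c) * (\<tau> + lam * norm v)"
    using ineq by linarith
  then show ?thesis
    using nonneg lam by (intro absorb_quadratic_inequality) auto
qed

locale state_dependent_monotone =
  fixes b :: real and A :: "real \<Rightarrow> 'h::{real_inner, banach, second_countable_topology} \<Rightarrow> 'h \<Rightarrow> 'h set"
    and \<theta> \<theta>' :: "real \<Rightarrow> real" and lam MB :: real
  assumes maximal: "\<And>t u. t \<in> {0..b} \<Longrightarrow> maximal_monotone (A t u)"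
    and \<theta>: "has_W12_derivative b \<theta> \<theta>'" and lam: "0 \<le> lam" "lam < 1"
    and dis_A: "\<And>t s u v. t \<in> {0..b} \<Longrightarrow> s \<in> {0..b} \<Longrightarrow>
      dis (A t u) (A s v) \<le> ereal (\<bar>\<theta> t - \<theta> s\<bar> + lam * norm (u - v))"
    and MB: "0 \<le> MB" and minimal_section_bound: "\<And>t u v. t \<in> {0..b} \<Longrightarrow> v \<in> op_dom (A t u) \<Longrightarrow>
      norm (minimal_section (A t u) v) \<le> MB * (1 + norm u + norm v)"
begin

text \<open>The operator at \<open>s\<close> is compared with the minimal sections at earlier times \<open>r\<close>: only for
  \<open>r < s\<close> does the term \<open>v \<bullet> v\<close> coming from \<open>Y = - v + g\<close> have the right sign.\<close>

lemma left_derivative_inequality: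
  assumes s: "0 < s" "s \<le> b"
    and v: "((\<lambda>r. (1 / (s - r)) *\<^sub>R (u s - u r)) \<longlongrightarrow> v) (at_left s)"
    and \<tau>: "((\<lambda>r. (1 / (s - r)) *\<^sub>R (\<theta> s - \<theta> r)) \<longlongrightarrow> \<tau>) (at_left s)"
    and u: "continuous_on {0..b} u"
    and dom: "AE r in leb b. u r \<in> op_dom (A r (u r))"
    and Y: "Y \<in> A s (u s) (u s)"
  defines "c \<equiv> MB * (1 + norm (u s) + norm (u s))"
  shows "- (Y \<bullet> v) \<le> c * norm v + (1 + norm Y + c) * (\<bar>\<tau>\<bar> + lam * norm v)"
proof -
  define S where "S = {r \<in> {0<..<s}. u r \<in> op_dom (A r (u r))}"
  have nontrivial: "at s within S \<noteq> bot"
    unfolding S_def using dom s by (rule AE_interval_at_left_within_nontrivial)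
  define D where "D r = (1 / (s - r)) *\<^sub>R (u s - u r)" for r
  define E where "E r = (1 / (s - r)) *\<^sub>R (\<theta> s - \<theta> r)" for r
  define C where "C r = MB * (1 + norm (u r) + norm (u r))" for r
  have "S \<subseteq> {..<s}"
    by (auto simp: S_def)
  then have D: "(D \<longlongrightarrow> v) (at s within S)" and E: "(E \<longlongrightarrow> \<tau>) (at s within S)"
    using tendsto_within_subset[OF v] tendsto_within_subset[OF \<tau>] unfolding D_def E_def by blast+
  have "(u \<longlongrightarrow> u s) (at s within S)"
    by (rule tendsto_within_subset[of u _ s "{0..b}"])
      (use u s in \<open>auto simp: continuous_on_def S_def\<close>)
  then have C: "(C \<longlongrightarrow> c) (at s within S)"
    unfolding C_def c_def by (intro tendsto_intros)
  have "- (Y \<bullet> D r) \<le> C r * norm (D r) + (1 + norm Y + C r) * (\<bar>E r\<bar> + lam * norm (D r))"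
    if r: "r \<in> S" for r
  proof (rule dis_difference_quotient_bound[where B = "A s (u s)" and B' = "A r (u r)" and x = "u s" and x' = "u r",
        OF _ Y])
    have r': "r \<in> {0..b}" "r < s" "u r \<in> op_dom (A r (u r))"
      using r s by (auto simp: S_def)
    show "minimal_section (A r (u r)) (u r) \<in> A r (u r) (u r)"
      by (rule minimal_section_mem[OF maximal[OF r'(1)] r'(3)])
    show "norm (minimal_section (A r (u r)) (u r)) \<le> C r"
      unfolding C_def by (rule minimal_section_bound[OF r'(1,3)])
    show "u s - u r = (s - r) *\<^sub>R D r" "0 < s - r"
      using r' by (auto simp: D_def)
    show "dis (A s (u s)) (A r (u r)) \<le> ereal (\<bar>(s - r) * E r\<bar> + lam * norm (u s - u r))"
      using dis_A[of s r "u s" "u r"] r' s by (simp add: E_def)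
  qed (rule lam)
  then have "\<forall>\<^sub>F r in at s within S.
      - (Y \<bullet> D r) \<le> C r * norm (D r) + (1 + norm Y + C r) * (\<bar>E r\<bar> + lam * norm (D r))"
    by (simp add: eventually_at_filter)
  then show ?thesis
    by (rule tendsto_le[OF nontrivial, rotated 2]) (intro tendsto_intros C D E)+
qed

definition velocity_factor :: real where
  "velocity_factor = 3 / (1 - lam) * (1 + 2 * MB)"

lemma velocity_factor_nonneg: "0 \<le> velocity_factor"
  using lam MB by (simp add: velocity_factor_def)

lemma inclusion_velocity_bound:
  assumes u: "has_W12_derivative b u u'" and incl: "AE t in leb b. - u' t + g t \<in> A t (u t) (u t)"
  shows "AE t in leb b. norm (u' t) \<le> velocity_factor * (1 + norm (g t) + norm (u t) + \<bar>\<theta>' t\<bar>)"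
proof -
  have dom: "AE t in leb b. u t \<in> op_dom (A t (u t))"
    using incl by eventually_elim (auto simp: op_dom_def)
  from AE_lebesgue_on_mem AE_interval_neq[where c = 0] incl
    has_W12_derivative_left_derivative[OF u] has_W12_derivative_left_derivative[OF \<theta>]
  show ?thesis
  proof eventually_elim
    case (elim s)
    define c where "c = MB * (1 + norm (u s) + norm (u s))"
    have c_nonneg: "0 \<le> c"
      using MB by (simp add: c_def)
    have "- ((- u' s + g s) \<bullet> u' s)
        \<le> c * norm (u' s) + (1 + norm (- u' s + g s) + c) * (\<bar>\<theta>' s\<bar> + lam * norm (u' s))"
      unfolding c_def using elim dom has_W12_derivative_continuous[OF u]
      by (intro left_derivative_inequality) auto
    then have "norm (u' s) \<le> 3 / (1 - lam) * (1 + norm (g s) + c + \<bar>\<theta>' s\<bar>)"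
      using c_nonneg lam by (intro norm_le_absorb_inner_inequality) auto
    also have "1 + norm (g s) + c + \<bar>\<theta>' s\<bar> \<le> (1 + 2 * MB) * (1 + norm (g s) + norm (u s) + \<bar>\<theta>' s\<bar>)"
    proof -
      have "0 \<le> MB * norm (g s)" "0 \<le> MB * \<bar>\<theta>' s\<bar>"
        using MB by auto
      then show ?thesis
        using MB by (simp add: c_def algebra_simps)
    qed
    then have "3 / (1 - lam) * (1 + norm (g s) + c + \<bar>\<theta>' s\<bar>)
        \<le> 3 / (1 - lam) * ((1 + 2 * MB) * (1 + norm (g s) + norm (u s) + \<bar>\<theta>' s\<bar>))"
      using lam by (intro mult_left_mono) auto
    finally show ?case
      by (simp only: velocity_factor_def mult.assoc)
  qed
qed

lemma perturbed_monotonicity: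
  assumes t: "t \<in> {0..b}" and Y: "Y \<in> A t u u" "norm Y \<le> m" and y: "y \<in> A t v z"
  shows "(v - z) \<bullet> y - (v - z) \<bullet> Y \<le> 2 * (1 + m + norm y) * norm (u - v)"
proof -
  have "(Y - y) \<bullet> (z - u) \<le> (1 + norm Y + norm y) * (lam * norm (u - v))"
    using dis_leD[OF dis_A[OF t t] Y(1) y] by simp
  also have "\<dots> \<le> (1 + m + norm y) * norm (u - v)"
    using Y(2) lam
    by (intro mult_mono)
      (auto simp: mult_left_le_one_le add_nonneg_nonneg order_trans[OF norm_ge_zero Y(2)])
  finally have "(Y - y) \<bullet> (z - u) \<le> (1 + m + norm y) * norm (u - v)" .
  moreover have "(Y - y) \<bullet> (u - v) \<le> (1 + m + norm y) * norm (u - v)"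
  proof -
    have "(Y - y) \<bullet> (u - v) \<le> norm (Y - y) * norm (u - v)"
      by (rule norm_cauchy_schwarz)
    also have "\<dots> \<le> (1 + m + norm y) * norm (u - v)"
      using Y(2) norm_triangle_ineq4[of Y y] by (intro mult_right_mono) auto
    finally show ?thesis .
  qed
  moreover have "(v - z) \<bullet> y - (v - z) \<bullet> Y = (Y - y) \<bullet> (z - u) + (Y - y) \<bullet> (u - v)"
    by (simp add: inner_diff_left inner_diff_right inner_commute)
  ultimately show ?thesis
    by linarith
qed

end


subsection \<open>Convolution with a semigroup\<close>

lemma continuous_on_blinfun_apply_pair:
  fixes T :: "'t::metric_space \<Rightarrow> 'a::real_normed_vector \<Rightarrow>\<^sub>L 'b::real_normed_vector"
  assumes T: "\<And>x. continuous_on S (\<lambda>t. T t x)" and M: "\<And>t. t \<in> S \<Longrightarrow> norm (T t) \<le> M"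
  shows "continuous_on (S \<times> UNIV) (\<lambda>(t, x). T t x)"
  unfolding continuous_on_def
proof
  fix p :: "'t \<times> 'a" assume "p \<in> S \<times> UNIV"
  then obtain t x where p: "p = (t, x)" and t: "t \<in> S" by auto
  let ?F = "at p within S \<times> UNIV"
  have mem: "\<forall>\<^sub>F q in ?F. fst q \<in> S"
    by (auto simp: eventually_at_filter mem_Times_iff intro!: always_eventually)
  have fst: "(fst \<longlongrightarrow> t) ?F" and snd: "(snd \<longlongrightarrow> x) ?F"
    using tendsto_fst[OF tendsto_ident_at] tendsto_snd[OF tendsto_ident_at] by (fastforce simp: p)+
  have "((\<lambda>q. T (fst q) x) \<longlongrightarrow> T t x) ?F"
    by (rule continuous_on_tendsto_compose[OF T fst t mem])
  moreover have "((\<lambda>q. T (fst q) (snd q - x)) \<longlongrightarrow> 0) ?F"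
  proof (rule Lim_null_comparison)
    show "\<forall>\<^sub>F q in ?F. norm (T (fst q) (snd q - x)) \<le> M * norm (snd q - x)"
      using mem by eventually_elim (meson M mult_right_mono norm_blinfun norm_ge_zero order_trans)
    have "((\<lambda>q. M * norm (snd q - x)) \<longlongrightarrow> M * norm (x - x)) ?F"
      by (intro tendsto_intros snd)
    then show "((\<lambda>q. M * norm (snd q - x)) \<longlongrightarrow> 0) ?F"
      by simp
  qed
  ultimately have "((\<lambda>q. T (fst q) x + T (fst q) (snd q - x)) \<longlongrightarrow> T t x + 0) ?F"
    by (rule tendsto_add)
  then show "((\<lambda>(t, x). T t x) \<longlongrightarrow> (case p of (t, x) \<Rightarrow> T t x)) ?F"
    by (simp add: p case_prod_beta' blinfun.diff_right)
qed

locale bounded_C0_semigroup =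
  fixes T :: "real \<Rightarrow> 'e::{banach, second_countable_topology} \<Rightarrow>\<^sub>L 'e" and b M :: real
  assumes b: "b > 0" and semigroup: "C0_semigroup T"
    and bound: "\<And>t. t \<in> {0..b} \<Longrightarrow> norm (T t) \<le> M"
begin

lemma M_nonneg: "0 \<le> M"
  using order_trans[OF norm_ge_zero bound[of 0]] b by simp

lemma norm_T_apply_le: "t \<in> {0..b} \<Longrightarrow> norm (T t x) \<le> M * norm x"
  by (meson bound mult_right_mono norm_blinfun norm_ge_zero order_trans)

lemma T_add_apply: "0 \<le> s \<Longrightarrow> 0 \<le> t \<Longrightarrow> T (s + t) x = T s (T t x)"
  using semigroup unfolding C0_semigroup_def by (metis blinfun_apply_blinfun_compose)

lemma T_0_apply: "T 0 x = x"
  using semigroup by (simp add: C0_semigroup_def)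

lemma norm_T_apply_diff_le:
  assumes "s \<in> {0..b}" "t \<in> {0..b}"
  shows "norm (T s x - T t x) \<le> M * norm (T \<bar>s - t\<bar> x - x)"
proof -
  have ordered: "norm (T q x - T p x) \<le> M * norm (T (q - p) x - x)" if "0 \<le> p" "p \<le> q" "q \<le> b" for p q
  proof -
    have "T q x - T p x = T p (T (q - p) x - x)"
      using T_add_apply[of p "q - p" x] that by (simp add: blinfun.diff_right)
    then show ?thesis
      using norm_T_apply_le[of p] that by simp
  qed
  show ?thesis
    using ordered[of s t] ordered[of t s] assms by (cases "s \<le> t") (auto simp: norm_minus_commute)
qed

lemma continuous_on_T_apply: "continuous_on {0..b} (\<lambda>t. T t x)"
  unfolding continuous_on_def
proof
  fix t assume t: "t \<in> {0..b}"
  have "filterlim (\<lambda>s. \<bar>s - t\<bar>) (at_right 0) (at t within {0..b})"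
    unfolding filterlim_at
  proof
    have "((\<lambda>s. \<bar>s - t\<bar>) \<longlongrightarrow> \<bar>t - t\<bar>) (at t within {0..b})"
      by (intro tendsto_intros)
    then show "((\<lambda>s. \<bar>s - t\<bar>) \<longlongrightarrow> 0) (at t within {0..b})"
      by simp
  qed (auto simp: eventually_at_filter)
  moreover have "((\<lambda>t. T t x) \<longlongrightarrow> x) (at_right 0)"
    using semigroup by (simp add: C0_semigroup_def)
  ultimately have "((\<lambda>s. T \<bar>s - t\<bar> x) \<longlongrightarrow> x) (at t within {0..b})"
    by (rule filterlim_compose[rotated])
  then have "((\<lambda>s. M * norm (T \<bar>s - t\<bar> x - x)) \<longlongrightarrow> M * norm (x - x)) (at t within {0..b})"
    by (intro tendsto_intros)
  then have modulus: "((\<lambda>s. M * norm (T \<bar>s - t\<bar> x - x)) \<longlongrightarrow> 0) (at t within {0..b})"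
    by simp
  have "\<forall>\<^sub>F s in at t within {0..b}. norm (T s x - T t x) \<le> M * norm (T \<bar>s - t\<bar> x - x)"
    using norm_T_apply_diff_le[OF _ t] by (auto simp: eventually_at_filter intro!: always_eventually)
  then have "((\<lambda>s. T s x - T t x) \<longlongrightarrow> 0) (at t within {0..b})"
    using modulus by (rule Lim_null_comparison)
  then show "((\<lambda>t. T t x) \<longlongrightarrow> T t x) (at t within {0..b})"
    by (simp add: LIM_zero_iff)
qed

lemma continuous_on_T_pair: "continuous_on ({0..b} \<times> UNIV) (\<lambda>(t, x). T t x)"
  by (rule continuous_on_blinfun_apply_pair[OF continuous_on_T_apply bound])

lemma uniform_limit_T_compact:
  assumes "compact K"
  shows "uniform_limit K (\<lambda>h x. T h x) (\<lambda>x. x) (at_right 0)"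
proof (rule uniform_limitI)
  fix e :: real assume e: "0 < e"
  have "uniformly_continuous_on ({0..b} \<times> K) (\<lambda>(t, x). T t x)"
    using assms
    by (intro compact_uniformly_continuous compact_Times continuous_on_subset[OF continuous_on_T_pair]) auto
  then obtain d where d: "d > 0" "\<And>p q. p \<in> {0..b} \<times> K \<Longrightarrow> q \<in> {0..b} \<times> K \<Longrightarrow> dist p q < d \<Longrightarrow>
      dist (case p of (t, x) \<Rightarrow> T t x) (case q of (t, x) \<Rightarrow> T t x) < e"
    using e unfolding uniformly_continuous_on_def by metis
  have "dist (T h x) x < e" if "x \<in> K" "0 < h" "h < min b d" for h x
    using d(2)[of "(h, x)" "(0, x)"] that b by (simp add: dist_Pair_Pair T_0_apply)
  then show "\<forall>\<^sub>F h in at_right 0. \<forall>x\<in>K. dist (T h x) x < e"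
    unfolding eventually_at_right_field using b d(1) by (intro exI[of _ "min b d"]) auto
qed

definition kernel :: "real \<Rightarrow> real \<Rightarrow> 'e \<Rightarrow> 'e" where
  "kernel t s y = indicator {0..t} s *\<^sub>R T (t - s) y"

lemma bounded_linear_kernel: "bounded_linear (kernel t s)"
  unfolding kernel_def by (intro bounded_linear_intros)

lemma norm_kernel_le:
  assumes "t \<in> {0..b}"
  shows "norm (kernel t s y) \<le> M * norm y"
  using norm_T_apply_le[of "t - s" y] assms M_nonneg by (auto simp: kernel_def indicator_def)

lemma borel_measurable_kernel:
  assumes h: "h \<in> borel_measurable (leb b)" and t: "t \<in> {0..b}"
  shows "(\<lambda>s. kernel t s (h s)) \<in> borel_measurable (leb b)"
proof -
  define \<Phi> where "\<Phi> p = indicator ({0..t} \<times> UNIV) p *\<^sub>R T (t - fst p) (snd p)" for p :: "real \<times> 'e"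
  have "continuous_on ({0..t} \<times> UNIV) (\<lambda>p. case (t - fst p, snd p) of (t, x) \<Rightarrow> T t x)"
    by (rule continuous_on_compose2[OF continuous_on_T_pair])
      (use t in \<open>auto intro!: continuous_intros\<close>)
  then have "continuous_on ({0..t} \<times> UNIV) (\<lambda>p. T (t - fst p) (snd p))"
    by simp
  then have "\<Phi> \<in> borel_measurable borel"
    unfolding \<Phi>_def by (intro borel_measurable_continuous_on_indicator borel_closed closed_Times) auto
  moreover have "(\<lambda>s. s) \<in> borel_measurable (leb b)"
    by (intro measurable_restrict_space1 measurable_completion) simp
  then have "(\<lambda>s. (s, h s)) \<in> borel_measurable (leb b)"
    using h by (rule borel_measurable_Pair)
  ultimately have "(\<lambda>s. \<Phi> (s, h s)) \<in> borel_measurable (leb b)"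
    by (rule measurable_compose[rotated])
  then show ?thesis
    by (simp add: \<Phi>_def kernel_def indicator_def mem_Times_iff)
qed

lemma continuous_kernel:
  assumes t: "t \<in> {0..b}" and s: "s \<in> {0..b}" "s \<noteq> t"
  shows "continuous (at t within {0..b}) (\<lambda>\<tau>. kernel \<tau> s y)"
proof -
  let ?F = "at t within {0..b}"
  have "continuous_on {0..b} (\<lambda>\<tau>. T (max 0 (\<tau> - s)) y)"
    using s by (intro continuous_on_compose2[OF continuous_on_T_apply] continuous_intros) auto
  then have lim: "((\<lambda>\<tau>. indicator {0..t} s *\<^sub>R T (max 0 (\<tau> - s)) y)
      \<longlongrightarrow> indicator {0..t} s *\<^sub>R T (max 0 (t - s)) y) ?F"
    by (intro tendsto_scaleR tendsto_const) (use t in \<open>auto simp: continuous_on_def\<close>)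
  have "\<forall>\<^sub>F \<tau> in ?F. indicator {0..t} s *\<^sub>R T (max 0 (\<tau> - s)) y = kernel \<tau> s y"
  proof (cases "s < t")
    case True
    then have "\<forall>\<^sub>F \<tau> in ?F. s < \<tau>"
      by (rule order_tendstoD(1)[OF tendsto_ident_at])
    then show ?thesis
      by eventually_elim (use True s in \<open>simp add: kernel_def\<close>)
  next
    case False
    then have "\<forall>\<^sub>F \<tau> in ?F. \<tau> < s"
      using s by (intro order_tendstoD(2)[OF tendsto_ident_at]) auto
    then show ?thesis
      by eventually_elim (use False s in \<open>simp add: kernel_def\<close>)
  qed
  with lim have "((\<lambda>\<tau>. kernel \<tau> s y) \<longlongrightarrow> indicator {0..t} s *\<^sub>R T (max 0 (t - s)) y) ?F"
    by (rule Lim_transform_eventually)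
  also have "indicator {0..t} s *\<^sub>R T (max 0 (t - s)) y = kernel t s y"
    by (cases "s \<le> t") (auto simp: kernel_def)
  finally show ?thesis
    unfolding continuous_within .
qed

definition convol :: "(real \<Rightarrow> 'e) \<Rightarrow> real \<Rightarrow> 'e" where
  "convol h t = (\<integral>s. T (t - s) (h s) \<partial>lebesgue_on {0..t})"

lemma convol_eq_kernel: "t \<in> {0..b} \<Longrightarrow> convol h t = (\<integral>s. kernel t s (h s) \<partial>leb b)"
  unfolding convol_def kernel_def by (rule integral_lebesgue_on_subset) auto

lemma continuous_on_convol:
  assumes h: "integrable (leb b) h"
  shows "continuous_on {0..b} (convol h)"
  unfolding continuous_on_sequentially
proof (intro allI ballI impI)
  fix z :: "nat \<Rightarrow> real" and t
  assume t: "t \<in> {0..b}" and z: "(\<forall>n. z n \<in> {0..b}) \<and> z \<longlonglongrightarrow> t"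
  have "(\<lambda>n. \<integral>s. kernel (z n) s (h s) \<partial>leb b) \<longlonglongrightarrow> (\<integral>s. kernel t s (h s) \<partial>leb b)"
  proof (rule integral_dominated_convergence[where w = "\<lambda>s. M * norm (h s)"])
    from AE_interval_neq[where c = t] AE_lebesgue_on_mem
    show "AE s in leb b. (\<lambda>n. kernel (z n) s (h s)) \<longlonglongrightarrow> kernel t s (h s)"
    proof eventually_elim
      case (elim s)
      show ?case
        by (rule continuous_within_tendsto_compose'[OF continuous_kernel[OF t]]) (use elim z in auto)
    qed
  qed (use h t z borel_measurable_kernel norm_kernel_le in \<open>auto intro!: AE_I2\<close>)
  then show "(convol h \<circ> z) \<longlonglongrightarrow> convol h t"
    using t z by (simp add: o_def convol_eq_kernel)
qed

lemma integrable_T_apply: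
  assumes h: "integrable (leb b) h" and t: "t \<in> {0..b}"
  shows "integrable (lebesgue_on {0..t}) (\<lambda>s. T (t - s) (h s))"
proof -
  have "integrable (leb b) (\<lambda>s. kernel t s (h s))"
    by (rule Bochner_Integration.integrable_bound[of _ "\<lambda>s. M * norm (h s)"])
      (use h t borel_measurable_kernel norm_kernel_le M_nonneg in \<open>auto intro!: AE_I2\<close>)
  then have "integrable (lebesgue_on {0..t}) (\<lambda>s. kernel t s (h s))"
    by (rule integrable_lebesgue_on_subset) (use t in auto)
  then show ?thesis
    by (rule Bochner_Integration.integrable_cong[THEN iffD1, rotated 2]) (auto simp: kernel_def)
qed

lemma norm_integral_T_apply_le:
  assumes m: "integrable (leb b) m" "AE s in leb b. norm (h s) \<le> m s"
    and st: "0 \<le> \<sigma>" "\<sigma> \<le> \<tau>" "\<tau> \<le> b"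
  shows "norm (\<integral>s. T (\<tau> - s) (h s) \<partial>lebesgue_on {\<sigma>..\<tau>}) \<le> M * (\<integral>s. m s \<partial>lebesgue_on {\<sigma>..\<tau>})"
proof -
  have "AE s in lebesgue_on {\<sigma>..\<tau>}. norm (h s) \<le> m s"
    using st by (intro AE_lebesgue_on_subset[OF m(2)]) auto
  with AE_lebesgue_on_mem have "AE s in lebesgue_on {\<sigma>..\<tau>}. norm (T (\<tau> - s) (h s)) \<le> M * m s"
  proof eventually_elim
    case (elim s)
    have "norm (T (\<tau> - s) (h s)) \<le> M * norm (h s)"
      by (rule norm_T_apply_le) (use elim st in auto)
    also have "\<dots> \<le> M * m s"
      using elim M_nonneg by (intro mult_left_mono) auto
    finally show ?case .
  qed
  moreover have "integrable (lebesgue_on {\<sigma>..\<tau>}) m"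
    using st by (intro integrable_lebesgue_on_subset[OF m(1)]) auto
  ultimately have "norm (\<integral>s. T (\<tau> - s) (h s) \<partial>lebesgue_on {\<sigma>..\<tau>}) \<le> (\<integral>s. M * m s \<partial>lebesgue_on {\<sigma>..\<tau>})"
    by (intro integral_norm_bound_AE) auto
  then show ?thesis
    by simp
qed

lemma norm_convol_le:
  assumes "integrable (leb b) m" "AE s in leb b. norm (h s) \<le> m s" "t \<in> {0..b}"
  shows "norm (convol h t) \<le> M * (\<integral>s. m s \<partial>lebesgue_on {0..t})"
  unfolding convol_def using assms by (intro norm_integral_T_apply_le) auto

lemma convol_eq_T_apply_convol:
  assumes h: "integrable (leb b) h" and st: "0 \<le> \<sigma>" "\<sigma> \<le> \<tau>" "\<tau> \<le> b"
  shows "convol h \<tau> = T (\<tau> - \<sigma>) (convol h \<sigma>) + (\<integral>s. T (\<tau> - s) (h s) \<partial>lebesgue_on {\<sigma>..\<tau>})"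
proof -
  have "T (\<tau> - \<sigma>) (convol h \<sigma>) = (\<integral>s. T (\<tau> - \<sigma>) (T (\<sigma> - s) (h s)) \<partial>lebesgue_on {0..\<sigma>})"
    unfolding convol_def using st
    by (intro integral_bounded_linear[symmetric] blinfun.bounded_linear_right integrable_T_apply[OF h]) auto
  also have "\<dots> = (\<integral>s. T (\<tau> - s) (h s) \<partial>lebesgue_on {0..\<sigma>})"
  proof (rule Bochner_Integration.integral_cong)
    fix s assume "s \<in> space (lebesgue_on {0..\<sigma>})"
    then show "T (\<tau> - \<sigma>) (T (\<sigma> - s) (h s)) = T (\<tau> - s) (h s)"
      using T_add_apply[of "\<tau> - \<sigma>" "\<sigma> - s" "h s"] st by simp
  qed simp
  finally show ?thesis
    using integral_lebesgue_on_combine[OF integrable_T_apply[OF h] st(1,2)] st by (simp add: convol_def)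
qed

lemma norm_convol_minus_T_apply_le:
  assumes "integrable (leb b) h" "integrable (leb b) m" "AE s in leb b. norm (h s) \<le> m s"
    and "0 \<le> \<sigma>" "\<sigma> \<le> \<tau>" "\<tau> \<le> b"
  shows "norm (convol h \<tau> - T (\<tau> - \<sigma>) (convol h \<sigma>)) \<le> M * (\<integral>s. m s \<partial>lebesgue_on {\<sigma>..\<tau>})"
  using convol_eq_T_apply_convol[of h \<sigma> \<tau>] norm_integral_T_apply_le[of m h \<sigma> \<tau>] assms by simp

end

lemma relatively_compact_if_near_compact:
  fixes S :: "'a::complete_space set"
  assumes near: "\<And>e. e > 0 \<Longrightarrow> \<exists>K. compact K \<and> (\<forall>x\<in>S. \<exists>y\<in>K. dist x y < e)"
  shows "compact (closure S)"
  unfolding compact_eq_totally_bounded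
proof (intro conjI allI impI)
  fix e :: real assume e: "0 < e"
  obtain K where K: "compact K" "\<And>x. x \<in> S \<Longrightarrow> \<exists>y\<in>K. dist x y < e / 3"
    using near[of "e / 3"] e by auto
  obtain k where k: "finite k" "K \<subseteq> (\<Union>x\<in>k. ball x (e / 3))"
    using K(1) e unfolding compact_eq_totally_bounded by (meson divide_pos_pos zero_less_numeral)
  have "closure S \<subseteq> (\<Union>x\<in>k. ball x e)"
  proof
    fix z assume "z \<in> closure S"
    then obtain x where x: "x \<in> S" "dist x z < e / 3"
      using e by (meson closure_approachable divide_pos_pos zero_less_numeral)
    obtain y c where "c \<in> k" "dist x y < e / 3" "dist c y < e / 3"
      using K(2)[OF x(1)] k(2) by fastforce
    then show "z \<in> (\<Union>x\<in>k. ball x e)"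
      using x(2) dist_triangle[of c z x] dist_triangle2[of c x y] by force
  qed
  then show "\<exists>k. finite k \<and> closure S \<subseteq> (\<Union>x\<in>k. ball x e)"
    using k(1) by blast
qed (simp add: complete_eq_closed)

locale compact_C0_semigroup = bounded_C0_semigroup +
  assumes T_compact: "\<And>t. t > 0 \<Longrightarrow> compact_operator (T t)"
begin

lemma compact_closure_convol:
  fixes h :: "'i \<Rightarrow> real \<Rightarrow> 'a"
  assumes h: "\<And>i. integrable (leb b) (h i)"
    and m: "integrable (leb b) m" "\<And>i. AE s in leb b. norm (h i s) \<le> m s"
    and t: "t \<in> {0..b}"
  shows "compact (closure (range (\<lambda>i. convol (h i) t)))"
proof (cases "t = 0")
  case True
  then show ?thesis
    by (simp add: convol_def)
next
  case False
  then have t0: "0 < t" "t \<le> b"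
    using t by auto
  show ?thesis
  proof (rule relatively_compact_if_near_compact)
    fix e :: real assume e: "e > 0"
    have "((\<lambda>\<sigma>. M * (\<integral>s. m s \<partial>lebesgue_on {\<sigma>..t})) \<longlongrightarrow> M * 0) (at_left t)"
      by (intro tendsto_intros integral_interval_tendsto_0(2)[OF m(1) t0])
    then have "\<forall>\<^sub>F \<sigma> in at_left t. M * (\<integral>s. m s \<partial>lebesgue_on {\<sigma>..t}) < e"
      by (rule order_tendstoD) (use e in simp)
    moreover have "\<forall>\<^sub>F \<sigma> in at_left t. \<sigma> \<in> {0<..<t}"
      using t0 by (intro eventually_at_leftI[of 0]) auto
    ultimately have "\<forall>\<^sub>F \<sigma> in at_left t. 0 < \<sigma> \<and> \<sigma> < t \<and> M * (\<integral>s. m s \<partial>lebesgue_on {\<sigma>..t}) < e"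
      by eventually_elim simp
    then obtain \<sigma> where \<sigma>: "0 < \<sigma>" "\<sigma> < t" "M * (\<integral>s. m s \<partial>lebesgue_on {\<sigma>..t}) < e"
      by (metis (no_types, lifting) eventually_happens trivial_limit_at_left_real)
    define K where "K = closure (T (t - \<sigma>) ` range (\<lambda>i. convol (h i) \<sigma>))"
    have "bounded (range (\<lambda>i. convol (h i) \<sigma>))"
      using norm_convol_le[OF m] \<sigma> t by (intro boundedI[where B = "M * (\<integral>s. m s \<partial>lebesgue_on {0..\<sigma>})"]) auto
    then have "compact K"
      using T_compact[of "t - \<sigma>"] \<sigma> by (simp add: K_def compact_operator_def relatively_compact_def)
    moreover have "dist (convol (h i) t) (T (t - \<sigma>) (convol (h i) \<sigma>)) < e" for i
      using norm_convol_minus_T_apply_le[OF h m, of \<sigma> t i] \<sigma> t by (simp add: dist_norm)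
    moreover have "T (t - \<sigma>) (convol (h i) \<sigma>) \<in> K" for i
      unfolding K_def by (rule closure_subset[THEN subsetD]) simp
    ultimately show "\<exists>K. compact K \<and> (\<forall>x\<in>range (\<lambda>i. convol (h i) t). \<exists>y\<in>K. dist x y < e)"
      by blast
  qed
qed

lemma convol_right_equicontinuous:
  fixes h :: "'i \<Rightarrow> real \<Rightarrow> 'a"
  assumes h: "\<And>i. integrable (leb b) (h i)"
    and m: "integrable (leb b) m" "\<And>i. AE s in leb b. norm (h i s) \<le> m s"
    and t: "0 \<le> t" "t < b"
  shows "uniform_limit UNIV (\<lambda>\<tau> i. convol (h i) \<tau>) (\<lambda>i. convol (h i) t) (at_right t)"
proof (rule uniform_limitI)
  fix e :: real assume e: "e > 0"
  define K where "K = closure (range (\<lambda>i. convol (h i) t))"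
  have "compact K"
    unfolding K_def using t by (intro compact_closure_convol[OF h m]) auto
  from uniform_limit_T_compact[OF this, THEN uniform_limitD, of "e / 2"] e
  have "\<forall>\<^sub>F \<tau> in at_right t. \<forall>z\<in>K. dist (T (\<tau> - t) z) z < e / 2"
    by (simp add: eventually_at_right_to_0[of _ t])
  moreover have "((\<lambda>\<tau>. M * (\<integral>s. m s \<partial>lebesgue_on {t..\<tau>})) \<longlongrightarrow> M * 0) (at_right t)"
    by (intro tendsto_intros integral_interval_tendsto_0(1)[OF m(1) t])
  then have "\<forall>\<^sub>F \<tau> in at_right t. M * (\<integral>s. m s \<partial>lebesgue_on {t..\<tau>}) < e / 2"
    by (rule order_tendstoD) (use e in simp)
  moreover have "\<forall>\<^sub>F \<tau> in at_right t. \<tau> \<in> {t<..<b}"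
    using t by (intro eventually_at_rightI[of _ b]) auto
  ultimately show "\<forall>\<^sub>F \<tau> in at_right t. \<forall>i\<in>UNIV. dist (convol (h i) \<tau>) (convol (h i) t) < e"
  proof eventually_elim
    case (elim \<tau>)
    have "dist (convol (h i) \<tau>) (T (\<tau> - t) (convol (h i) t)) < e / 2" for i
      using norm_convol_minus_T_apply_le[OF h m, of t \<tau> i] elim t by (simp add: dist_norm)
    moreover have "dist (T (\<tau> - t) (convol (h i) t)) (convol (h i) t) < e / 2" for i
      using elim(1) closure_subset[of "range (\<lambda>i. convol (h i) t)"] unfolding K_def by blast
    ultimately show ?case
      by (metis dist_triangle_half_r dist_commute)
  qed
qed

end


subsection \<open>Pointwise convergent subsequences\<close>

lemma convergent_subsequence_countable:
  fixes y :: "nat \<Rightarrow> 'i::countable \<Rightarrow> 'a::metric_space"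
  assumes "\<And>i. \<exists>K. compact K \<and> (\<forall>n. y n i \<in> K)"
  obtains r :: "nat \<Rightarrow> nat" where "strict_mono r" "\<And>i. convergent (\<lambda>n. y (r n) i)"
proof -
  obtain K where K: "\<And>i. compact (K i)" "\<And>n i. y n i \<in> K i"
    using assms by metis
  have "compactin (product_topology (\<lambda>_. euclidean) UNIV) (PiE UNIV K)"
    using K(1) by (simp add: compactin_PiE)
  then have "compact (PiE UNIV K)"
    by (simp add: euclidean_product_topology)
  moreover have "y n \<in> PiE UNIV K" for n
    using K(2) by auto
  ultimately obtain l r where r: "strict_mono r" "(y \<circ> r) \<longlonglongrightarrow> l"
    unfolding compact_def by blast
  have "(\<lambda>n. y (r n) i) \<longlonglongrightarrow> l i" for i
    using continuous_on_tendsto_compose[OF continuous_on_product_coordinates r(2)] by simp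
  with r(1) that show ?thesis
    by (auto simp: convergent_def)
qed

lemma Cauchy_if_near_Cauchy:
  fixes z :: "nat \<Rightarrow> 'a::metric_space"
  assumes near: "\<And>e. e > 0 \<Longrightarrow> \<exists>w. Cauchy w \<and> (\<forall>n. dist (w n) (z n) < e)"
  shows "Cauchy z"
proof (rule metric_CauchyI)
  fix e :: real assume e: "0 < e"
  obtain w where w: "Cauchy w" "\<And>n. dist (w n) (z n) < e / 3"
    using near[of "e / 3"] e by auto
  obtain N where N: "\<And>m n. m \<ge> N \<Longrightarrow> n \<ge> N \<Longrightarrow> dist (w m) (w n) < e / 3"
    using metric_CauchyD[OF w(1), of "e / 3"] e by auto
  have "dist (z m) (z n) < e" if "m \<ge> N" "n \<ge> N" for m n
    using N[OF that] w(2)[of m] w(2)[of n] dist_triangle2[of "z m" "z n" "w n"]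
      dist_triangle[of "z m" "w n" "w m"] by (simp add: dist_commute)
  then show "\<exists>M. \<forall>m\<ge>M. \<forall>n\<ge>M. dist (z m) (z n) < e"
    by blast
qed

text \<open>A form of the Arzela-Ascoli theorem. Convergence on a countable dense set containing the
  right end point propagates to each \<open>t\<close> from the right, so equicontinuity from the right suffices.\<close>

lemma pointwise_convergent_subsequence:
  fixes y :: "nat \<Rightarrow> real \<Rightarrow> 'a::complete_space"
  assumes "a \<le> b"
    and compact_values: "\<And>t. t \<in> {a..b} \<Longrightarrow> \<exists>K. compact K \<and> (\<forall>n. y n t \<in> K)"
    and equicontinuous: "\<And>t. t \<in> {a..<b} \<Longrightarrow> uniform_limit UNIV (\<lambda>\<tau> n. y n \<tau>) (\<lambda>n. y n t) (at_right t)"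
  obtains r :: "nat \<Rightarrow> nat" where "strict_mono r" "\<And>t. t \<in> {a..b} \<Longrightarrow> convergent (\<lambda>n. y (r n) t)"
proof -
  define Q where "Q = insert b ({a..b} \<inter> \<rat>)"
  have Q: "countable Q" "Q \<noteq> {}" "Q \<subseteq> {a..b}"
    using countable_rat \<open>a \<le> b\<close> by (auto simp: Q_def)
  have "\<exists>K. compact K \<and> (\<forall>n. y n (from_nat_into Q k) \<in> K)" for k
    by (intro compact_values subsetD[OF Q(3)] from_nat_into[OF Q(2)])
  then obtain r where r: "strict_mono (r :: nat \<Rightarrow> nat)" "\<And>k. convergent (\<lambda>n. y (r n) (from_nat_into Q k))"
    using convergent_subsequence_countable[of "\<lambda>n k. y n (from_nat_into Q k)"] by blast
  then have on_Q: "convergent (\<lambda>n. y (r n) p)" if "p \<in> Q" for p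
    using from_nat_into_surj[OF Q(1) that] by metis
  have "convergent (\<lambda>n. y (r n) t)" if t: "t \<in> {a..b}" for t
  proof (cases "t = b")
    case True
    then show ?thesis
      by (simp add: on_Q Q_def)
  next
    case False
    have "Cauchy (\<lambda>n. y (r n) t)"
    proof (rule Cauchy_if_near_Cauchy)
      fix e :: real assume "e > 0"
      with equicontinuous[of t] t False have "\<forall>\<^sub>F \<tau> in at_right t. \<forall>n. dist (y n \<tau>) (y n t) < e"
        by (auto dest: uniform_limitD)
      then obtain c where close: "t < c" "\<And>\<tau> n. t < \<tau> \<Longrightarrow> \<tau> < c \<Longrightarrow> dist (y n \<tau>) (y n t) < e"
        by (auto simp: eventually_at_right_field)
      obtain p where p: "p \<in> \<rat>" "t < p" "p < min c b"
        using Rats_dense_in_real[of t "min c b"] close(1) t False by auto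
      then have "Cauchy (\<lambda>n. y (r n) p)"
        using t by (intro convergent_Cauchy on_Q) (auto simp: Q_def)
      then show "\<exists>w. Cauchy w \<and> (\<forall>n. dist (w n) (y (r n) t) < e)"
        using close(2) p by (intro exI[of _ "\<lambda>n. y (r n) p"]) auto
    qed
    then show ?thesis
      by (simp add: Cauchy_convergent_iff)
  qed
  with r(1) that show ?thesis
    by blast
qed


subsection \<open>Convex combinations of tails\<close>

inductive_set tail_hull :: "(nat \<Rightarrow> 'a \<Rightarrow> 'b::real_vector) \<Rightarrow> nat \<Rightarrow> ('a \<Rightarrow> 'b) set"
  for v :: "nat \<Rightarrow> 'a \<Rightarrow> 'b" and n :: nat where
  tail: "k \<ge> n \<Longrightarrow> v k \<in> tail_hull v n"
| combination: "p \<in> tail_hull v n \<Longrightarrow> q \<in> tail_hull v n \<Longrightarrow> 0 \<le> a \<Longrightarrow> 0 \<le> c \<Longrightarrow> a + c = 1 \<Longrightarrow>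
    (\<lambda>t. a *\<^sub>R p t + c *\<^sub>R q t) \<in> tail_hull v n"

lemma tail_hull_antimono: "q \<in> tail_hull v n \<Longrightarrow> m \<le> n \<Longrightarrow> q \<in> tail_hull v m"
  by (induction rule: tail_hull.induct) (auto intro: tail_hull.intros)

lemma tail_hull_borel_measurable:
  fixes v :: "nat \<Rightarrow> 'a \<Rightarrow> 'b::{real_normed_vector, second_countable_topology}"
  assumes "q \<in> tail_hull v n" "\<And>k. v k \<in> borel_measurable M"
  shows "q \<in> borel_measurable M"
  using assms by (induction rule: tail_hull.induct) auto

definition convex_functional :: "('a \<Rightarrow> 'b::real_vector) set \<Rightarrow> (('a \<Rightarrow> 'b) \<Rightarrow> real) \<Rightarrow> bool" where
  "convex_functional H J \<longleftrightarrow> (\<forall>p\<in>H. \<forall>q\<in>H. \<forall>a\<ge>0. \<forall>c\<ge>0. a + c = 1 \<longrightarrow>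
     J (\<lambda>t. a *\<^sub>R p t + c *\<^sub>R q t) \<le> a * J p + c * J q)"

lemma tail_hull_convex_functional_le:
  assumes "q \<in> tail_hull v n" "convex_functional (tail_hull v n) J" "\<And>k. k \<ge> n \<Longrightarrow> J (v k) \<le> r"
  shows "J q \<le> r"
  using assms
proof (induction rule: tail_hull.induct)
  case (combination p q a c)
  then have "J (\<lambda>t. a *\<^sub>R p t + c *\<^sub>R q t) \<le> a * J p + c * J q"
    unfolding convex_functional_def by blast
  also have "\<dots> \<le> a * r + c * r"
    using combination by (intro add_mono mult_left_mono) auto
  also have "\<dots> = r"
    using combination.hyps(5) by (simp flip: distrib_right)
  finally show ?case .
qed auto

lemma tail_hull_limit_convex_functional_le:
  assumes q: "\<And>n. q n \<in> tail_hull v n" and J: "convex_functional (tail_hull v 0) J"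
    and lim: "(\<lambda>n. J (q n)) \<longlonglongrightarrow> l" and J_le: "\<And>k. J (v k) \<le> c k" and c_tendsto: "c \<longlonglongrightarrow> \<rho>"
  shows "l \<le> \<rho>"
proof (rule field_le_epsilon)
  fix e :: real assume "e > 0"
  then have "\<forall>\<^sub>F k in sequentially. c k < \<rho> + e"
    by (intro order_tendstoD(2)[OF c_tendsto]) simp
  then obtain N where N: "\<And>k. k \<ge> N \<Longrightarrow> c k < \<rho> + e"
    by (auto simp: eventually_sequentially)
  have "J (q n) \<le> \<rho> + e" if "n \<ge> N" for n
  proof (rule tail_hull_convex_functional_le[OF q])
    show "convex_functional (tail_hull v n) J"
      using J tail_hull_antimono[of _ v n 0] by (auto simp: convex_functional_def)
    show "J (v k) \<le> \<rho> + e" if "k \<ge> n" for k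
      using J_le[of k] N[of k] \<open>n \<ge> N\<close> that by linarith
  qed
  then show "l \<le> \<rho> + e"
    by (intro LIMSEQ_le_const2[OF lim]) blast
qed

lemma tail_hull_eval_mem_convex_hull:
  assumes "q \<in> tail_hull v n"
  shows "q t \<in> convex hull ((\<lambda>k. v k t) ` {n..})"
  using assms
proof (induction rule: tail_hull.induct)
  case (tail k)
  then show ?case
    by (intro hull_inc) auto
next
  case (combination p q a c)
  then show ?case
    by (intro convexD[OF convex_convex_hull])
qed

definition tail_hull_limit ::
    "'a measure \<Rightarrow> (nat \<Rightarrow> 'a \<Rightarrow> 'b::real_normed_vector) \<Rightarrow> ('a \<Rightarrow> 'b) \<Rightarrow> bool" where
  "tail_hull_limit M v z \<longleftrightarrow> z \<in> borel_measurable M \<and>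
     (\<exists>q. (\<forall>n. q n \<in> tail_hull v n) \<and> (AE t in M. (\<lambda>n. q n t) \<longlonglongrightarrow> z t))"

definition convex_tail_limit :: "(nat \<Rightarrow> 'a::real_normed_vector) \<Rightarrow> 'a \<Rightarrow> bool" where
  "convex_tail_limit y z \<longleftrightarrow> (\<forall>n. z \<in> closure (convex hull (y ` {n..})))"

lemma tail_hull_limit_AE_convex_tail_limit:
  assumes "tail_hull_limit M v z"
  shows "AE t in M. convex_tail_limit (\<lambda>k. v k t) (z t)"
proof -
  obtain q where q: "\<And>n. q n \<in> tail_hull v n" "AE t in M. (\<lambda>n. q n t) \<longlonglongrightarrow> z t"
    using assms unfolding tail_hull_limit_def by blast
  from q(2) show ?thesis
  proof eventually_elim
    case (elim t)
    have "q i t \<in> convex hull ((\<lambda>k. v k t) ` {n..})" if "i \<ge> n" for i n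
      by (rule tail_hull_eval_mem_convex_hull[OF tail_hull_antimono[OF q(1) that]])
    then have "\<forall>\<^sub>F i in sequentially. q i t \<in> closure (convex hull ((\<lambda>k. v k t) ` {n..}))" for n
      unfolding eventually_sequentially using closure_subset by blast
    then show ?case
      unfolding convex_tail_limit_def by (intro allI Lim_in_closed_set[OF closed_closure _ _ elim]) auto
  qed
qed

lemma convex_tail_limit_linear:
  assumes L: "bounded_linear L" and "convex_tail_limit y z"
  shows "convex_tail_limit (\<lambda>k. L (y k)) (L z)"
  unfolding convex_tail_limit_def
proof
  fix n
  have "L z \<in> L ` closure (convex hull (y ` {n..}))"
    using assms(2) by (simp add: convex_tail_limit_def)
  also have "\<dots> \<subseteq> closure (L ` (convex hull (y ` {n..})))"
    by (rule closure_bounded_linear_image_subset[OF L])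
  also have "L ` (convex hull (y ` {n..})) = convex hull ((\<lambda>k. L (y k)) ` {n..})"
    by (simp add: convex_hull_linear_image[OF bounded_linear.linear[OF L]] image_image)
  finally show "L z \<in> closure (convex hull ((\<lambda>k. L (y k)) ` {n..}))" .
qed

lemma convex_tail_limit_convex_on_le:
  assumes "convex_tail_limit y z" and \<phi>: "convex_on UNIV \<phi>" "continuous_on UNIV \<phi>"
    and \<phi>_le: "\<And>k. \<phi> (y k) \<le> c k" and c_tendsto: "c \<longlonglongrightarrow> \<rho>"
  shows "\<phi> z \<le> \<rho>"
proof (rule field_le_epsilon)
  fix e :: real assume "e > 0"
  then have "\<forall>\<^sub>F k in sequentially. c k < \<rho> + e"
    by (intro order_tendstoD(2)[OF c_tendsto]) simp
  then obtain n where n: "\<And>k. k \<ge> n \<Longrightarrow> c k < \<rho> + e"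
    by (auto simp: eventually_sequentially)
  have "\<phi> (y k) \<le> \<rho> + e" if "k \<ge> n" for k
    using \<phi>_le[of k] n[OF that] by linarith
  then have "\<forall>x\<in>convex hull (y ` {n..}). \<phi> x \<le> \<rho> + e"
    by (intro convex_on_convex_hull_bound convex_on_subset[OF \<phi>(1)]) auto
  then have "convex hull (y ` {n..}) \<subseteq> {x. \<phi> x \<le> \<rho> + e}"
    by blast
  moreover have "closed {x. \<phi> x \<le> \<rho> + e}"
    by (intro closed_Collect_le \<phi>(2) continuous_on_const)
  ultimately have "closure (convex hull (y ` {n..})) \<subseteq> {x. \<phi> x \<le> \<rho> + e}"
    by (rule closure_minimal)
  then show "\<phi> z \<le> \<rho> + e"
    using assms(1) by (auto simp: convex_tail_limit_def)
qed

lemma convex_on_infdist: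
  fixes S :: "'a::real_normed_vector set"
  assumes S: "convex S" "S \<noteq> {}"
  shows "convex_on UNIV (\<lambda>x. infdist x S)"
  unfolding convex_on_def
proof (intro conjI ballI allI impI)
  fix x y :: 'a and a c :: real assume ac: "0 \<le> a" "0 \<le> c" "a + c = 1"
  show "infdist (a *\<^sub>R x + c *\<^sub>R y) S \<le> a * infdist x S + c * infdist y S"
  proof (rule field_le_epsilon)
    fix e :: real assume e: "e > 0"
    obtain p where p: "p \<in> S" "dist x p < infdist x S + e"
      using infdist_less_imp_dist_less[of x S "infdist x S + e"] S(2) e by auto
    obtain q where q: "q \<in> S" "dist y q < infdist y S + e"
      using infdist_less_imp_dist_less[of y S "infdist y S + e"] S(2) e by auto
    have "infdist (a *\<^sub>R x + c *\<^sub>R y) S \<le> dist (a *\<^sub>R x + c *\<^sub>R y) (a *\<^sub>R p + c *\<^sub>R q)"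
      using p(1) q(1) S(1) ac by (intro infdist_le convexD) auto
    also have "\<dots> = norm (a *\<^sub>R (x - p) + c *\<^sub>R (y - q))"
      by (simp add: dist_norm algebra_simps)
    also have "\<dots> \<le> a * dist x p + c * dist y q"
      using norm_triangle_ineq[of "a *\<^sub>R (x - p)" "c *\<^sub>R (y - q)"] ac by (simp add: dist_norm)
    also have "\<dots> \<le> a * (infdist x S + e) + c * (infdist y S + e)"
      using p q ac by (intro add_mono mult_left_mono) auto
    also have "\<dots> = a * infdist x S + c * infdist y S + (a + c) * e"
      by (simp add: algebra_simps)
    finally show "infdist (a *\<^sub>R x + c *\<^sub>R y) S \<le> a * infdist x S + c * infdist y S + e"
      using ac by simp
  qed
qed simp

lemma convex_tail_limit_mem:
  assumes "convex_tail_limit y z" and S: "closed S" "convex S" "S \<noteq> {}"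
    and near: "\<And>k. infdist (y k) S \<le> c k" "c \<longlonglongrightarrow> 0"
  shows "z \<in> S"
proof -
  have "infdist z S \<le> 0"
    using convex_on_infdist[OF S(2,3)] near
    by (intro convex_tail_limit_convex_on_le[OF assms(1), where \<phi> = "\<lambda>x. infdist x S"])
      (auto intro: continuous_intros)
  then have "infdist z S = 0"
    using infdist_nonneg[of z S] by linarith
  then show ?thesis
    using in_closed_iff_infdist_zero[OF S(1,3)] by blast
qed

lemma convex_on_norm: "convex_on UNIV (norm :: 'a::real_normed_vector \<Rightarrow> real)"
  using convex_on_dist[of UNIV "0 :: 'a"] by simp

lemma convex_on_norm_square: "convex_on UNIV (\<lambda>x :: 'a::real_normed_vector. (norm x)\<^sup>2)"
  unfolding convex_on_def
proof (intro conjI ballI allI impI)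
  fix x y :: 'a and a c :: real assume ac: "0 \<le> a" "0 \<le> c" "a + c = 1"
  have "(norm (a *\<^sub>R x + c *\<^sub>R y))\<^sup>2 \<le> (a * norm x + c * norm y)\<^sup>2"
    using convex_on_norm ac unfolding convex_on_def by (intro power_mono) auto
  also have "\<dots> \<le> a * (norm x)\<^sup>2 + c * (norm y)\<^sup>2"
    using convex_power2 ac unfolding convex_on_def by auto
  finally show "(norm (a *\<^sub>R x + c *\<^sub>R y))\<^sup>2 \<le> a * (norm x)\<^sup>2 + c * (norm y)\<^sup>2" .
qed simp


subsection \<open>Square integrable limits of convex combinations\<close>

lemma minimizing_sequence_of_decreasing_sets:
  fixes N :: "'a \<Rightarrow> real"
  assumes H: "decseq H" "\<And>n. H n \<noteq> {}" and N: "\<And>x. 0 \<le> N x" and bounded: "\<And>n. \<exists>x\<in>H n. N x \<le> C"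
  obtains q l where "\<And>n. q n \<in> H n" "(\<lambda>n. N (q n)) \<longlonglongrightarrow> l"
    "\<And>e. e > 0 \<Longrightarrow> \<forall>\<^sub>F n in sequentially. \<forall>x\<in>H n. l - e < N x"
proof -
  define \<alpha> where "\<alpha> n = (INF x\<in>H n. N x)" for n
  have bdd: "bdd_below (N ` H n)" for n
    using N by (intro bdd_belowI2) auto
  have \<alpha>_le: "\<alpha> n \<le> N x" if "x \<in> H n" for n x
    unfolding \<alpha>_def by (rule cINF_lower[OF bdd that])
  have "incseq \<alpha>"
    unfolding incseq_def \<alpha>_def using H by (auto simp: decseq_def intro!: cINF_superset_mono bdd)
  moreover have "\<alpha> n \<le> C" for n
    using bounded[of n] \<alpha>_le order_trans by blast
  ultimately obtain l where l: "\<alpha> \<longlonglongrightarrow> l" "\<And>n. \<alpha> n \<le> l"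
    using incseq_convergent by blast
  have "\<exists>x\<in>H n. N x < \<alpha> n + 1 / real (Suc n)" for n
    using cINF_less_iff[OF H(2) bdd, of n "\<alpha> n + 1 / real (Suc n)"] unfolding \<alpha>_def by simp
  then obtain q where q: "\<And>n. q n \<in> H n" "\<And>n. N (q n) < \<alpha> n + 1 / real (Suc n)"
    by metis
  show ?thesis
  proof (rule that[OF q(1)])
    show "(\<lambda>n. N (q n)) \<longlonglongrightarrow> l"
    proof (rule tendsto_sandwich[OF _ _ l(1)])
      show "(\<lambda>n. \<alpha> n + 1 / real (Suc n)) \<longlonglongrightarrow> l"
        using tendsto_add[OF l(1) LIMSEQ_inverse_Suc] by simp
      show "\<forall>\<^sub>F n in sequentially. \<alpha> n \<le> N (q n)"
        using \<alpha>_le q(1) by (intro always_eventually) blast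
      show "\<forall>\<^sub>F n in sequentially. N (q n) \<le> \<alpha> n + 1 / real (Suc n)"
        using q(2) less_imp_le by (intro always_eventually) blast
    qed
    fix e :: real assume "e > 0"
    then have "\<forall>\<^sub>F n in sequentially. l - e < \<alpha> n"
      by (intro order_tendstoD(1)[OF l(1)]) simp
    then show "\<forall>\<^sub>F n in sequentially. \<forall>x\<in>H n. l - e < N x"
      by eventually_elim (use \<alpha>_le less_le_trans in blast)
  qed
qed

lemma (in finite_measure) integral_norm_le_square:
  fixes f :: "'a \<Rightarrow> 'b::{banach, second_countable_topology}"
  assumes f: "f \<in> borel_measurable M" "integrable M (\<lambda>x. (norm (f x))\<^sup>2)" and e: "e > 0"
  shows "(\<integral>x. norm (f x) \<partial>M) \<le> e * measure M (space M) + (\<integral>x. (norm (f x))\<^sup>2 \<partial>M) / e"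
proof -
  have "norm (f x) \<le> e + (norm (f x))\<^sup>2 / e" for x
  proof (cases "norm (f x) \<le> e")
    case True
    then show ?thesis
      using e by (simp add: add_increasing2)
  next
    case False
    then have "norm (f x) * e \<le> (norm (f x))\<^sup>2"
      by (simp add: power2_eq_square mult_left_mono)
    then show ?thesis
      using e by (simp add: pos_le_divide_eq add_increasing)
  qed
  moreover have "integrable M (\<lambda>x. norm (f x))"
    by (rule square_integrable_imp_integrable) (use f in auto)
  ultimately have "(\<integral>x. norm (f x) \<partial>M) \<le> (\<integral>x. e + (norm (f x))\<^sup>2 / e \<partial>M)"
    using f by (intro integral_mono) auto
  also have "\<dots> = e * measure M (space M) + (\<integral>x. (norm (f x))\<^sup>2 \<partial>M) / e"
    using f by simp
  finally show ?thesis .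
qed

lemma (in finite_measure) L1_Cauchy_if_L2_Cauchy:
  fixes q :: "nat \<Rightarrow> 'a \<Rightarrow> 'b::{banach, second_countable_topology}"
  assumes q: "\<And>n. q n \<in> borel_measurable M"
    and diff: "\<And>i j. integrable M (\<lambda>x. (norm (q i x - q j x))\<^sup>2)"
    and Cauchy: "\<And>e. e > 0 \<Longrightarrow> \<exists>n. \<forall>i\<ge>n. \<forall>j\<ge>n. (\<integral>x. (norm (q i x - q j x))\<^sup>2 \<partial>M) < e"
    and e: "e > 0"
  shows "\<exists>n. \<forall>i\<ge>n. \<forall>j\<ge>n. (\<integral>x. norm (q i x - q j x) \<partial>M) < e"
proof -
  define \<mu> where "\<mu> = measure M (space M) + 1"
  define \<epsilon> where "\<epsilon> = e / 2 / \<mu>"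
  have \<mu>: "\<mu> > 0"
    by (simp add: \<mu>_def add_nonneg_pos)
  then have \<epsilon>: "\<epsilon> > 0"
    using e by (simp add: \<epsilon>_def)
  have "\<epsilon> * measure M (space M) \<le> \<epsilon> * \<mu>"
    using \<epsilon> by (intro mult_left_mono) (simp_all add: \<mu>_def)
  also have "\<dots> = e / 2"
    using \<mu> by (simp add: \<epsilon>_def)
  finally have \<epsilon>_measure: "\<epsilon> * measure M (space M) \<le> e / 2" .
  obtain n where n: "\<And>i j. i \<ge> n \<Longrightarrow> j \<ge> n \<Longrightarrow> (\<integral>x. (norm (q i x - q j x))\<^sup>2 \<partial>M) < \<epsilon> * (e / 2)"
    using Cauchy[of "\<epsilon> * (e / 2)"] \<epsilon> e by auto
  have "(\<integral>x. norm (q i x - q j x) \<partial>M) < e" if "i \<ge> n" "j \<ge> n" for i j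
  proof -
    have "(\<integral>x. norm (q i x - q j x) \<partial>M)
        \<le> \<epsilon> * measure M (space M) + (\<integral>x. (norm (q i x - q j x))\<^sup>2 \<partial>M) / \<epsilon>"
      using q diff \<epsilon> by (intro integral_norm_le_square) auto
    also have "\<dots> < e / 2 + e / 2"
      using n[OF that] \<epsilon> \<epsilon>_measure by (intro add_le_less_mono) (simp_all add: pos_divide_less_eq mult.commute)
    finally show ?thesis
      by simp
  qed
  then show ?thesis
    by blast
qed

lemma (in finite_measure) L2_Cauchy_AE_convergent_subsequence:
  fixes q :: "nat \<Rightarrow> 'a \<Rightarrow> 'b::{banach, second_countable_topology}"
  assumes q: "\<And>n. q n \<in> borel_measurable M" "\<And>n. integrable M (\<lambda>x. (norm (q n x))\<^sup>2)"
    and diff: "\<And>i j. integrable M (\<lambda>x. (norm (q i x - q j x))\<^sup>2)"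
    and Cauchy: "\<And>e. e > 0 \<Longrightarrow> \<exists>n. \<forall>i\<ge>n. \<forall>j\<ge>n. (\<integral>x. (norm (q i x - q j x))\<^sup>2 \<partial>M) < e"
  obtains r z where "strict_mono (r :: nat \<Rightarrow> nat)" "z \<in> borel_measurable M"
    "AE x in M. (\<lambda>n. q (r n) x) \<longlonglongrightarrow> z x"
proof -
  have "integrable M (\<lambda>x. norm (q n x))" for n
    by (rule square_integrable_imp_integrable) (use q in auto)
  then have "integrable M (q n)" for n
    using q(1) by (simp add: integrable_norm_iff)
  then obtain r where r: "strict_mono r" "AE x in M. Cauchy (\<lambda>n. q (r n) x)"
    using cauchy_L1_AE_cauchy_subseq[OF _ L1_Cauchy_if_L2_Cauchy[OF q(1) diff Cauchy]] by blast
  show ?thesis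
  proof (rule that[OF r(1)])
    show "(\<lambda>x. lim (\<lambda>n. q (r n) x)) \<in> borel_measurable M"
      by (rule borel_measurable_lim_metric) (rule q(1))
    show "AE x in M. (\<lambda>n. q (r n) x) \<longlonglongrightarrow> lim (\<lambda>n. q (r n) x)"
      using r(2) by eventually_elim (simp add: Cauchy_convergent_iff convergent_LIMSEQ_iff)
  qed
qed

locale L2_dominated_sequence = finite_measure M for M :: "'a measure" +
  fixes v :: "nat \<Rightarrow> 'a \<Rightarrow> 'b::{real_inner, banach, second_countable_topology}" and m :: "'a \<Rightarrow> real"
  assumes v_measurable: "\<And>k. v k \<in> borel_measurable M"
    and m_measurable: "m \<in> borel_measurable M" and m_square_integrable: "integrable M (\<lambda>t. (m t)\<^sup>2)"
    and v_le: "\<And>k. AE t in M. norm (v k t) \<le> m t"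
begin

lemma m_integrable: "integrable M m"
  using square_integrable_imp_integrable[OF m_measurable m_square_integrable] .

lemma tail_hull_AE_norm_le:
  assumes "q \<in> tail_hull v n"
  shows "AE t in M. norm (q t) \<le> m t"
proof -
  have "AE t in M. \<forall>k. norm (v k t) \<le> m t"
    using v_le by (simp add: AE_all_countable)
  then show ?thesis
  proof eventually_elim
    case (elim t)
    then have "convex hull ((\<lambda>k. v k t) ` {n..}) \<subseteq> cball 0 (m t)"
      by (intro hull_minimal) auto
    then show ?case
      using tail_hull_eval_mem_convex_hull[OF assms, of t] by (auto simp: subset_iff)
  qed
qed

lemma tail_hull_square_integrable:
  assumes "q \<in> tail_hull v n"
  shows "integrable M (\<lambda>t. (norm (q t))\<^sup>2)"
proof (rule Bochner_Integration.integrable_bound[OF m_square_integrable])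
  show "AE t in M. norm ((norm (q t))\<^sup>2) \<le> norm ((m t)\<^sup>2)"
    using tail_hull_AE_norm_le[OF assms] by eventually_elim (simp add: power_mono)
qed (use tail_hull_borel_measurable[OF assms v_measurable] in measurable)

lemma tail_hull_norm_diff_square:
  assumes p: "p \<in> tail_hull v n" and q: "q \<in> tail_hull v n"
  shows "integrable M (\<lambda>t. (norm (p t - q t))\<^sup>2)"
    and "(\<integral>t. (norm (p t - q t))\<^sup>2 \<partial>M) = 2 * (\<integral>t. (norm (p t))\<^sup>2 \<partial>M) + 2 * (\<integral>t. (norm (q t))\<^sup>2 \<partial>M)
      - 4 * (\<integral>t. (norm ((1/2) *\<^sub>R p t + (1/2) *\<^sub>R q t))\<^sup>2 \<partial>M)"
proof -
  have "(\<lambda>t. (1/2) *\<^sub>R p t + (1/2) *\<^sub>R q t) \<in> tail_hull v n"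
    by (intro tail_hull.combination p q) auto
  note integrable = tail_hull_square_integrable[OF p] tail_hull_square_integrable[OF q]
    tail_hull_square_integrable[OF this]
  show "integrable M (\<lambda>t. (norm (p t - q t))\<^sup>2)"
    unfolding norm_diff_square_midpoint using integrable by simp
  show "(\<integral>t. (norm (p t - q t))\<^sup>2 \<partial>M) = 2 * (\<integral>t. (norm (p t))\<^sup>2 \<partial>M) + 2 * (\<integral>t. (norm (q t))\<^sup>2 \<partial>M)
      - 4 * (\<integral>t. (norm ((1/2) *\<^sub>R p t + (1/2) *\<^sub>R q t))\<^sup>2 \<partial>M)"
    unfolding norm_diff_square_midpoint using integrable by simp
qed

lemma tail_hull_minimizing_sequence_L2_Cauchy:
  assumes q: "\<And>n. q n \<in> tail_hull v n" and lim: "(\<lambda>n. \<integral>t. (norm (q n t))\<^sup>2 \<partial>M) \<longlonglongrightarrow> l"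
    and lower: "\<And>e. e > 0 \<Longrightarrow> \<forall>\<^sub>F n in sequentially. \<forall>p\<in>tail_hull v n. l - e < (\<integral>t. (norm (p t))\<^sup>2 \<partial>M)"
    and e: "e > 0"
  shows "\<exists>n. \<forall>i\<ge>n. \<forall>j\<ge>n. (\<integral>t. (norm (q i t - q j t))\<^sup>2 \<partial>M) < e"
proof -
  have "\<forall>\<^sub>F n in sequentially. (\<integral>t. (norm (q n t))\<^sup>2 \<partial>M) < l + e / 8"
    using e by (intro order_tendstoD(2)[OF lim]) simp
  then have "\<forall>\<^sub>F n in sequentially. \<forall>i\<ge>n. (\<integral>t. (norm (q i t))\<^sup>2 \<partial>M) < l + e / 8"
    by (rule eventually_all_ge_at_top)
  moreover have "\<forall>\<^sub>F n in sequentially. \<forall>p\<in>tail_hull v n. l - e / 8 < (\<integral>t. (norm (p t))\<^sup>2 \<partial>M)"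
    using e by (intro lower) simp
  ultimately have "\<forall>\<^sub>F n in sequentially. \<forall>i\<ge>n. \<forall>j\<ge>n. (\<integral>t. (norm (q i t - q j t))\<^sup>2 \<partial>M) < e"
  proof eventually_elim
    case (elim n)
    show ?case
    proof (intro allI impI)
      fix i j assume ij: "i \<ge> n" "j \<ge> n"
      then have "q i \<in> tail_hull v n" "q j \<in> tail_hull v n"
        using tail_hull_antimono[OF q] by auto
      moreover from this have "(\<lambda>t. (1/2) *\<^sub>R q i t + (1/2) *\<^sub>R q j t) \<in> tail_hull v n"
        by (intro tail_hull.combination) auto
      with elim(2) have "l - e / 8 < (\<integral>t. (norm ((1/2) *\<^sub>R q i t + (1/2) *\<^sub>R q j t))\<^sup>2 \<partial>M)"
        by (rule bspec)
      moreover have "(\<integral>t. (norm (q i t))\<^sup>2 \<partial>M) < l + e / 8" "(\<integral>t. (norm (q j t))\<^sup>2 \<partial>M) < l + e / 8"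
        using elim(1) ij by auto
      ultimately show "(\<integral>t. (norm (q i t - q j t))\<^sup>2 \<partial>M) < e"
        using tail_hull_norm_diff_square(2)[of "q i" n "q j"] by linarith
    qed
  qed
  then show ?thesis
    by (auto simp: eventually_sequentially)
qed

text \<open>A Mazur-type lemma that needs no weak compactness: nearly norm-minimal elements of the convex
  hulls of the tails form a Cauchy sequence in \<open>L\<^sup>2\<close>, by the parallelogram law.\<close>

lemma tail_hull_limit_exists: "\<exists>z. tail_hull_limit M v z"
proof -
  have v_tail: "v n \<in> tail_hull v n" for n
    by (simp add: tail_hull.tail)
  have v_bound: "(\<integral>t. (norm (v n t))\<^sup>2 \<partial>M) \<le> (\<integral>t. (m t)\<^sup>2 \<partial>M)" for n
  proof (rule integral_mono_AE[OF tail_hull_square_integrable[OF v_tail] m_square_integrable])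
    show "AE t in M. (norm (v n t))\<^sup>2 \<le> (m t)\<^sup>2"
      using v_le[of n] by eventually_elim (simp add: power_mono)
  qed
  obtain q l where q: "\<And>n. q n \<in> tail_hull v n" and lim: "(\<lambda>n. \<integral>t. (norm (q n t))\<^sup>2 \<partial>M) \<longlonglongrightarrow> l"
    and lower: "\<And>e. e > 0 \<Longrightarrow> \<forall>\<^sub>F n in sequentially. \<forall>p\<in>tail_hull v n. l - e < (\<integral>t. (norm (p t))\<^sup>2 \<partial>M)"
  proof (rule minimizing_sequence_of_decreasing_sets)
    show "decseq (tail_hull v)"
      unfolding decseq_def using tail_hull_antimono by blast
    show "\<exists>q\<in>tail_hull v n. (\<integral>t. (norm (q t))\<^sup>2 \<partial>M) \<le> (\<integral>t. (m t)\<^sup>2 \<partial>M)" for n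
      using v_tail v_bound by blast
  qed (use v_tail in auto)
  have q_0: "q n \<in> tail_hull v 0" for n
    by (rule tail_hull_antimono[OF q]) simp
  obtain r z where r: "strict_mono r" and z: "z \<in> borel_measurable M" "AE t in M. (\<lambda>n. q (r n) t) \<longlonglongrightarrow> z t"
    by (rule L2_Cauchy_AE_convergent_subsequence[OF tail_hull_borel_measurable[OF q v_measurable]
          tail_hull_square_integrable[OF q] tail_hull_norm_diff_square(1)[OF q_0 q_0]
          tail_hull_minimizing_sequence_L2_Cauchy[OF q lim lower]])
  have "q (r n) \<in> tail_hull v n" for n
    using tail_hull_antimono[OF q] strict_mono_imp_increasing[OF r] by blast
  with z have "tail_hull_limit M v z"
    unfolding tail_hull_limit_def by (intro conjI exI[of _ "\<lambda>n. q (r n)"]) auto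
  then show ?thesis
    by blast
qed

lemma tail_hull_limit_AE_norm_le:
  assumes "tail_hull_limit M v z"
  shows "AE t in M. norm (z t) \<le> m t"
proof -
  have "AE t in M. \<forall>k. norm (v k t) \<le> m t"
    using v_le by (simp add: AE_all_countable)
  with tail_hull_limit_AE_convex_tail_limit[OF assms] show ?thesis
  proof eventually_elim
    case (elim t)
    then show ?case
      by (intro convex_tail_limit_convex_on_le[OF elim(1) convex_on_norm continuous_on_norm_id _ tendsto_const]) simp
  qed
qed

lemma tail_hull_integrable_compose:
  fixes \<Phi> :: "'a \<Rightarrow> 'b \<Rightarrow> 'c::{banach, second_countable_topology}"
  assumes p: "p \<in> tail_hull v n"
    and \<Phi>: "\<And>p. p \<in> borel_measurable M \<Longrightarrow> (\<lambda>t. \<Phi> t (p t)) \<in> borel_measurable M"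
    and g: "integrable M g" "\<And>t y. norm y \<le> m t \<Longrightarrow> norm (\<Phi> t y) \<le> g t"
  shows "integrable M (\<lambda>t. \<Phi> t (p t))"
proof (rule Bochner_Integration.integrable_bound[OF g(1) \<Phi>[OF tail_hull_borel_measurable[OF p v_measurable]]])
  show "AE t in M. norm (\<Phi> t (p t)) \<le> norm (g t)"
    using tail_hull_AE_norm_le[OF p]
    by eventually_elim (use g(2) in \<open>fastforce intro: order_trans[OF _ abs_ge_self]\<close>)
qed

lemma tail_hull_integral_tendsto:
  fixes \<Phi> :: "'a \<Rightarrow> 'b \<Rightarrow> 'c::{banach, second_countable_topology}"
  assumes q: "\<And>n. q n \<in> tail_hull v n" and z: "z \<in> borel_measurable M" "AE t in M. (\<lambda>n. q n t) \<longlonglongrightarrow> z t"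
    and \<Phi>: "\<And>p. p \<in> borel_measurable M \<Longrightarrow> (\<lambda>t. \<Phi> t (p t)) \<in> borel_measurable M"
      "\<And>t. continuous_on UNIV (\<Phi> t)"
    and g: "integrable M g" "\<And>t y. norm y \<le> m t \<Longrightarrow> norm (\<Phi> t y) \<le> g t"
  shows "(\<lambda>n. \<integral>t. \<Phi> t (q n t) \<partial>M) \<longlonglongrightarrow> (\<integral>t. \<Phi> t (z t) \<partial>M)"
proof (rule integral_dominated_convergence[OF \<Phi>(1)[OF z(1)]
      \<Phi>(1)[OF tail_hull_borel_measurable[OF q v_measurable]] g(1)])
  show "AE t in M. (\<lambda>n. \<Phi> t (q n t)) \<longlonglongrightarrow> \<Phi> t (z t)"
    using z(2) by eventually_elim (rule continuous_on_tendsto_compose[OF \<Phi>(2)], auto)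
  show "AE t in M. norm (\<Phi> t (q n t)) \<le> g t" for n
    using tail_hull_AE_norm_le[OF q] by eventually_elim (rule g(2))
qed

lemma tail_hull_limit_integral:
  fixes K :: "'a \<Rightarrow> 'b \<Rightarrow> 'c::{banach, second_countable_topology}"
  assumes z: "tail_hull_limit M v z"
    and K: "\<And>s. bounded_linear (K s)" "\<And>s y. norm (K s y) \<le> C * norm y"
      "\<And>p. p \<in> borel_measurable M \<Longrightarrow> (\<lambda>s. K s (p s)) \<in> borel_measurable M"
    and C: "0 \<le> C" and l: "(\<lambda>k. \<integral>s. K s (v k s) \<partial>M) \<longlonglongrightarrow> l"
  shows "(\<integral>s. K s (z s) \<partial>M) = l"
proof -
  obtain q where q: "\<And>n. q n \<in> tail_hull v n" and z_measurable: "z \<in> borel_measurable M"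
    and qz: "AE t in M. (\<lambda>n. q n t) \<longlonglongrightarrow> z t"
    using z unfolding tail_hull_limit_def by blast
  have g: "integrable M (\<lambda>t. C * m t)" "\<And>t y. norm y \<le> m t \<Longrightarrow> norm (K t y) \<le> C * m t"
    using m_integrable K(2) mult_left_mono[OF _ C] order_trans by (simp, blast)
  have "(\<lambda>n. \<integral>s. K s (q n s) \<partial>M) \<longlonglongrightarrow> (\<integral>s. K s (z s) \<partial>M)"
    using K(1) by (intro tail_hull_integral_tendsto[OF q z_measurable qz K(3) _ g] linear_continuous_on) auto
  then have lim: "(\<lambda>n. norm ((\<integral>s. K s (q n s) \<partial>M) - l)) \<longlonglongrightarrow> norm ((\<integral>s. K s (z s) \<partial>M) - l)"
    by (intro tendsto_intros)
  have "convex_functional (tail_hull v 0) (\<lambda>p. norm ((\<integral>s. K s (p s) \<partial>M) - l))"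
    unfolding convex_functional_def
  proof (intro ballI allI impI)
    fix p p' and a c :: real
    assume p: "p \<in> tail_hull v 0" "p' \<in> tail_hull v 0" and ac: "0 \<le> a" "0 \<le> c" "a + c = 1"
    note integrable = p[THEN tail_hull_integrable_compose, where \<Phi> = K, OF K(3) g]
    have "(\<integral>s. K s (a *\<^sub>R p s + c *\<^sub>R p' s) \<partial>M)
        = a *\<^sub>R (\<integral>s. K s (p s) \<partial>M) + c *\<^sub>R (\<integral>s. K s (p' s) \<partial>M)"
      using integrable
      by (simp add: linear_add[OF bounded_linear.linear[OF K(1)]] linear_scale[OF bounded_linear.linear[OF K(1)]])
    moreover have "convex_on UNIV (\<lambda>x. norm (x - l))"
      using convex_on_dist[of UNIV l] by (simp add: dist_norm norm_minus_commute)
    ultimately show "norm ((\<integral>s. K s (a *\<^sub>R p s + c *\<^sub>R p' s) \<partial>M) - l)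
        \<le> a * norm ((\<integral>s. K s (p s) \<partial>M) - l) + c * norm ((\<integral>s. K s (p' s) \<partial>M) - l)"
      using ac by (simp add: convex_on_def)
  qed
  moreover have "(\<lambda>k. norm ((\<integral>s. K s (v k s) \<partial>M) - l)) \<longlonglongrightarrow> 0"
    using l by (simp add: LIM_zero_iff tendsto_norm_zero_iff)
  ultimately have "norm ((\<integral>s. K s (z s) \<partial>M) - l) \<le> 0"
    by (intro tail_hull_limit_convex_functional_le[OF q _ lim order_refl])
  then show ?thesis
    by simp
qed

lemma tail_hull_limit_convex_integral_le:
  assumes z: "tail_hull_limit M v z" and \<phi>: "convex_on UNIV \<phi>" "continuous_on UNIV \<phi>"
    and \<phi>_le: "\<And>y. \<bar>\<phi> y\<bar> \<le> (norm y)\<^sup>2" and \<rho>: "(\<lambda>k. \<integral>s. \<phi> (v k s) \<partial>M) \<longlonglongrightarrow> \<rho>"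
  shows "(\<integral>s. \<phi> (z s) \<partial>M) \<le> \<rho>"
proof -
  obtain q where q: "\<And>n. q n \<in> tail_hull v n" and z_measurable: "z \<in> borel_measurable M"
    and qz: "AE t in M. (\<lambda>n. q n t) \<longlonglongrightarrow> z t"
    using z unfolding tail_hull_limit_def by blast
  have \<phi>_measurable: "(\<lambda>t. \<phi> (p t)) \<in> borel_measurable M" if "p \<in> borel_measurable M" for p
    using that borel_measurable_continuous_onI[OF \<phi>(2)] by (rule measurable_compose)
  have \<phi>_bound: "norm (\<phi> y) \<le> (m t)\<^sup>2" if "norm y \<le> m t" for t y
    using \<phi>_le[of y] power_mono[OF that norm_ge_zero, of 2] by simp
  note \<phi>_integrable =
    tail_hull_integrable_compose[where \<Phi> = "\<lambda>_. \<phi>", OF _ \<phi>_measurable m_square_integrable \<phi>_bound]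
  have lim: "(\<lambda>n. \<integral>s. \<phi> (q n s) \<partial>M) \<longlonglongrightarrow> (\<integral>s. \<phi> (z s) \<partial>M)"
    by (rule tail_hull_integral_tendsto[OF q z_measurable qz \<phi>_measurable \<phi>(2) m_square_integrable \<phi>_bound])
  have "convex_functional (tail_hull v 0) (\<lambda>p. \<integral>s. \<phi> (p s) \<partial>M)"
    unfolding convex_functional_def
  proof (intro ballI allI impI)
    fix p p' and a c :: real
    assume p: "p \<in> tail_hull v 0" "p' \<in> tail_hull v 0" and ac: "0 \<le> a" "0 \<le> c" "a + c = 1"
    have "(\<integral>s. \<phi> (a *\<^sub>R p s + c *\<^sub>R p' s) \<partial>M) \<le> (\<integral>s. a * \<phi> (p s) + c * \<phi> (p' s) \<partial>M)"
    proof (rule integral_mono)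
      show "integrable M (\<lambda>s. \<phi> (a *\<^sub>R p s + c *\<^sub>R p' s))"
        by (rule \<phi>_integrable[OF tail_hull.combination[OF p ac]])
      show "integrable M (\<lambda>s. a * \<phi> (p s) + c * \<phi> (p' s))"
        using \<phi>_integrable p by simp
      show "\<phi> (a *\<^sub>R p s + c *\<^sub>R p' s) \<le> a * \<phi> (p s) + c * \<phi> (p' s)" for s
        using \<phi>(1) ac by (simp add: convex_on_def)
    qed
    also have "\<dots> = a * (\<integral>s. \<phi> (p s) \<partial>M) + c * (\<integral>s. \<phi> (p' s) \<partial>M)"
      using \<phi>_integrable p by simp
    finally show "(\<integral>s. \<phi> (a *\<^sub>R p s + c *\<^sub>R p' s) \<partial>M)
        \<le> a * (\<integral>s. \<phi> (p s) \<partial>M) + c * (\<integral>s. \<phi> (p' s) \<partial>M)" .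
  qed
  then show ?thesis
    by (rule tail_hull_limit_convex_functional_le[OF q _ lim order_refl \<rho>])
qed

end


subsection \<open>Trajectories of the control system\<close>

lemma (in bounded_C0_semigroup) coupled_system_bound:
  fixes u u' :: "real \<Rightarrow> 'h::{banach, second_countable_topology}"
  assumes h: "integrable (leb b) h" and x: "\<And>t. t \<in> {0..b} \<Longrightarrow> x t = T t x0 + convol h t"
    and u: "has_W12_derivative b u u'"
    and \<alpha>: "integrable (leb b) \<alpha>" "AE t in leb b. 0 \<le> \<alpha> t" and c_nonneg: "0 \<le> c"
    and h_le: "AE t in leb b. norm (h t) \<le> \<alpha> t + c * (norm (x t) + norm (u t))"
    and u'_le: "AE t in leb b. norm (u' t) \<le> \<alpha> t + c * (norm (x t) + norm (u t))"
    and t: "t \<in> {0..b}"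
  shows "norm (x t) + norm (u t)
    \<le> (M * norm x0 + norm (u 0) + (M + 1) * (\<integral>s. \<alpha> s \<partial>leb b)) * exp ((M + 1) * c * t)"
proof (rule gronwall_integral[OF _ _ _ t])
  have "continuous_on {0..b} (\<lambda>t. T t x0 + convol h t)"
    by (intro continuous_intros continuous_on_T_apply continuous_on_convol h)
  then have "continuous_on {0..b} x"
    by (rule continuous_on_eq) (simp add: x)
  then show cont: "continuous_on {0..b} (\<lambda>t. norm (x t) + norm (u t))"
    by (intro continuous_intros has_W12_derivative_continuous[OF u])
  fix t assume t: "t \<in> {0..b}"
  define P where "P s = \<alpha> s + c * (norm (x s) + norm (u s))" for s
  have state_integrable: "integrable (leb b) (\<lambda>s. norm (x s) + norm (u s))"
    by (intro continuous_imp_integrable_real cont)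
  then have P: "integrable (leb b) P"
    unfolding P_def using \<alpha>(1) by simp
  have "norm (x t) \<le> norm (T t x0) + norm (convol h t)"
    unfolding x[OF t] by (rule norm_triangle_ineq)
  also have "\<dots> \<le> M * norm x0 + M * (\<integral>s. P s \<partial>lebesgue_on {0..t})"
    using h_le t by (intro add_mono norm_T_apply_le norm_convol_le P) (simp_all add: P_def)
  finally have x_le: "norm (x t) \<le> M * norm x0 + M * (\<integral>s. P s \<partial>lebesgue_on {0..t})" .
  have "norm (u t - u 0) \<le> (\<integral>s. P s \<partial>lebesgue_on {0..t})"
    using u'_le t by (intro has_W12_derivative_norm_diff_le[OF u _ _ _ P]) (simp_all add: P_def)
  then have u_le: "norm (u t) \<le> norm (u 0) + (\<integral>s. P s \<partial>lebesgue_on {0..t})"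
    using norm_triangle_sub[of "u t" "u 0"] by linarith
  have "(\<integral>s. P s \<partial>lebesgue_on {0..t})
      \<le> (\<integral>s. \<alpha> s \<partial>leb b) + c * (\<integral>s. norm (x s) + norm (u s) \<partial>lebesgue_on {0..t})"
    unfolding P_def using t by (intro integral_interval_affine_le \<alpha> state_integrable) auto
  then have "(M + 1) * (\<integral>s. P s \<partial>lebesgue_on {0..t})
      \<le> (M + 1) * ((\<integral>s. \<alpha> s \<partial>leb b) + c * (\<integral>s. norm (x s) + norm (u s) \<partial>lebesgue_on {0..t}))"
    using M_nonneg by (intro mult_left_mono) auto
  then show "norm (x t) + norm (u t) \<le> M * norm x0 + norm (u 0) + (M + 1) * (\<integral>s. \<alpha> s \<partial>leb b)
      + (M + 1) * c * (\<integral>s. norm (x s) + norm (u s) \<partial>lebesgue_on {0..t})"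
    using x_le u_le by (simp add: algebra_simps)
qed (use c_nonneg M_nonneg in auto)

definition growth_lipschitz_multi ::
    "real \<Rightarrow> (real \<Rightarrow> 'e::real_normed_vector \<Rightarrow> 'h::real_normed_vector \<Rightarrow> 'v::real_normed_vector set) \<Rightarrow>
     real \<Rightarrow> (real \<Rightarrow> real) \<Rightarrow> bool" where
  "growth_lipschitz_multi b \<Phi> C k \<longleftrightarrow> 0 \<le> C \<and>
     (\<forall>t\<in>{0..b}. \<forall>x u. closed (\<Phi> t x u) \<and> convex (\<Phi> t x u) \<and> \<Phi> t x u \<noteq> {}) \<and>
     (AE t in leb b. \<forall>x u. \<forall>y\<in>\<Phi> t x u. norm y \<le> C * (1 + norm x + norm u)) \<and>
     (AE t in leb b. \<forall>x u x' u'. Haus (\<Phi> t x u) (\<Phi> t x' u') \<le> ereal (k t * (norm (x - x') + norm (u - u'))))"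

text \<open>The values of a trajectory are bundled into one function with values in \<open>'e \<times> 'y \<times> 'h \<times> 'h\<close>: the
  selection of \<open>F\<close>, the control, the selection of \<open>G\<close> and the derivative of \<open>u\<close>.\<close>

abbreviation control_part :: "'e \<times> 'y \<times> 'h \<times> 'h \<Rightarrow> 'y" where
  "control_part p \<equiv> fst (snd p)"

abbreviation reaction_part :: "'e \<times> 'y \<times> 'h \<times> 'h \<Rightarrow> 'h" where
  "reaction_part p \<equiv> fst (snd (snd p))"

abbreviation velocity_part :: "'e \<times> 'y \<times> 'h \<times> 'h \<Rightarrow> 'h" where
  "velocity_part p \<equiv> snd (snd (snd p))"

lemma norm_fst_snd_le: "norm (fst p) \<le> norm p" "norm (snd p) \<le> norm p"
  for p :: "'a::real_normed_vector \<times> 'b::real_normed_vector"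
  by (cases p, simp add: norm_fst_le norm_snd_le)+

lemma norm_parts_le:
  fixes p :: "'e::real_normed_vector \<times> 'y::real_normed_vector \<times> 'h::real_normed_vector \<times> 'h"
  shows "norm (control_part p) \<le> norm p" "norm (reaction_part p) \<le> norm p" "norm (velocity_part p) \<le> norm p"
  by (meson norm_fst_snd_le order_trans)+

lemma norm_le_sum_parts:
  fixes p :: "'e::real_normed_vector \<times> 'y::real_normed_vector \<times> 'h::real_normed_vector \<times> 'h"
  shows "norm p \<le> norm (fst p) + norm (control_part p) + norm (reaction_part p) + norm (velocity_part p)"
  using norm_Pair_le[of "fst p" "snd p"] norm_Pair_le[of "control_part p" "snd (snd p)"]
    norm_Pair_le[of "reaction_part p" "velocity_part p"] by simp

locale control_system =
  compact_C0_semigroup T b M + state_dependent_monotone b A \<theta> \<theta>' lam MB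
  for T :: "real \<Rightarrow> 'e::{real_inner, banach, second_countable_topology} \<Rightarrow>\<^sub>L 'e" and b M :: real
    and A :: "real \<Rightarrow> 'h::{real_inner, banach, second_countable_topology} \<Rightarrow> 'h \<Rightarrow> 'h set"
    and \<theta> \<theta>' :: "real \<Rightarrow> real" and lam MB :: real +
  fixes F :: "real \<Rightarrow> 'e \<Rightarrow> 'h \<Rightarrow> 'e set" and MF :: real and kF :: "real \<Rightarrow> real"
    and G :: "real \<Rightarrow> 'e \<Rightarrow> 'h \<Rightarrow> 'h set" and MG :: real and kG :: "real \<Rightarrow> real"
    and W :: "real \<Rightarrow> 'y::{real_inner, banach, second_countable_topology} set" and \<phi>W :: "real \<Rightarrow> real"
    and Bop :: "'y \<Rightarrow>\<^sub>L 'e" and x0 :: 'e and u0 :: 'h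
  assumes dom_compact: "\<And>R. ball_relatively_compact (\<Union>t\<in>{0..b}. \<Union>u\<in>cball 0 R. op_dom (A t u))"
    and F: "growth_lipschitz_multi b F MF kF" and G: "growth_lipschitz_multi b G MG kG"
    and W: "\<And>t. t \<in> {0..b} \<Longrightarrow> closed (W t) \<and> convex (W t)"
    and \<phi>W: "in_L2 b \<phi>W" "AE t in leb b. \<forall>w\<in>W t. norm w \<le> \<phi>W t"
begin

definition forcing :: "'e \<times> 'y \<times> 'h \<times> 'h \<Rightarrow> 'e" where
  "forcing p = fst p + Bop (control_part p)"

lemma bounded_linear_forcing: "bounded_linear forcing"
  unfolding forcing_def by (intro bounded_linear_intros)

lemma norm_forcing_le: "norm (forcing p) \<le> (1 + norm Bop) * norm p"
  using norm_triangle_ineq[of "fst p" "Bop (control_part p)"] norm_fst_snd_le(1)[of p]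
    norm_blinfun[of Bop "control_part p"] mult_left_mono[OF norm_parts_le(1)[of p], of "norm Bop"]
  by (simp add: forcing_def distrib_right)

definition velocities :: "real \<Rightarrow> 'e \<Rightarrow> 'h \<Rightarrow> ('e \<times> 'y \<times> 'h \<times> 'h) set" where
  "velocities t x u = {p. fst p \<in> F t x u \<and> control_part p \<in> W t \<and> reaction_part p \<in> G t x u \<and>
     - velocity_part p + reaction_part p \<in> A t u u}"

definition trajectory :: "(real \<Rightarrow> 'e) \<Rightarrow> (real \<Rightarrow> 'h) \<Rightarrow> (real \<Rightarrow> 'e \<times> 'y \<times> 'h \<times> 'h) \<Rightarrow> bool" where
  "trajectory x u z \<longleftrightarrow> integrable (leb b) z \<and> u 0 = u0 \<and> has_W12_derivative b u (\<lambda>t. velocity_part (z t)) \<and>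
     (AE t in leb b. z t \<in> velocities t (x t) (u t)) \<and>
     (\<forall>t\<in>{0..b}. x t = T t x0 + convol (\<lambda>s. forcing (z s)) t)"

lemma trajectory_forcing_integrable: "trajectory x u z \<Longrightarrow> integrable (leb b) (\<lambda>s. forcing (z s))"
  unfolding trajectory_def by (blast intro: integrable_bounded_linear[OF bounded_linear_forcing])

lemma trajectory_continuous:
  assumes "trajectory x u z"
  shows "continuous_on {0..b} x" "continuous_on {0..b} u"
proof -
  have "continuous_on {0..b} (\<lambda>t. T t x0 + convol (\<lambda>s. forcing (z s)) t)"
    by (intro continuous_intros continuous_on_T_apply continuous_on_convol trajectory_forcing_integrable[OF assms])
  then show "continuous_on {0..b} x"
    by (rule continuous_on_eq) (use assms in \<open>simp add: trajectory_def\<close>)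
  show "continuous_on {0..b} u"
    using assms has_W12_derivative_continuous unfolding trajectory_def by blast
qed


subsection \<open>A priori bounds\<close>

definition source :: "real \<Rightarrow> real" where
  "source t = MF + velocity_factor * (1 + MG) + norm Bop * norm (\<phi>W t) + velocity_factor * norm (\<theta>' t)"

definition growth :: real where
  "growth = MF + velocity_factor * (MG + 1)"

definition state_bound :: real where
  "state_bound = (M * norm x0 + norm u0 + (M + 1) * (\<integral>s. source s \<partial>leb b)) * exp ((M + 1) * growth * b)"

definition velocity_bound :: "real \<Rightarrow> real" where
  "velocity_bound t = (MF + MG) * (1 + state_bound) + norm (\<phi>W t) + source t + growth * state_bound"

lemma constants_nonneg: "0 \<le> MF" "0 \<le> MG" "0 \<le> growth" "0 \<le> source t"
proof -
  show "0 \<le> MF" "0 \<le> MG"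
    using F G by (auto simp: growth_lipschitz_multi_def)
  then show "0 \<le> growth" "0 \<le> source t"
    using velocity_factor_nonneg by (auto simp: growth_def source_def)
qed

lemma source_L2: "in_L2 b source"
proof -
  have "in_L2 b \<theta>'"
    using \<theta> by (simp add: has_W12_derivative_def)
  then show ?thesis
    unfolding source_def using \<phi>W(1) by (intro in_L2_add in_L2_mult_left in_L2_norm in_L2_const)
qed

lemma velocity_bound_L2: "in_L2 b velocity_bound"
  unfolding velocity_bound_def using \<phi>W(1) source_L2 by (intro in_L2_add in_L2_norm in_L2_const)

lemma trajectory_parts_bound:
  assumes "trajectory x u z"
  shows "AE t in leb b. norm (fst (z t)) \<le> MF * (1 + norm (x t) + norm (u t)) \<and>
    norm (control_part (z t)) \<le> norm (\<phi>W t) \<and>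
    norm (reaction_part (z t)) \<le> MG * (1 + norm (x t) + norm (u t)) \<and>
    norm (velocity_part (z t)) \<le> source t + growth * (norm (x t) + norm (u t))"
proof -
  have z: "AE t in leb b. z t \<in> velocities t (x t) (u t)"
    and u: "has_W12_derivative b u (\<lambda>t. velocity_part (z t))"
    using assms by (auto simp: trajectory_def)
  have "AE t in leb b. - velocity_part (z t) + reaction_part (z t) \<in> A t (u t) (u t)"
    using z by eventually_elim (simp add: velocities_def)
  note velocity = inclusion_velocity_bound[OF u this]
  have "AE t in leb b. \<forall>x u. \<forall>f\<in>F t x u. norm f \<le> MF * (1 + norm x + norm u)"
    "AE t in leb b. \<forall>x u. \<forall>g\<in>G t x u. norm g \<le> MG * (1 + norm x + norm u)"
    using F G by (auto simp: growth_lipschitz_multi_def)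
  with z \<phi>W(2) velocity show ?thesis
  proof eventually_elim
    case (elim t)
    have g: "norm (reaction_part (z t)) \<le> MG * (1 + norm (x t) + norm (u t))"
      using elim(1,5) by (auto simp: velocities_def)
    then have "norm (velocity_part (z t)) \<le> velocity_factor *
        (1 + MG * (1 + norm (x t) + norm (u t)) + (norm (x t) + norm (u t)) + norm (\<theta>' t))"
      using elim(3) velocity_factor_nonneg
      by (elim order_trans) (intro mult_left_mono, use norm_ge_zero[of "x t"] in \<open>auto simp del: norm_ge_zero\<close>)
    also have "\<dots> = velocity_factor * (1 + MG) + velocity_factor * norm (\<theta>' t)
        + velocity_factor * (MG + 1) * (norm (x t) + norm (u t))"
      by (simp add: algebra_simps)
    also have "\<dots> \<le> source t + growth * (norm (x t) + norm (u t))"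
      unfolding source_def growth_def using constants_nonneg by (intro add_mono mult_right_mono) auto
    finally have "norm (velocity_part (z t)) \<le> source t + growth * (norm (x t) + norm (u t))" .
    moreover have "norm (control_part (z t)) \<le> norm (\<phi>W t)"
      using elim(1,2) by (force simp: velocities_def)
    moreover have "norm (fst (z t)) \<le> MF * (1 + norm (x t) + norm (u t))"
      using elim(1,4) by (auto simp: velocities_def)
    ultimately show ?case
      using g by blast
  qed
qed

lemma trajectory_forcing_bound:
  assumes "trajectory x u z"
  shows "AE t in leb b. norm (forcing (z t)) \<le> source t + growth * (norm (x t) + norm (u t))"
  using trajectory_parts_bound[OF assms]
proof eventually_elim
  case (elim t)
  have "norm (Bop (control_part (z t))) \<le> norm Bop * norm (\<phi>W t)"
    using elim norm_blinfun[of Bop "control_part (z t)"] mult_left_mono[of _ "norm (\<phi>W t)" "norm Bop"] by force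
  then have "norm (forcing (z t)) \<le> MF * (1 + norm (x t) + norm (u t)) + norm Bop * norm (\<phi>W t)"
    unfolding forcing_def using elim norm_triangle_ineq[of "fst (z t)" "Bop (control_part (z t))"] by linarith
  also have "\<dots> = MF + norm Bop * norm (\<phi>W t) + MF * (norm (x t) + norm (u t))"
    by (simp add: algebra_simps)
  also have "\<dots> \<le> source t + growth * (norm (x t) + norm (u t))"
  proof (rule add_mono)
    show "MF + norm Bop * norm (\<phi>W t) \<le> source t"
      unfolding source_def using constants_nonneg velocity_factor_nonneg by simp
    show "MF * (norm (x t) + norm (u t)) \<le> growth * (norm (x t) + norm (u t))"
      unfolding growth_def using constants_nonneg velocity_factor_nonneg by (intro mult_right_mono) auto
  qed
  finally show ?case .
qed

lemma trajectory_state_bound: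
  assumes tr: "trajectory x u z" and t: "t \<in> {0..b}"
  shows "norm (x t) + norm (u t) \<le> state_bound"
proof -
  define c where "c = M * norm x0 + norm u0 + (M + 1) * (\<integral>s. source s \<partial>leb b)"
  have "norm (x t) + norm (u t)
      \<le> (M * norm x0 + norm (u 0) + (M + 1) * (\<integral>s. source s \<partial>leb b)) * exp ((M + 1) * growth * t)"
  proof (rule coupled_system_bound[OF trajectory_forcing_integrable[OF tr] _ _ _ _ _ _ _ t])
    show "has_W12_derivative b u (\<lambda>t. velocity_part (z t))"
      using tr by (simp add: trajectory_def)
    show "AE t in leb b. norm (velocity_part (z t)) \<le> source t + growth * (norm (x t) + norm (u t))"
      using trajectory_parts_bound[OF tr] by eventually_elim simp
  qed (use tr trajectory_forcing_bound[OF tr] in_L2_integrable[OF source_L2] constants_nonneg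
      in \<open>auto simp: trajectory_def\<close>)
  also have "M * norm x0 + norm (u 0) + (M + 1) * (\<integral>s. source s \<partial>leb b) = c"
    using tr by (simp add: trajectory_def c_def)
  also have "c * exp ((M + 1) * growth * t) \<le> c * exp ((M + 1) * growth * b)"
    unfolding c_def using t M_nonneg constants_nonneg
    by (auto intro!: mult_left_mono add_nonneg_nonneg mult_nonneg_nonneg Bochner_Integration.integral_nonneg)
  finally show ?thesis
    by (simp add: state_bound_def c_def)
qed

lemma trajectory_state_norm_le:
  assumes "trajectory x u z" "t \<in> {0..b}"
  shows "norm (x t) \<le> state_bound" "norm (u t) \<le> state_bound"
  using trajectory_state_bound[OF assms] norm_ge_zero[of "x t"] norm_ge_zero[of "u t"] by linarith+

lemma trajectory_velocity_bound:
  assumes tr: "trajectory x u z"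
  shows "AE t in leb b. norm (z t) \<le> velocity_bound t"
  using trajectory_parts_bound[OF tr] AE_lebesgue_on_mem
proof eventually_elim
  case (elim t)
  note state = trajectory_state_bound[OF tr elim(2)]
  have "MF * (1 + norm (x t) + norm (u t)) \<le> MF * (1 + state_bound)"
    "MG * (1 + norm (x t) + norm (u t)) \<le> MG * (1 + state_bound)"
    "growth * (norm (x t) + norm (u t)) \<le> growth * state_bound"
    using state constants_nonneg by (auto intro!: mult_left_mono)
  then show ?case
    using elim norm_le_sum_parts[of "z t"] unfolding velocity_bound_def distrib_right by linarith
qed


subsection \<open>Compactness\<close>

definition state_set :: "'h set" where
  "state_set = closure ((\<Union>t\<in>{0..b}. \<Union>u\<in>cball 0 state_bound. op_dom (A t u)) \<inter> cball 0 state_bound)"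

lemma compact_state_set: "compact state_set"
  using dom_compact unfolding state_set_def ball_relatively_compact_def relatively_compact_def by blast

lemma trajectory_mem_state_set:
  assumes tr: "trajectory x u z" and t: "t \<in> {0..b}"
  shows "u t \<in> state_set"
proof (rule AE_interval_continuous_closed[OF trajectory_continuous(2)[OF tr] _ _ b t])
  have "AE s in leb b. z s \<in> velocities s (x s) (u s)"
    using tr by (simp add: trajectory_def)
  with AE_lebesgue_on_mem show "AE s in leb b. u s \<in> state_set"
  proof eventually_elim
    case (elim s)
    have "u s \<in> op_dom (A s (u s))"
      using elim(2) by (auto simp: op_dom_def velocities_def)
    moreover have "u s \<in> cball 0 state_bound"
      using trajectory_state_norm_le(2)[OF tr elim(1)] by simp
    ultimately have "u s \<in> (\<Union>t\<in>{0..b}. \<Union>u\<in>cball 0 state_bound. op_dom (A t u)) \<inter> cball 0 state_bound"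
      using elim(1) by blast
    then show ?case
      unfolding state_set_def by (rule subsetD[OF closure_subset])
  qed
qed (simp add: state_set_def)

lemma trajectory_convol_convergent_subsequence:
  assumes tr: "\<And>n. trajectory (x n) (u n) (z n)"
  obtains r :: "nat \<Rightarrow> nat" where "strict_mono r"
    "\<And>t. t \<in> {0..b} \<Longrightarrow> convergent (\<lambda>n. convol (\<lambda>s. forcing (z (r n) s)) t)"
proof -
  let ?h = "\<lambda>n s. forcing (z n s)"
  note h = trajectory_forcing_integrable[OF tr]
  have m: "integrable (leb b) (\<lambda>t. (1 + norm Bop) * velocity_bound t)"
    using in_L2_integrable[OF velocity_bound_L2] by simp
  have h_le: "AE s in leb b. norm (?h n s) \<le> (1 + norm Bop) * velocity_bound s" for n
    using trajectory_velocity_bound[OF tr[of n]]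
  proof eventually_elim
    case (elim s)
    then show ?case
      using norm_forcing_le[of "z n s"] mult_left_mono[OF elim, of "1 + norm Bop"] by simp
  qed
  show ?thesis
  proof (rule pointwise_convergent_subsequence[of 0 b "\<lambda>n. convol (?h n)"])
    show "\<exists>K. compact K \<and> (\<forall>n. convol (?h n) t \<in> K)" if "t \<in> {0..b}" for t
      by (rule exI[of _ "closure (range (\<lambda>n. convol (?h n) t))"])
        (use compact_closure_convol[OF h m h_le that] in \<open>auto intro: closure_subset[THEN subsetD]\<close>)
    show "uniform_limit UNIV (\<lambda>\<tau> n. convol (?h n) \<tau>) (\<lambda>n. convol (?h n) t) (at_right t)"
      if "t \<in> {0..<b}" for t
      using that by (intro convol_right_equicontinuous[OF h m h_le]) auto
  qed (use b that in auto)
qed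

lemma trajectory_state_convergent_subsequence:
  assumes tr: "\<And>n. trajectory (x n) (u n) (z n)"
  obtains r :: "nat \<Rightarrow> nat" where "strict_mono r" "\<And>t. t \<in> {0..b} \<Longrightarrow> convergent (\<lambda>n. u (r n) t)"
proof (rule pointwise_convergent_subsequence[of 0 b u])
  show "\<exists>K. compact K \<and> (\<forall>n. u n t \<in> K)" if "t \<in> {0..b}" for t
    using compact_state_set trajectory_mem_state_set[OF tr that] by blast
  show "uniform_limit UNIV (\<lambda>\<tau> n. u n \<tau>) (\<lambda>n. u n t) (at_right t)" if "t \<in> {0..<b}" for t
  proof (rule has_W12_derivative_right_equicontinuous[OF _ in_L2_integrable[OF velocity_bound_L2]])
    show "has_W12_derivative b (u n) (\<lambda>t. velocity_part (z n t))" for n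
      using tr by (simp add: trajectory_def)
    show "AE s in leb b. norm (velocity_part (z n s)) \<le> velocity_bound s" for n
      using trajectory_velocity_bound[OF tr[of n]]
      by eventually_elim (meson norm_parts_le(3) order_trans)
  qed (use that in auto)
qed (use b that in auto)

lemma trajectory_pointwise_convergent_subsequence:
  assumes tr: "\<And>n. trajectory (x n) (u n) (z n)"
  obtains r :: "nat \<Rightarrow> nat" and x' u' where "strict_mono r"
    "\<And>t. t \<in> {0..b} \<Longrightarrow> (\<lambda>n. x (r n) t) \<longlonglongrightarrow> x' t" "\<And>t. t \<in> {0..b} \<Longrightarrow> (\<lambda>n. u (r n) t) \<longlonglongrightarrow> u' t"
proof -
  obtain rx :: "nat \<Rightarrow> nat" where rx: "strict_mono rx"
    "\<And>t. t \<in> {0..b} \<Longrightarrow> convergent (\<lambda>n. convol (\<lambda>s. forcing (z (rx n) s)) t)"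
    by (rule trajectory_convol_convergent_subsequence[of x u z, OF tr]) (rule that)
  obtain ru :: "nat \<Rightarrow> nat" where ru: "strict_mono ru" "\<And>t. t \<in> {0..b} \<Longrightarrow> convergent (\<lambda>n. u (rx (ru n)) t)"
    by (rule trajectory_state_convergent_subsequence[of "\<lambda>n. x (rx n)" "\<lambda>n. u (rx n)" "\<lambda>n. z (rx n)", OF tr])
      (rule that)
  show ?thesis
  proof (rule that)
    show "strict_mono (rx \<circ> ru)"
      using rx(1) ru(1) by (rule strict_mono_o)
    fix t assume t: "t \<in> {0..b}"
    have "x n t = T t x0 + convol (\<lambda>s. forcing (z n s)) t" for n
      using tr[of n] t by (simp add: trajectory_def)
    moreover have "convergent (\<lambda>n. convol (\<lambda>s. forcing (z (rx (ru n)) s)) t)"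
      using convergent_subseq_convergent[OF rx(2)[OF t] ru(1)] by (simp add: o_def)
    ultimately have "convergent (\<lambda>n. x ((rx \<circ> ru) n) t)"
      by (simp add: convergent_add convergent_const)
    then show "(\<lambda>n. x ((rx \<circ> ru) n) t) \<longlonglongrightarrow> lim (\<lambda>n. x ((rx \<circ> ru) n) t)"
      by (simp add: convergent_LIMSEQ_iff)
    show "(\<lambda>n. u ((rx \<circ> ru) n) t) \<longlonglongrightarrow> lim (\<lambda>n. u ((rx \<circ> ru) n) t)"
      using ru(2)[OF t] by (simp add: convergent_LIMSEQ_iff)
  qed
qed

end


subsection \<open>Closedness\<close>

lemma Lipschitz_multi_limit_mem:
  assumes y: "convex_tail_limit y p" and mem: "\<And>k. y k \<in> \<Phi> (x k) (u k)"
    and S: "closed (\<Phi> x' u')" "convex (\<Phi> x' u')" "\<Phi> x' u' \<noteq> {}"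
    and Haus: "\<And>k. Haus (\<Phi> (x k) (u k)) (\<Phi> x' u') \<le> ereal (c * (norm (x k - x') + norm (u k - u')))"
    and lim: "x \<longlonglongrightarrow> x'" "u \<longlonglongrightarrow> u'"
  shows "p \<in> \<Phi> x' u'"
proof (rule convex_tail_limit_mem[OF y S])
  show "infdist (y k) (\<Phi> x' u') \<le> c * (norm (x k - x') + norm (u k - u'))" for k
    by (rule Haus_leD[OF Haus mem])
  have "(\<lambda>k. c * (norm (x k - x') + norm (u k - u'))) \<longlonglongrightarrow> c * (norm (x' - x') + norm (u' - u'))"
    by (intro tendsto_intros lim)
  then show "(\<lambda>k. c * (norm (x k - x') + norm (u k - u'))) \<longlonglongrightarrow> 0"
    by simp
qed

lemma (in state_dependent_monotone) monotone_limit_mem: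
  assumes t: "t \<in> {0..b}" and Y: "convex_tail_limit Y p" "\<And>k. Y k \<in> A t (u k) (u k)" "\<And>k. norm (Y k) \<le> m"
    and lim: "u \<longlonglongrightarrow> u'"
  shows "p \<in> A t u' u'"
  unfolding maximal_monotone_mem_iff[OF maximal[OF t]]
proof (intro allI ballI)
  fix w y assume y: "y \<in> A t u' w"
  define \<phi> where "\<phi> q = (u' - w) \<bullet> y - (u' - w) \<bullet> q" for q
  have affine: "\<phi> (a *\<^sub>R p + c *\<^sub>R q) = a * \<phi> p + c * \<phi> q" if "a + c = 1" for a c p q
  proof -
    have a: "a = 1 - c"
      using that by simp
    show ?thesis
      unfolding a \<phi>_def by (simp add: inner_add_right algebra_simps)
  qed
  have "\<phi> p \<le> 2 * (1 + m + norm y) * norm (u' - u')"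
  proof (rule convex_tail_limit_convex_on_le[OF Y(1)])
    show "convex_on UNIV \<phi>"
      by (simp add: convex_on_def affine)
    show "continuous_on UNIV \<phi>"
      unfolding \<phi>_def by (intro continuous_intros)
    show "\<phi> (Y k) \<le> 2 * (1 + m + norm y) * norm (u k - u')" for k
      unfolding \<phi>_def by (rule perturbed_monotonicity[OF t Y(2,3) y])
    show "(\<lambda>k. 2 * (1 + m + norm y) * norm (u k - u')) \<longlonglongrightarrow> 2 * (1 + m + norm y) * norm (u' - u')"
      by (intro tendsto_intros lim)
  qed
  moreover have "(p - y) \<bullet> (u' - w) = - \<phi> p"
    by (simp add: \<phi>_def inner_diff_left inner_diff_right inner_commute[of p] inner_commute[of y])
  ultimately show "0 \<le> (p - y) \<bullet> (u' - w)"
    by simp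
qed

context control_system
begin

lemma velocities_limit_mem:
  assumes t: "t \<in> {0..b}" and y: "convex_tail_limit y p"
      "\<And>k. y k \<in> velocities t (x k) (u k)" "\<And>k. norm (y k) \<le> m"
    and lim: "x \<longlonglongrightarrow> x'" "u \<longlonglongrightarrow> u'"
    and F_Haus: "\<forall>x u x' u'. Haus (F t x u) (F t x' u') \<le> ereal (kF t * (norm (x - x') + norm (u - u')))"
    and G_Haus: "\<forall>x u x' u'. Haus (G t x u) (G t x' u') \<le> ereal (kG t * (norm (x - x') + norm (u - u')))"
  shows "p \<in> velocities t x' u'"
proof -
  note part = convex_tail_limit_linear[OF _ y(1)]
  have "fst p \<in> F t x' u'"
  proof (rule Lipschitz_multi_limit_mem[OF part _ _ _ _ F_Haus[rule_format] lim])
    show "fst (y k) \<in> F t (x k) (u k)" for k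
      using y(2)[of k] by (simp add: velocities_def)
  qed (use F t in \<open>auto simp: growth_lipschitz_multi_def bounded_linear_fst\<close>)
  moreover have "reaction_part p \<in> G t x' u'"
  proof (rule Lipschitz_multi_limit_mem[OF part _ _ _ _ G_Haus[rule_format] lim])
    show "reaction_part (y k) \<in> G t (x k) (u k)" for k
      using y(2)[of k] by (simp add: velocities_def)
    show "bounded_linear (\<lambda>p :: 'e \<times> 'y \<times> 'h \<times> 'h. reaction_part p)"
      by (intro bounded_linear_intros)
  qed (use G t in \<open>auto simp: growth_lipschitz_multi_def\<close>)
  moreover have "control_part p \<in> W t"
  proof (rule convex_tail_limit_mem[OF part _ _ _ _ tendsto_const])
    have "control_part (y k) \<in> W t" for k
      using y(2)[of k] by (simp add: velocities_def)
    then show "infdist (control_part (y k)) (W t) \<le> 0" for k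
      by simp
    show "W t \<noteq> {}"
      using y(2)[of 0] by (auto simp: velocities_def)
    show "bounded_linear (\<lambda>p :: 'e \<times> 'y \<times> 'h \<times> 'h. control_part p)"
      by (intro bounded_linear_intros)
  qed (use W[OF t] in auto)
  moreover have "- velocity_part p + reaction_part p \<in> A t u' u'"
  proof (rule monotone_limit_mem[OF t part _ _ lim(2)])
    show "bounded_linear (\<lambda>p :: 'e \<times> 'y \<times> 'h \<times> 'h. - velocity_part p + reaction_part p)"
      by (intro bounded_linear_add bounded_linear_minus bounded_linear_intros)
    show "- velocity_part (y k) + reaction_part (y k) \<in> A t (u k) (u k)" for k
      using y(2)[of k] by (simp add: velocities_def)
    show "norm (- velocity_part (y k) + reaction_part (y k)) \<le> m + m" for k
      using norm_triangle_ineq[of "- velocity_part (y k)" "reaction_part (y k)"]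
        norm_parts_le(2,3)[of "y k"] y(3)[of k] by simp
  qed
  ultimately show ?thesis
    by (simp add: velocities_def)
qed

lemma trajectory_L2_dominated_sequence:
  assumes tr: "\<And>n. trajectory (x n) (u n) (z n)"
  shows "L2_dominated_sequence (leb b) z velocity_bound"
proof (intro L2_dominated_sequence.intro L2_dominated_sequence_axioms.intro)
  show "finite_measure (leb b)"
    by (rule finite_measure_lebesgue_on) simp
  show "velocity_bound \<in> borel_measurable (leb b)" "integrable (leb b) (\<lambda>t. (velocity_bound t)\<^sup>2)"
    using velocity_bound_L2 by (auto simp: in_L2_def)
  show "z n \<in> borel_measurable (leb b)" "AE t in leb b. norm (z n t) \<le> velocity_bound t" for n
    using tr[of n] trajectory_velocity_bound[OF tr[of n]] by (auto simp: trajectory_def)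
qed

lemma AE_velocities_limit:
  assumes tr: "\<And>n. trajectory (x n) (u n) (z n)" and z': "tail_hull_limit (leb b) z z'"
    and x: "\<And>t. t \<in> {0..b} \<Longrightarrow> (\<lambda>n. x n t) \<longlonglongrightarrow> x' t" and u: "\<And>t. t \<in> {0..b} \<Longrightarrow> (\<lambda>n. u n t) \<longlonglongrightarrow> u' t"
  shows "AE t in leb b. z' t \<in> velocities t (x' t) (u' t)"
proof -
  have "AE t in leb b. \<forall>n. z n t \<in> velocities t (x n t) (u n t) \<and> norm (z n t) \<le> velocity_bound t"
    unfolding AE_all_countable AE_conj_iff
    using tr trajectory_velocity_bound[OF tr] by (auto simp: trajectory_def)
  moreover have
    "AE t in leb b. \<forall>x u x' u'. Haus (F t x u) (F t x' u') \<le> ereal (kF t * (norm (x - x') + norm (u - u')))"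
    "AE t in leb b. \<forall>x u x' u'. Haus (G t x u) (G t x' u') \<le> ereal (kG t * (norm (x - x') + norm (u - u')))"
    using F G by (auto simp: growth_lipschitz_multi_def)
  ultimately show ?thesis
    using tail_hull_limit_AE_convex_tail_limit[OF z'] AE_lebesgue_on_mem
  proof eventually_elim
    case (elim t)
    show ?case
      by (rule velocities_limit_mem[OF elim(5,4) _ _ x[OF elim(5)] u[OF elim(5)] elim(2,3)])
        (use elim(1) in auto)
  qed
qed

lemma limit_mild_solution:
  assumes tr: "\<And>n. trajectory (x n) (u n) (z n)" and z': "tail_hull_limit (leb b) z z'"
    and t: "t \<in> {0..b}" and x: "(\<lambda>n. x n t) \<longlonglongrightarrow> x'"
  shows "x' = T t x0 + convol (\<lambda>s. forcing (z' s)) t"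
proof -
  interpret L2_dominated_sequence "leb b" z velocity_bound
    by (rule trajectory_L2_dominated_sequence[OF tr])
  have "(\<integral>s. kernel t s (forcing (z' s)) \<partial>leb b) = x' - T t x0"
  proof (rule tail_hull_limit_integral[OF z'])
    show "bounded_linear (\<lambda>p. kernel t s (forcing p))" for s
      by (rule bounded_linear_compose[OF bounded_linear_kernel bounded_linear_forcing])
    show "norm (kernel t s (forcing p)) \<le> M * (1 + norm Bop) * norm p" for s p
      using norm_kernel_le[OF t, of s "forcing p"] mult_left_mono[OF norm_forcing_le M_nonneg, of p]
      by (simp add: mult.assoc)
    show "(\<lambda>s. kernel t s (forcing (p s))) \<in> borel_measurable (leb b)" if "p \<in> borel_measurable (leb b)" for p
      using that borel_measurable_continuous_onI[OF linear_continuous_on[OF bounded_linear_forcing]]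
      by (intro borel_measurable_kernel[OF measurable_compose t])
    have "x n t - T t x0 = (\<integral>s. kernel t s (forcing (z n s)) \<partial>leb b)" for n
      using tr[of n] t by (simp add: trajectory_def convol_eq_kernel)
    then show "(\<lambda>n. \<integral>s. kernel t s (forcing (z n s)) \<partial>leb b) \<longlonglongrightarrow> x' - T t x0"
      using tendsto_diff[OF x tendsto_const, of "T t x0"] by simp
  qed (use M_nonneg in simp)
  then show ?thesis
    using convol_eq_kernel[OF t] by (simp add: algebra_simps)
qed

lemma borel_measurable_velocity_part:
  fixes p :: "real \<Rightarrow> 'e \<times> 'y \<times> 'h \<times> 'h"
  assumes "p \<in> borel_measurable N"
  shows "(\<lambda>t. velocity_part (p t)) \<in> borel_measurable N"
  using assms borel_measurable_continuous_onI[OF linear_continuous_on]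
  by (rule measurable_compose) (intro bounded_linear_intros)

lemma limit_primitive:
  assumes tr: "\<And>n. trajectory (x n) (u n) (z n)" and z': "tail_hull_limit (leb b) z z'"
    and t: "t \<in> {0..b}" and u: "(\<lambda>n. u n t) \<longlonglongrightarrow> u'"
  shows "u' = u0 + (\<integral>s. velocity_part (z' s) \<partial>lebesgue_on {0..t})"
proof -
  interpret L2_dominated_sequence "leb b" z velocity_bound
    by (rule trajectory_L2_dominated_sequence[OF tr])
  have restrict: "(\<integral>s. velocity_part (p s) \<partial>lebesgue_on {0..t})
      = (\<integral>s. indicator {0..t} s *\<^sub>R velocity_part (p s) \<partial>leb b)" for p :: "real \<Rightarrow> 'e \<times> 'y \<times> 'h \<times> 'h"
    using t by (intro integral_lebesgue_on_subset) auto
  have "(\<integral>s. indicator {0..t} s *\<^sub>R velocity_part (z' s) \<partial>leb b) = u' - u0"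
  proof (rule tail_hull_limit_integral[OF z', where C = 1])
    show "bounded_linear (\<lambda>p :: 'e \<times> 'y \<times> 'h \<times> 'h. indicator {0..t} s *\<^sub>R velocity_part p)" for s
      by (intro bounded_linear_intros)
    show "norm (indicator {0..t} s *\<^sub>R velocity_part p) \<le> 1 * norm p" for s and p :: "'e \<times> 'y \<times> 'h \<times> 'h"
      using norm_parts_le(3)[of p] by (auto simp: indicator_def)
    show "(\<lambda>s. indicator {0..t} s *\<^sub>R velocity_part (p s)) \<in> borel_measurable (leb b)"
      if "p \<in> borel_measurable (leb b)" for p :: "real \<Rightarrow> 'e \<times> 'y \<times> 'h \<times> 'h"
      using borel_measurable_velocity_part[OF that]
      by (intro borel_measurable_scaleR borel_measurable_indicator)
        (use t in \<open>auto simp: sets_restrict_space_iff\<close>)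
    have "u n t - u0 = (\<integral>s. indicator {0..t} s *\<^sub>R velocity_part (z n s) \<partial>leb b)" for n
      using tr[of n] t by (simp add: trajectory_def has_W12_derivative_def restrict)
    then show "(\<lambda>n. \<integral>s. indicator {0..t} s *\<^sub>R velocity_part (z n s) \<partial>leb b) \<longlonglongrightarrow> u' - u0"
      using tendsto_diff[OF u tendsto_const, of u0] by simp
  qed simp
  then show ?thesis
    by (simp add: restrict algebra_simps)
qed

lemma limit_has_W12_derivative:
  assumes tr: "\<And>n. trajectory (x n) (u n) (z n)" and z': "tail_hull_limit (leb b) z z'"
    and u: "\<And>t. t \<in> {0..b} \<Longrightarrow> (\<lambda>n. u n t) \<longlonglongrightarrow> u' t"
  shows "u' 0 = u0" "has_W12_derivative b u' (\<lambda>t. velocity_part (z' t))"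
proof -
  interpret L2_dominated_sequence "leb b" z velocity_bound
    by (rule trajectory_L2_dominated_sequence[OF tr])
  note primitive = limit_primitive[OF tr z' _ u]
  show u'_0: "u' 0 = u0"
    using primitive[of 0] b by simp
  have "in_L2 b (\<lambda>t. velocity_part (z' t))"
  proof (rule in_L2_dominated[OF _ velocity_bound_L2])
    show "(\<lambda>t. velocity_part (z' t)) \<in> borel_measurable (leb b)"
      using z' by (intro borel_measurable_velocity_part) (simp add: tail_hull_limit_def)
    show "AE t in leb b. norm (velocity_part (z' t)) \<le> velocity_bound t"
      using tail_hull_limit_AE_norm_le[OF z'] by eventually_elim (meson norm_parts_le(3) order_trans)
  qed
  then show "has_W12_derivative b u' (\<lambda>t. velocity_part (z' t))"
    using primitive u'_0 by (simp add: has_W12_derivative_def)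
qed

lemma trajectory_tail_hull_limit:
  assumes tr: "\<And>n. trajectory (x n) (u n) (z n)" and z': "tail_hull_limit (leb b) z z'"
    and x: "\<And>t. t \<in> {0..b} \<Longrightarrow> (\<lambda>n. x n t) \<longlonglongrightarrow> x' t" and u: "\<And>t. t \<in> {0..b} \<Longrightarrow> (\<lambda>n. u n t) \<longlonglongrightarrow> u' t"
  shows "trajectory x' u' z'"
proof -
  interpret L2_dominated_sequence "leb b" z velocity_bound
    by (rule trajectory_L2_dominated_sequence[OF tr])
  have "in_L2 b z'"
    using z' by (intro in_L2_dominated[OF _ velocity_bound_L2 tail_hull_limit_AE_norm_le[OF z']])
      (simp add: tail_hull_limit_def)
  then have "integrable (leb b) z'"
    by (rule in_L2_integrable)
  then show ?thesis
    unfolding trajectory_def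
    using limit_has_W12_derivative[OF tr z' u] AE_velocities_limit[OF tr z' x u]
      limit_mild_solution[OF tr z' _ x] by blast
qed

lemma control_cost_tail_hull_limit_le:
  assumes tr: "\<And>n. trajectory (x n) (u n) (z n)" and z': "tail_hull_limit (leb b) z z'"
    and lim: "(\<lambda>n. control_cost b (\<lambda>t. control_part (z n t))) \<longlonglongrightarrow> \<rho>"
  shows "control_cost b (\<lambda>t. control_part (z' t)) \<le> \<rho>"
proof -
  interpret L2_dominated_sequence "leb b" z velocity_bound
    by (rule trajectory_L2_dominated_sequence[OF tr])
  have "(\<integral>t. (norm (control_part (z' t)))\<^sup>2 \<partial>leb b) \<le> 2 * \<rho>"
  proof (rule tail_hull_limit_convex_integral_le[OF z'])
    have "linear (\<lambda>p :: 'e \<times> 'y \<times> 'h \<times> 'h. control_part p)"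
      by (intro bounded_linear.linear bounded_linear_intros)
    then show "convex_on UNIV (\<lambda>p :: 'e \<times> 'y \<times> 'h \<times> 'h. (norm (control_part p))\<^sup>2)"
      using convex_on_norm_square[where 'a = 'y] by (simp add: convex_on_def linear_add linear_scale)
    show "continuous_on UNIV (\<lambda>p :: 'e \<times> 'y \<times> 'h \<times> 'h. (norm (control_part p))\<^sup>2)"
      by (intro continuous_intros)
    show "\<bar>(norm (control_part p))\<^sup>2\<bar> \<le> (norm p)\<^sup>2" for p :: "'e \<times> 'y \<times> 'h \<times> 'h"
      by (simp add: norm_parts_le power_mono)
    have "(\<lambda>n. 2 * control_cost b (\<lambda>t. control_part (z n t))) \<longlonglongrightarrow> 2 * \<rho>"
      by (intro tendsto_intros lim)
    then show "(\<lambda>n. \<integral>t. (norm (control_part (z n t)))\<^sup>2 \<partial>leb b) \<longlonglongrightarrow> 2 * \<rho>"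
      by (simp add: control_cost_def)
  qed
  then show ?thesis
    by (simp add: control_cost_def)
qed

lemma trajectory_control_in_L2:
  assumes tr: "trajectory x u z"
  shows "in_L2 b (\<lambda>t. control_part (z t))"
proof (rule in_L2_dominated[OF _ velocity_bound_L2])
  have "integrable (leb b) (\<lambda>t. control_part (z t))"
    using tr by (intro integrable_bounded_linear[of "\<lambda>p. control_part p"] bounded_linear_intros)
      (simp add: trajectory_def)
  then show "(\<lambda>t. control_part (z t)) \<in> borel_measurable (leb b)"
    by simp
  show "AE t in leb b. norm (control_part (z t)) \<le> velocity_bound t"
    using trajectory_velocity_bound[OF tr] by eventually_elim (meson norm_parts_le(1) order_trans)
qed

lemma trajectory_control_cost_le:
  assumes tr: "trajectory x u z"
  shows "control_cost b (\<lambda>t. control_part (z t)) \<le> control_cost b velocity_bound"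
proof -
  have "(\<integral>t. (norm (control_part (z t)))\<^sup>2 \<partial>leb b) \<le> (\<integral>t. (norm (velocity_bound t))\<^sup>2 \<partial>leb b)"
  proof (rule integral_mono_AE)
    show "AE t in leb b. (norm (control_part (z t)))\<^sup>2 \<le> (norm (velocity_bound t))\<^sup>2"
      using trajectory_velocity_bound[OF tr]
    proof eventually_elim
      case (elim t)
      then have "norm (control_part (z t)) \<le> norm (velocity_bound t)"
        using norm_parts_le(1)[of "z t"] by simp
      then show ?case
        by (rule power_mono) simp
    qed
  qed (use trajectory_control_in_L2[OF tr] velocity_bound_L2 in \<open>auto simp: in_L2_def\<close>)
  then show ?thesis
    by (simp add: control_cost_def)
qed

lemma trajectory_compactness:
  assumes tr: "\<And>n. trajectory (x n) (u n) (z n)"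
  obtains r :: "nat \<Rightarrow> nat" and x' u' z' \<rho> where "strict_mono r" "trajectory x' u' z'"
    "\<And>t. t \<in> {0..b} \<Longrightarrow> (\<lambda>n. x (r n) t) \<longlonglongrightarrow> x' t" "\<And>t. t \<in> {0..b} \<Longrightarrow> (\<lambda>n. u (r n) t) \<longlonglongrightarrow> u' t"
    "(\<lambda>n. control_cost b (\<lambda>t. control_part (z (r n) t))) \<longlonglongrightarrow> \<rho>"
    "control_cost b (\<lambda>t. control_part (z' t)) \<le> \<rho>"
proof -
  define C where "C n = control_cost b (\<lambda>t. control_part (z n t))" for n
  have "C n \<in> {0..control_cost b velocity_bound}" for n
    using trajectory_control_cost_le[OF tr] by (simp add: C_def control_cost_def)
  then obtain \<rho> rC where rC: "strict_mono (rC :: nat \<Rightarrow> nat)" "(C \<circ> rC) \<longlonglongrightarrow> \<rho>"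
    using compact_Icc[of 0 "control_cost b velocity_bound"] unfolding compact_def by blast
  obtain rS x' u' where rS: "strict_mono (rS :: nat \<Rightarrow> nat)"
    and x: "\<And>t. t \<in> {0..b} \<Longrightarrow> (\<lambda>n. x (rC (rS n)) t) \<longlonglongrightarrow> x' t"
    and u: "\<And>t. t \<in> {0..b} \<Longrightarrow> (\<lambda>n. u (rC (rS n)) t) \<longlonglongrightarrow> u' t"
    using trajectory_pointwise_convergent_subsequence[of "\<lambda>n. x (rC n)" "\<lambda>n. u (rC n)" "\<lambda>n. z (rC n)", OF tr]
    by blast
  have tr': "trajectory (x (rC (rS n))) (u (rC (rS n))) (z (rC (rS n)))" for n
    by (rule tr)
  have "L2_dominated_sequence (leb b) (\<lambda>n. z (rC (rS n))) velocity_bound"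
    by (rule trajectory_L2_dominated_sequence) (rule tr')
  then obtain z' where z': "tail_hull_limit (leb b) (\<lambda>n. z (rC (rS n))) z'"
    using L2_dominated_sequence.tail_hull_limit_exists by blast
  have C: "(\<lambda>n. C (rC (rS n))) \<longlonglongrightarrow> \<rho>"
    using LIMSEQ_subseq_LIMSEQ[OF rC(2) rS] by (simp add: o_def)
  show ?thesis
  proof (rule that[of "rC \<circ> rS" x' u' z' \<rho>])
    show "strict_mono (rC \<circ> rS)"
      using rC(1) rS by (rule strict_mono_o)
    show "trajectory x' u' z'"
      by (rule trajectory_tail_hull_limit[OF tr' z' x u])
    show "control_cost b (\<lambda>t. control_part (z' t)) \<le> \<rho>"
      by (rule control_cost_tail_hull_limit_le[OF tr' z']) (use C in \<open>simp add: C_def\<close>)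
  qed (use x u C in \<open>simp_all add: C_def\<close>)
qed

end


subsection \<open>Convergence of the cost\<close>

lemma borel_measurable_lebesgue_on_AE_eq:
  fixes f g :: "'a::euclidean_space \<Rightarrow> 'b::euclidean_space"
  assumes S: "S \<in> sets lebesgue" and f: "f \<in> borel_measurable (lebesgue_on S)"
    and AE_eq: "AE x in lebesgue_on S. f x = g x"
  shows "g \<in> borel_measurable (lebesgue_on S)"
proof -
  have "AE x in lebesgue. indicator S x *\<^sub>R f x = indicator S x *\<^sub>R g x"
    using AE_eq S by (auto simp: AE_lebesgue_on_iff indicator_def elim!: eventually_mono)
  moreover have "(\<lambda>x. indicator S x *\<^sub>R f x) \<in> borel_measurable lebesgue"
    using f S by (simp add: borel_measurable_restrict_space_iff)
  ultimately have "(\<lambda>x. indicator S x *\<^sub>R g x) \<in> borel_measurable lebesgue"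
    by (rule borel_measurable_AE[rotated])
  then show ?thesis
    using S by (simp add: borel_measurable_restrict_space_iff)
qed

lemma borel_measurable_Caratheodory_compose:
  fixes l :: "'a::euclidean_space \<Rightarrow> 'p::{metric_space, second_countable_topology} \<Rightarrow> real"
  assumes S: "S \<in> sets lebesgue" and l: "\<And>p. (\<lambda>t. l t p) \<in> borel_measurable (lebesgue_on S)"
    and cont: "AE t in lebesgue_on S. continuous_on UNIV (l t)"
    and x: "x \<in> borel_measurable (lebesgue_on S)"
  shows "(\<lambda>t. l t (x t)) \<in> borel_measurable (lebesgue_on S)"
proof -
  obtain s where s: "\<And>i. simple_function (lebesgue_on S) (s i)" "\<And>t. t \<in> S \<Longrightarrow> (\<lambda>i. s i t) \<longlonglongrightarrow> x t"
    using borel_measurable_implies_sequence_metric[OF x] by force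
  have "(\<lambda>t. l t (s i t)) \<in> borel_measurable (lebesgue_on S)" for i
  proof (rule measurable_compose_countable'[of "s i ` S" "\<lambda>p t. l t p"])
    show "s i \<in> measurable (lebesgue_on S) (count_space (s i ` S))"
      using s(1)[of i] by (simp add: simple_function_def measurable_count_space_eq2)
    show "countable (s i ` S)"
      using simple_functionD(1)[OF s(1)[of i]] by (simp add: countable_finite)
  qed (rule l)
  then have "(\<lambda>t. lim (\<lambda>i. l t (s i t))) \<in> borel_measurable (lebesgue_on S)"
    by (rule borel_measurable_lim_metric)
  moreover from cont AE_lebesgue_on_mem have "AE t in lebesgue_on S. lim (\<lambda>i. l t (s i t)) = l t (x t)"
  proof eventually_elim
    case (elim t)
    have "(\<lambda>i. l t (s i t)) \<longlonglongrightarrow> l t (x t)"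
      by (rule continuous_on_tendsto_compose[OF elim(1) s(2)[OF elim(2)]]) auto
    then show ?case
      by (rule limI)
  qed
  ultimately show ?thesis
    by (rule borel_measurable_lebesgue_on_AE_eq[OF S])
qed

lemma Hl_diff_zero_dominated:
  fixes l :: "real \<Rightarrow> 'e::{real_inner, banach, second_countable_topology} \<Rightarrow>
       'h::{real_inner, banach, second_countable_topology} \<Rightarrow> 'l::metric_space \<Rightarrow> 'k::metric_space \<Rightarrow> real"
  assumes "Hl b l" and R: "0 \<le> R"
  obtains \<beta> where "integrable (leb b) \<beta>"
    "AE t in leb b. \<forall>x u. norm x \<le> R \<longrightarrow> \<bar>l t x u \<zeta> \<eta> - l t 0 u \<zeta> \<eta>\<bar> \<le> \<beta> t"
proof -
  have "\<exists>\<kappa>. (\<forall>R>0. \<exists>\<beta>. L1_nonneg b \<beta> \<and> (AE t in leb b. \<forall>r\<in>{0..R}. \<kappa> t r \<le> \<beta> t)) \<and>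
      (AE t in leb b. \<forall>x y u \<zeta> \<eta>.
        \<bar>l t x u \<zeta> \<eta> - l t y u \<zeta> \<eta>\<bar> \<le> (1 + max (norm x) (norm y)) * \<kappa> t (norm (x - y)))"
    using assms(1) unfolding Hl_def by (elim conjE exE) (rule exI, rule conjI, assumption+)
  then obtain \<kappa> where \<kappa>_bounded: "\<forall>R>0. \<exists>\<beta>. L1_nonneg b \<beta> \<and> (AE t in leb b. \<forall>r\<in>{0..R}. \<kappa> t r \<le> \<beta> t)"
    and modulus: "AE t in leb b. \<forall>x y u \<zeta> \<eta>.
      \<bar>l t x u \<zeta> \<eta> - l t y u \<zeta> \<eta>\<bar> \<le> (1 + max (norm x) (norm y)) * \<kappa> t (norm (x - y))"
    by (elim exE conjE) (rule that)
  have "R + 1 > 0"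
    using R by simp
  with \<kappa>_bounded obtain \<beta> where \<beta>: "L1_nonneg b \<beta>" "AE t in leb b. \<forall>r\<in>{0..R + 1}. \<kappa> t r \<le> \<beta> t"
    by blast
  show ?thesis
  proof (rule that)
    show "integrable (leb b) (\<lambda>t. (1 + R) * \<beta> t)"
      using \<beta>(1) by (simp add: L1_nonneg_def)
    from modulus \<beta>(2) AE_lebesgue_on_mem
    show "AE t in leb b. \<forall>x u. norm x \<le> R \<longrightarrow> \<bar>l t x u \<zeta> \<eta> - l t 0 u \<zeta> \<eta>\<bar> \<le> (1 + R) * \<beta> t"
    proof eventually_elim
      case (elim t)
      show ?case
      proof (intro allI impI)
        fix x :: 'e and u :: 'h assume x: "norm x \<le> R"
        have "\<bar>l t x u \<zeta> \<eta> - l t 0 u \<zeta> \<eta>\<bar> \<le> (1 + max (norm x) (norm (0::'e))) * \<kappa> t (norm (x - 0))"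
          using elim(1) by blast
        also have "\<dots> \<le> (1 + norm x) * \<beta> t"
          using elim(2) x by (auto intro!: mult_left_mono)
        also have "\<dots> \<le> (1 + R) * \<beta> t"
          using x \<beta>(1) elim(3) by (intro mult_right_mono) (auto simp: L1_nonneg_def)
        finally show "\<bar>l t x u \<zeta> \<eta> - l t 0 u \<zeta> \<eta>\<bar> \<le> (1 + R) * \<beta> t" .
      qed
    qed
  qed
qed

lemma Hl_dominated:
  fixes l :: "real \<Rightarrow> 'e::{real_inner, banach, second_countable_topology} \<Rightarrow>
       'h::{real_inner, banach, second_countable_topology} \<Rightarrow> 'l::metric_space \<Rightarrow> 'k::metric_space \<Rightarrow> real"
  assumes l: "Hl b l" and R: "0 \<le> R"
  obtains \<beta> where "integrable (leb b) \<beta>"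
    "AE t in leb b. \<forall>x u. norm x \<le> R \<longrightarrow> norm u \<le> R \<longrightarrow> \<bar>l t x u \<zeta> \<eta>\<bar> \<le> \<beta> t"
proof -
  obtain \<beta> where \<beta>: "integrable (leb b) \<beta>"
    "AE t in leb b. \<forall>x u. norm x \<le> R \<longrightarrow> \<bar>l t x u \<zeta> \<eta> - l t 0 u \<zeta> \<eta>\<bar> \<le> \<beta> t"
    by (rule Hl_diff_zero_dominated[OF l R])
  have "\<forall>D. bounded D \<longrightarrow> (\<exists>\<theta>. L1_nonneg b \<theta> \<and>
      (AE t in leb b. \<forall>u. \<forall>(\<zeta>, \<eta>)\<in>D. \<bar>l t 0 u \<zeta> \<eta>\<bar> \<le> \<theta> t * (1 + norm u)))"
    using l unfolding Hl_def by (elim conjE)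
  from this[rule_format, of "{(\<zeta>, \<eta>)}"]
  obtain \<theta> where \<theta>: "L1_nonneg b \<theta>" "AE t in leb b. \<forall>u. \<bar>l t 0 u \<zeta> \<eta>\<bar> \<le> \<theta> t * (1 + norm u)"
    by auto
  show ?thesis
  proof (rule that)
    show "integrable (leb b) (\<lambda>t. \<beta> t + \<theta> t * (1 + R))"
      using \<beta>(1) \<theta>(1) by (auto simp: L1_nonneg_def)
    from \<beta>(2) \<theta>(2) AE_lebesgue_on_mem
    show "AE t in leb b. \<forall>x u. norm x \<le> R \<longrightarrow> norm u \<le> R \<longrightarrow> \<bar>l t x u \<zeta> \<eta>\<bar> \<le> \<beta> t + \<theta> t * (1 + R)"
    proof eventually_elim
      case (elim t)
      show ?case
      proof (intro allI impI)
        fix x :: 'e and u :: 'h assume x: "norm x \<le> R" and u: "norm u \<le> R"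
        have "\<bar>l t 0 u \<zeta> \<eta>\<bar> \<le> \<theta> t * (1 + norm u)"
          using elim(2) by blast
        also have "\<dots> \<le> \<theta> t * (1 + R)"
          using u \<theta>(1) elim(3) by (intro mult_left_mono) (auto simp: L1_nonneg_def)
        finally show "\<bar>l t x u \<zeta> \<eta>\<bar> \<le> \<beta> t + \<theta> t * (1 + R)"
          using elim(1)[rule_format, OF x, of u] by linarith
      qed
    qed
  qed
qed

lemma Hl_AE_continuous:
  fixes l :: "real \<Rightarrow> 'e::{real_inner, banach, second_countable_topology} \<Rightarrow>
       'h::{real_inner, banach, second_countable_topology} \<Rightarrow> 'l::metric_space \<Rightarrow> 'k::metric_space \<Rightarrow> real"
  assumes "Hl b l"
  shows "AE t in leb b. continuous_on UNIV (\<lambda>p. l t (fst p) (snd p) \<zeta> \<eta>)"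
proof -
  have "AE t in leb b. continuous_on UNIV (\<lambda>(x, u, \<zeta>, \<eta>). l t x u \<zeta> \<eta>)"
    using assms by (simp add: Hl_def)
  then show ?thesis
  proof eventually_elim
    case (elim t)
    have "continuous_on UNIV (\<lambda>p. (fst p, snd p, \<zeta>, \<eta>))"
      by (intro continuous_intros)
    from continuous_on_compose2[OF elim this] show ?case
      by simp
  qed
qed

lemma Hl_borel_measurable_compose:
  fixes l :: "real \<Rightarrow> 'e::{real_inner, banach, second_countable_topology} \<Rightarrow>
       'h::{real_inner, banach, second_countable_topology} \<Rightarrow> 'l::metric_space \<Rightarrow> 'k::metric_space \<Rightarrow> real"
  assumes l: "Hl b l" and "continuous_on {0..b} x" "continuous_on {0..b} u"
  shows "(\<lambda>t. l t (x t) (u t) \<zeta> \<eta>) \<in> borel_measurable (leb b)"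
proof -
  have "(\<lambda>t. (x t, u t)) \<in> borel_measurable (leb b)"
    using assms by (intro borel_measurable_Pair continuous_imp_measurable_on_sets_lebesgue) auto
  moreover have "(\<lambda>t. l t (fst p) (snd p) \<zeta> \<eta>) \<in> borel_measurable (leb b)" for p
    using l by (simp add: Hl_def)
  ultimately show ?thesis
    using borel_measurable_Caratheodory_compose[of "{0..b}" "\<lambda>t p. l t (fst p) (snd p) \<zeta> \<eta>" "\<lambda>t. (x t, u t)"]
      Hl_AE_continuous[OF l] by simp
qed

lemma cost_tendsto:
  fixes l :: "real \<Rightarrow> 'e::{real_inner, banach, second_countable_topology} \<Rightarrow>
       'h::{real_inner, banach, second_countable_topology} \<Rightarrow> 'l::metric_space \<Rightarrow> 'k::metric_space \<Rightarrow> real"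
  assumes b: "b > 0" and l: "Hl b l" and \<phi>: "continuous_on UNIV (\<lambda>(x, u, \<zeta>', \<eta>'). \<phi> x u \<zeta>' \<eta>')"
    and cont: "\<And>n. continuous_on {0..b} (x n)" "\<And>n. continuous_on {0..b} (u n)"
      "continuous_on {0..b} x'" "continuous_on {0..b} u'"
    and bounded: "\<And>n t. t \<in> {0..b} \<Longrightarrow> norm (x n t) \<le> R" "\<And>n t. t \<in> {0..b} \<Longrightarrow> norm (u n t) \<le> R"
    and x: "\<And>t. t \<in> {0..b} \<Longrightarrow> (\<lambda>n. x n t) \<longlonglongrightarrow> x' t" and u: "\<And>t. t \<in> {0..b} \<Longrightarrow> (\<lambda>n. u n t) \<longlonglongrightarrow> u' t"
  shows "(\<lambda>n. cost b l \<phi> \<zeta> \<eta> (x n) (u n)) \<longlonglongrightarrow> cost b l \<phi> \<zeta> \<eta> x' u'"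
proof -
  have "0 \<le> R"
    using order_trans[OF norm_ge_zero bounded(1)[of 0]] b by simp
  obtain \<beta> where \<beta>: "integrable (leb b) \<beta>"
    "AE t in leb b. \<forall>x u. norm x \<le> R \<longrightarrow> norm u \<le> R \<longrightarrow> \<bar>l t x u \<zeta> \<eta>\<bar> \<le> \<beta> t"
    by (rule Hl_dominated[OF l \<open>0 \<le> R\<close>])
  have "(\<lambda>n. \<integral>t. l t (x n t) (u n t) \<zeta> \<eta> \<partial>leb b) \<longlonglongrightarrow> (\<integral>t. l t (x' t) (u' t) \<zeta> \<eta> \<partial>leb b)"
  proof (rule integral_dominated_convergence[OF Hl_borel_measurable_compose[OF l]
        Hl_borel_measurable_compose[OF l] \<beta>(1)])
    from Hl_AE_continuous[OF l, where \<zeta> = \<zeta> and \<eta> = \<eta>] AE_lebesgue_on_mem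
    show "AE t in leb b. (\<lambda>n. l t (x n t) (u n t) \<zeta> \<eta>) \<longlonglongrightarrow> l t (x' t) (u' t) \<zeta> \<eta>"
    proof eventually_elim
      case (elim t)
      have "(\<lambda>n. (x n t, u n t)) \<longlonglongrightarrow> (x' t, u' t)"
        by (intro tendsto_Pair x u elim)
      from continuous_on_tendsto_compose[OF elim(1) this] show ?case
        by simp
    qed
    show "AE t in leb b. norm (l t (x n t) (u n t) \<zeta> \<eta>) \<le> \<beta> t" for n
      using \<beta>(2) AE_lebesgue_on_mem by eventually_elim (use bounded in auto)
  qed (rule cont)+
  moreover have "(\<lambda>n. \<phi> (x n b) (u n b) \<zeta> \<eta>) \<longlonglongrightarrow> \<phi> (x' b) (u' b) \<zeta> \<eta>"
  proof -
    have "(\<lambda>n. (x n b, u n b, \<zeta>, \<eta>)) \<longlonglongrightarrow> (x' b, u' b, \<zeta>, \<eta>)"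
      by (intro tendsto_Pair tendsto_const x u) (use b in auto)
    from continuous_on_tendsto_compose[OF \<phi> this] show ?thesis
      by simp
  qed
  ultimately show ?thesis
    unfolding cost_def by (rule tendsto_add)
qed


subsection \<open>Existence of an optimal control\<close>

lemma minimizer_exists:
  fixes V :: "'s \<Rightarrow> real"
  assumes "Z \<noteq> {}"
    and compact: "\<And>s. (\<And>n. s n \<in> Z) \<Longrightarrow>
      \<exists>s'\<in>Z. \<exists>r v. strict_mono (r :: nat \<Rightarrow> nat) \<and> (\<lambda>n. V (s (r n))) \<longlonglongrightarrow> v \<and> V s' \<le> v"
  obtains s' where "s' \<in> Z" "\<And>s. s \<in> Z \<Longrightarrow> V s' \<le> V s"
proof -
  define I where "I = Inf ((\<lambda>s. ereal (V s)) ` Z)"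
  obtain a where "\<And>n. a n \<in> (\<lambda>s. ereal (V s)) ` Z" and a: "a \<longlonglongrightarrow> I"
    using Inf_as_limit[of "(\<lambda>s. ereal (V s)) ` Z"] \<open>Z \<noteq> {}\<close> unfolding I_def by auto
  then have "\<forall>n. \<exists>s\<in>Z. a n = ereal (V s)"
    by blast
  then obtain s where s: "\<And>n. s n \<in> Z" "\<And>n. a n = ereal (V (s n))"
    by metis
  obtain s' r v where s': "s' \<in> Z" "V s' \<le> v" and r: "strict_mono (r :: nat \<Rightarrow> nat)" "(\<lambda>n. V (s (r n))) \<longlonglongrightarrow> v"
    using compact[of s, OF s(1)] by blast
  have "(\<lambda>n. ereal (V (s (r n)))) \<longlonglongrightarrow> I"
    using LIMSEQ_subseq_LIMSEQ[OF a r(1)] by (simp add: o_def s(2))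
  moreover have "(\<lambda>n. ereal (V (s (r n)))) \<longlonglongrightarrow> ereal v"
    using r(2) by simp
  ultimately have I: "I = ereal v"
    by (rule LIMSEQ_unique)
  have "V s' \<le> V s" if "s \<in> Z" for s
  proof -
    have "I \<le> ereal (V s)"
      unfolding I_def using that by (intro Inf_lower imageI)
    then show ?thesis
      using I s'(2) by simp
  qed
  with s'(1) that show ?thesis
    by blast
qed

lemma INF_add_attained:
  fixes J :: "'s \<Rightarrow> real" and C :: "'w \<Rightarrow> real"
  assumes w: "w \<in> U" and s: "s \<in> S w"
    and minimal: "\<And>w' s'. w' \<in> U \<Longrightarrow> s' \<in> S w' \<Longrightarrow> J s + C w \<le> J s' + C w'"
  shows "(INF s\<in>S w. ereal (J s)) + ereal (C w) = (INF w\<in>U. (INF s\<in>S w. ereal (J s)) + ereal (C w))"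
proof (rule antisym)
  have "ereal (J s + C w) \<le> (INF s\<in>S w'. ereal (J s)) + ereal (C w')" if w': "w' \<in> U" for w'
  proof -
    have "ereal (J s + C w - C w') \<le> (INF s\<in>S w'. ereal (J s))"
    proof (rule INF_greatest)
      show "ereal (J s + C w - C w') \<le> ereal (J s')" if "s' \<in> S w'" for s'
        using minimal[OF w' that] by simp
    qed
    then have "ereal (J s + C w - C w') + ereal (C w') \<le> (INF s\<in>S w'. ereal (J s)) + ereal (C w')"
      by (rule add_right_mono)
    then show ?thesis
      by simp
  qed
  moreover have "(INF s\<in>S w. ereal (J s)) + ereal (C w) \<le> ereal (J s) + ereal (C w)"
    using s by (intro add_right_mono INF_lower)
  ultimately show "(INF s\<in>S w. ereal (J s)) + ereal (C w) \<le> (INF w\<in>U. (INF s\<in>S w. ereal (J s)) + ereal (C w))"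
    by (intro INF_greatest) (simp add: order_trans)
qed (use w in \<open>rule INF_lower\<close>)

context control_system
begin

lemma optimal_trajectory_exists:
  fixes l :: "real \<Rightarrow> 'e \<Rightarrow> 'h \<Rightarrow> 'l::metric_space \<Rightarrow> 'k::metric_space \<Rightarrow> real"
  assumes l: "Hl b l" and \<phi>: "continuous_on UNIV (\<lambda>(x, u, \<zeta>', \<eta>'). \<phi> x u \<zeta>' \<eta>')"
    and nonempty: "\<exists>x u z. trajectory x u z"
  obtains x u z where "trajectory x u z"
    "\<And>x' u' z'. trajectory x' u' z' \<Longrightarrow>
      cost b l \<phi> \<zeta> \<eta> x u + control_cost b (\<lambda>t. control_part (z t))
        \<le> cost b l \<phi> \<zeta> \<eta> x' u' + control_cost b (\<lambda>t. control_part (z' t))"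
proof -
  define V :: "(real \<Rightarrow> 'e) \<times> (real \<Rightarrow> 'h) \<times> (real \<Rightarrow> 'e \<times> 'y \<times> 'h \<times> 'h) \<Rightarrow> real" where
    "V = (\<lambda>(x, u, z). cost b l \<phi> \<zeta> \<eta> x u + control_cost b (\<lambda>t. control_part (z t)))"
  obtain s where s: "s \<in> {(x, u, z). trajectory x u z}"
    and minimal: "\<And>s'. s' \<in> {(x, u, z). trajectory x u z} \<Longrightarrow> V s \<le> V s'"
  proof (rule minimizer_exists)
    show "{(x, u, z). trajectory x u z} \<noteq> {}"
      using nonempty by auto
    fix s :: "nat \<Rightarrow> (real \<Rightarrow> 'e) \<times> (real \<Rightarrow> 'h) \<times> (real \<Rightarrow> 'e \<times> 'y \<times> 'h \<times> 'h)"
    assume s: "\<And>n. s n \<in> {(x, u, z). trajectory x u z}"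
    define x where "x n = fst (s n)" for n
    define u where "u n = fst (snd (s n))" for n
    define z where "z n = snd (snd (s n))" for n
    have tr: "trajectory (x n) (u n) (z n)" for n
      using s[of n] by (auto simp: x_def u_def z_def)
    obtain r x' u' z' \<rho> where r: "strict_mono (r :: nat \<Rightarrow> nat)" and tr': "trajectory x' u' z'"
      and lim: "\<And>t. t \<in> {0..b} \<Longrightarrow> (\<lambda>n. x (r n) t) \<longlonglongrightarrow> x' t" "\<And>t. t \<in> {0..b} \<Longrightarrow> (\<lambda>n. u (r n) t) \<longlonglongrightarrow> u' t"
      and \<rho>: "(\<lambda>n. control_cost b (\<lambda>t. control_part (z (r n) t))) \<longlonglongrightarrow> \<rho>"
        "control_cost b (\<lambda>t. control_part (z' t)) \<le> \<rho>"
      by (rule trajectory_compactness[of x u z, OF tr]) (rule that)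
    have "(\<lambda>n. cost b l \<phi> \<zeta> \<eta> (x (r n)) (u (r n))) \<longlonglongrightarrow> cost b l \<phi> \<zeta> \<eta> x' u'"
      by (rule cost_tendsto[OF b l \<phi> _ _ _ _ _ _ lim])
        (use trajectory_continuous tr tr' trajectory_state_norm_le in blast)+
    from tendsto_add[OF this \<rho>(1)] have "(\<lambda>n. V (s (r n))) \<longlonglongrightarrow> cost b l \<phi> \<zeta> \<eta> x' u' + \<rho>"
      by (simp add: V_def x_def u_def z_def case_prod_beta)
    moreover have "V (x', u', z') \<le> cost b l \<phi> \<zeta> \<eta> x' u' + \<rho>"
      using \<rho>(2) by (simp add: V_def)
    ultimately show "\<exists>s'\<in>{(x, u, z). trajectory x u z}. \<exists>r v. strict_mono (r :: nat \<Rightarrow> nat) \<and>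
        (\<lambda>n. V (s (r n))) \<longlonglongrightarrow> v \<and> V s' \<le> v"
      using r tr' by (intro bexI[of _ "(x', u', z')"]) auto
  qed (rule that)
  show ?thesis
  proof (rule that)
    show "trajectory (fst s) (fst (snd s)) (snd (snd s))"
      using s by auto
    show "cost b l \<phi> \<zeta> \<eta> (fst s) (fst (snd s)) + control_cost b (\<lambda>t. control_part (snd (snd s) t))
        \<le> cost b l \<phi> \<zeta> \<eta> x' u' + control_cost b (\<lambda>t. control_part (z' t))" if "trajectory x' u' z'" for x' u' z'
      using minimal[of "(x', u', z')"] that by (simp add: V_def case_prod_beta)
  qed
qed

lemma trajectory_admissible_mild_solution:
  assumes sys: "T = T' \<zeta>" "A = (\<lambda>t u. B t u \<eta>)" "F = (\<lambda>t x u. F' t x u \<zeta>)" "G = (\<lambda>t x u. G' t x u \<eta>)"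
    "x0 = x0' \<zeta>" "u0 = u0' \<eta>"
    and tr: "trajectory x u z"
  shows "(\<lambda>t. control_part (z t)) \<in> admissible_controls b W"
    "(x, u) \<in> mild_solutions b T' B F' G' Bop x0' u0' \<zeta> \<eta> (\<lambda>t. control_part (z t))"
proof -
  have z: "integrable (leb b) z" "AE t in leb b. z t \<in> velocities t (x t) (u t)"
    using tr by (auto simp: trajectory_def)
  have "AE t in leb b. control_part (z t) \<in> W t"
    using z(2) by eventually_elim (simp add: velocities_def)
  then show "(\<lambda>t. control_part (z t)) \<in> admissible_controls b W"
    using trajectory_control_in_L2[OF tr] by (simp add: admissible_controls_def)
  have "AE t in leb b. fst (z t) \<in> F t (x t) (u t) \<and> reaction_part (z t) \<in> G t (x t) (u t) \<and>
      - velocity_part (z t) + reaction_part (z t) \<in> A t (u t) (u t)"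
    using z(2) by eventually_elim (simp add: velocities_def)
  moreover have "integrable (leb b) (\<lambda>t. fst (z t))" "integrable (leb b) (\<lambda>t. reaction_part (z t))"
    using z(1) by (intro integrable_bounded_linear[of fst] integrable_bounded_linear[of "\<lambda>p. reaction_part p"]
        bounded_linear_intros; simp)+
  moreover have "u 0 = u0" "has_W12_derivative b u (\<lambda>t. velocity_part (z t))"
    "\<forall>t\<in>{0..b}. x t = T t x0 + (\<integral>s. T (t - s) (fst (z s) + Bop (control_part (z s))) \<partial>lebesgue_on {0..t})"
    using tr by (simp_all add: trajectory_def convol_def forcing_def)
  ultimately show "(x, u) \<in> mild_solutions b T' B F' G' Bop x0' u0' \<zeta> \<eta> (\<lambda>t. control_part (z t))"
    using trajectory_continuous(1)[OF tr] unfolding mild_solutions_def sys by blast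
qed

lemma mild_solution_trajectory:
  assumes sys: "T = T' \<zeta>" "A = (\<lambda>t u. B t u \<eta>)" "F = (\<lambda>t x u. F' t x u \<zeta>)" "G = (\<lambda>t x u. G' t x u \<eta>)"
    "x0 = x0' \<zeta>" "u0 = u0' \<eta>"
    and w: "w \<in> admissible_controls b W" and xu: "(x, u) \<in> mild_solutions b T' B F' G' Bop x0' u0' \<zeta> \<eta> w"
  obtains z where "trajectory x u z" "w = (\<lambda>t. control_part (z t))"
proof -
  obtain u' f g where u: "u 0 = u0" "has_W12_derivative b u u'"
    and f: "integrable (leb b) f" and g: "integrable (leb b) g"
    and incl: "AE t in leb b. f t \<in> F t (x t) (u t) \<and> g t \<in> G t (x t) (u t) \<and> - u' t + g t \<in> A t (u t) (u t)"
    and x: "\<forall>t\<in>{0..b}. x t = T t x0 + (\<integral>s. T (t - s) (f s + Bop (w s)) \<partial>lebesgue_on {0..t})"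
    using xu unfolding mild_solutions_def sys by blast
  define z where "z t = (f t, w t, g t, u' t)" for t
  have w_integrable: "integrable (leb b) w" and wW: "AE t in leb b. w t \<in> W t"
    using w by (auto simp: admissible_controls_def intro: in_L2_integrable)
  have u'_integrable: "integrable (leb b) u'"
    by (rule has_W12_derivative_integrable[OF u(2)])
  have "integrable (leb b) z"
  proof (rule Bochner_Integration.integrable_bound)
    show "integrable (leb b) (\<lambda>t. norm (f t) + norm (w t) + norm (g t) + norm (u' t))"
      using f g w_integrable u'_integrable by simp
    show "z \<in> borel_measurable (leb b)"
      unfolding z_def using f g w_integrable u'_integrable by (intro borel_measurable_Pair) auto
    show "AE t in leb b. norm (z t) \<le> norm (norm (f t) + norm (w t) + norm (g t) + norm (u' t))"
      using norm_le_sum_parts[of "z _"] by (intro AE_I2) (simp add: z_def)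
  qed
  moreover have "AE t in leb b. z t \<in> velocities t (x t) (u t)"
    using incl wW by eventually_elim (simp add: z_def velocities_def)
  ultimately have "trajectory x u z"
    using u x by (simp add: trajectory_def z_def convol_def forcing_def)
  moreover have "w = (\<lambda>t. control_part (z t))"
    by (simp add: z_def)
  ultimately show ?thesis
    by (rule that)
qed

end

lemma growth_lipschitz_multi_section:
  fixes \<Phi> :: "real \<Rightarrow> 'e::real_inner \<Rightarrow> 'h::real_inner \<Rightarrow> 'p::metric_space \<Rightarrow> 'v::real_inner set"
  assumes convex_values: "\<forall>t\<in>{0..b}. \<forall>x u p.
      \<Phi> t x u p \<noteq> {} \<and> compactin weak_topology (\<Phi> t x u p) \<and> convex (\<Phi> t x u p)"
    and Lipschitz: "\<forall>D. bounded D \<longrightarrow> (\<exists>k. L1_nonneg b k \<and> (AE t in leb b. \<forall>x u y v. \<forall>p\<in>D.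
      Haus (\<Phi> t x u p) (\<Phi> t y v p) \<le> ereal (k t * (norm (x - y) + norm (u - v)))))"
    and growth: "\<forall>D. bounded D \<longrightarrow> (\<exists>C>0. AE t in leb b. \<forall>x u. \<forall>p\<in>D.
      set_norm (\<Phi> t x u p) \<le> ereal (C * (1 + norm x + norm u)))"
  obtains C k where "growth_lipschitz_multi b (\<lambda>t x u. \<Phi> t x u p) C k"
proof -
  have "bounded {p}"
    by simp
  obtain k where k: "AE t in leb b. \<forall>x u y v.
      Haus (\<Phi> t x u p) (\<Phi> t y v p) \<le> ereal (k t * (norm (x - y) + norm (u - v)))"
    using Lipschitz[rule_format, OF \<open>bounded {p}\<close>] by auto
  obtain C where C: "C > 0" "AE t in leb b. \<forall>x u. set_norm (\<Phi> t x u p) \<le> ereal (C * (1 + norm x + norm u))"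
    using growth[rule_format, OF \<open>bounded {p}\<close>] by auto
  have "AE t in leb b. \<forall>x u. \<forall>y\<in>\<Phi> t x u p. norm y \<le> C * (1 + norm x + norm u)"
    using C(2) by eventually_elim (use set_norm_leD in blast)
  with k C(1) convex_values have "growth_lipschitz_multi b (\<lambda>t x u. \<Phi> t x u p) C k"
    by (auto simp: growth_lipschitz_multi_def weakly_compact_imp_closed)
  then show ?thesis
    by (rule that)
qed

lemma HF_growth_lipschitz_multi:
  assumes "HF b F"
  obtains C k where "growth_lipschitz_multi b (\<lambda>t x u. F t x u \<zeta>) C k"
  using assms unfolding HF_def by (elim conjE) (rule growth_lipschitz_multi_section[of b F \<zeta>], assumption+)

lemma HG_growth_lipschitz_multi:
  assumes "HG b G"
  obtains C k where "growth_lipschitz_multi b (\<lambda>t x u. G t x u \<eta>) C k"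
  using assms unfolding HG_def by (elim conjE) (rule growth_lipschitz_multi_section[of b G \<eta>], assumption+)

lemma HA_compact_C0_semigroup:
  assumes "b > 0" and A: "HA b domA A T"
  obtains M where "compact_C0_semigroup (T \<zeta>) b M"
proof -
  have "\<exists>M>0. \<forall>\<zeta>'\<in>{\<zeta>}. \<forall>t\<in>{0..b}. norm (T \<zeta>' t) \<le> M"
    using A unfolding HA_def by (meson bounded_insert bounded_empty)
  then obtain M where M: "\<And>t. t \<in> {0..b} \<Longrightarrow> norm (T \<zeta> t) \<le> M"
    by blast
  have "\<forall>\<zeta>. generates (domA \<zeta>) (A \<zeta>) (T \<zeta>) \<and> (\<forall>t>0. compact_operator (T \<zeta> t))"
    using A unfolding HA_def by (elim conjE)
  then have "C0_semigroup (T \<zeta>)" "\<And>t. t > 0 \<Longrightarrow> compact_operator (T \<zeta> t)"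
    by (auto simp: generates_def)
  then have "compact_C0_semigroup (T \<zeta>) b M"
    using M \<open>b > 0\<close> by unfold_locales auto
  then show ?thesis
    by (rule that)
qed

lemma HB_state_dependent_monotone:
  assumes maximal: "\<And>t u. t \<in> {0..b} \<Longrightarrow> maximal_monotone (B t u \<eta>)" and B: "HB b B"
  obtains \<theta> \<theta>' lam MB where "state_dependent_monotone b (\<lambda>t u. B t u \<eta>) \<theta> \<theta>' lam MB"
proof -
  obtain \<theta> lam lam' where lam: "0 \<le> lam" "lam < 1" and "in_W12 b \<theta>"
    and dis: "\<forall>t\<in>{0..b}. \<forall>s\<in>{0..b}. \<forall>u v \<eta>1 \<eta>2. dis (B t u \<eta>1) (B s v \<eta>2)
        \<le> ereal (\<bar>\<theta> t - \<theta> s\<bar> + lam * norm (u - v) + lam' * dist \<eta>1 \<eta>2)"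
    using B unfolding HB_def by (elim conjE exE) (rule that)
  then obtain \<theta>' where \<theta>: "has_W12_derivative b \<theta> \<theta>'"
    by (auto simp: in_W12_def)
  obtain MB where MB: "MB > 0" "\<forall>t\<in>{0..b}. \<forall>u \<eta>. \<forall>v\<in>op_dom (B t u \<eta>).
      norm (minimal_section (B t u \<eta>) v) \<le> MB * (1 + norm u + norm v)"
    using B unfolding HB_def by (elim conjE exE) (rule that)
  have "dis (B t u \<eta>) (B s v \<eta>) \<le> ereal (\<bar>\<theta> t - \<theta> s\<bar> + lam * norm (u - v))"
    if "t \<in> {0..b}" "s \<in> {0..b}" for t s u v
    using dis[rule_format, OF that, of u \<eta> v \<eta>] by simp
  then have "state_dependent_monotone b (\<lambda>t u. B t u \<eta>) \<theta> \<theta>' lam MB"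
    using maximal \<theta> lam MB by unfold_locales auto
  then show ?thesis
    by (rule that)
qed

lemma HB_domains_relatively_compact:
  assumes "HB b B"
  shows "ball_relatively_compact (\<Union>t\<in>{0..b}. \<Union>u\<in>cball 0 R. op_dom (B t u \<eta>))"
proof -
  have "bounded (cball 0 R \<times> {\<eta>})"
    by (intro bounded_Times bounded_cball) simp
  then have "ball_relatively_compact (\<Union>t\<in>{0..b}. \<Union>(u, \<eta>)\<in>cball 0 R \<times> {\<eta>}. op_dom (B t u \<eta>))"
    using assms unfolding HB_def by blast
  moreover have "(\<Union>t\<in>{0..b}. \<Union>(u, \<eta>)\<in>cball 0 R \<times> {\<eta>}. op_dom (B t u \<eta>))
      = (\<Union>t\<in>{0..b}. \<Union>u\<in>cball 0 R. op_dom (B t u \<eta>))"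
    by auto
  ultimately show ?thesis
    by simp
qed

lemma HW_bound:
  assumes "HW b W"
  obtains \<phi> where "in_L2 b \<phi>" "AE t in leb b. \<forall>w\<in>W t. norm w \<le> \<phi> t"
proof -
  obtain \<phi> where "in_L2 b \<phi>" and \<phi>: "AE t in leb b. set_norm (W t) \<le> ereal (\<phi> t)"
    using assms unfolding HW_def by blast
  moreover from \<phi> have "AE t in leb b. \<forall>w\<in>W t. norm w \<le> \<phi> t"
    by eventually_elim (use set_norm_leD in blast)
  ultimately show ?thesis
    by (intro that)
qed

lemma admissible_controls_nonempty:
  assumes HW: "HW b W"
  shows "admissible_controls b W \<noteq> {}"
proof -
  obtain \<phi> where \<phi>: "in_L2 b \<phi>" "AE t in leb b. \<forall>w\<in>W t. norm w \<le> \<phi> t"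
    by (rule HW_bound[OF HW])
  have W: "measurable_multi b W" "\<And>t. t \<in> {0..b} \<Longrightarrow> closed (W t) \<and> convex (W t) \<and> W t \<noteq> {}"
    using HW unfolding HW_def by blast+
  have mem: "AE t in leb b. min_norm_element (W t) \<in> W t"
    using W(2) min_norm_element(1) by (intro AE_I2) auto
  have "in_L2 b (\<lambda>t. min_norm_element (W t))"
  proof (rule in_L2_dominated[OF borel_measurable_min_norm_element[OF W] \<phi>(1)])
    show "AE t in leb b. norm (min_norm_element (W t)) \<le> \<phi> t"
      using mem \<phi>(2) by eventually_elim blast
  qed
  with mem show ?thesis
    unfolding admissible_controls_def by blast
qed

lemma optimal_mild_solution_exists:
  fixes b :: real
    and domA :: "'l::metric_space \<Rightarrow> 'e::{real_inner, banach, second_countable_topology} set"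
    and B :: "real \<Rightarrow> 'h::{real_inner, banach, second_countable_topology} \<Rightarrow> 'k::metric_space \<Rightarrow> 'h \<Rightarrow> 'h set"
    and W :: "real \<Rightarrow> 'y::{real_inner, banach, second_countable_topology} set"
  assumes "b > 0" and maximal: "\<And>t u \<eta>'. t \<in> {0..b} \<Longrightarrow> maximal_monotone (B t u \<eta>')"
    and A: "HA b domA A T" and B: "HB b B" and F: "HF b F" and G: "HG b G" and W: "HW b W"
    and l: "Hl b l" and \<phi>: "continuous_on UNIV (\<lambda>(x, u, \<zeta>', \<eta>'). \<phi> x u \<zeta>' \<eta>')"
    and nonempty: "\<exists>w\<in>admissible_controls b W. mild_solutions b T B F G Bop x0 u0 \<zeta> \<eta> w \<noteq> {}"
  obtains w x u where "w \<in> admissible_controls b W" "(x, u) \<in> mild_solutions b T B F G Bop x0 u0 \<zeta> \<eta> w"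
    "\<And>w' x' u'. w' \<in> admissible_controls b W \<Longrightarrow> (x', u') \<in> mild_solutions b T B F G Bop x0 u0 \<zeta> \<eta> w' \<Longrightarrow>
      cost b l \<phi> \<zeta> \<eta> x u + control_cost b w \<le> cost b l \<phi> \<zeta> \<eta> x' u' + control_cost b w'"
proof -
  obtain M where semigroup: "compact_C0_semigroup (T \<zeta>) b M"
    by (rule HA_compact_C0_semigroup[OF \<open>b > 0\<close> A])
  obtain \<theta> \<theta>' lam MB where monotone: "state_dependent_monotone b (\<lambda>t u. B t u \<eta>) \<theta> \<theta>' lam MB"
    by (rule HB_state_dependent_monotone[OF maximal B])
  obtain MF kF where F': "growth_lipschitz_multi b (\<lambda>t x u. F t x u \<zeta>) MF kF"
    by (rule HF_growth_lipschitz_multi[OF F])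
  obtain MG kG where G': "growth_lipschitz_multi b (\<lambda>t x u. G t x u \<eta>) MG kG"
    by (rule HG_growth_lipschitz_multi[OF G])
  obtain \<phi>W where \<phi>W: "in_L2 b \<phi>W" "AE t in leb b. \<forall>w\<in>W t. norm w \<le> \<phi>W t"
    by (rule HW_bound[OF W])
  interpret control_system "T \<zeta>" b M "\<lambda>t u. B t u \<eta>" \<theta> \<theta>' lam MB "\<lambda>t x u. F t x u \<zeta>" MF kF
    "\<lambda>t x u. G t x u \<eta>" MG kG W \<phi>W Bop "x0 \<zeta>" "u0 \<eta>"
    using semigroup monotone F' G' \<phi>W W
    by (intro control_system.intro control_system_axioms.intro HB_domains_relatively_compact[OF B])
      (auto simp: HW_def)
  note to_trajectory = mild_solution_trajectory[of T \<zeta> B \<eta> F G x0 u0, OF refl refl refl refl refl refl]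
    and to_solution = trajectory_admissible_mild_solution[of T \<zeta> B \<eta> F G x0 u0, OF refl refl refl refl refl refl]
  have "\<exists>x u z. trajectory x u z"
    using nonempty to_trajectory by (metis ex_in_conv surj_pair)
  then obtain x u z where tr: "trajectory x u z"
    and minimal: "\<And>x' u' z'. trajectory x' u' z' \<Longrightarrow>
      cost b l \<phi> \<zeta> \<eta> x u + control_cost b (\<lambda>t. control_part (z t))
        \<le> cost b l \<phi> \<zeta> \<eta> x' u' + control_cost b (\<lambda>t. control_part (z' t))"
    by (rule optimal_trajectory_exists[where \<zeta> = \<zeta> and \<eta> = \<eta>, OF l \<phi>]) (rule that)
  show ?thesis
  proof (rule that[OF to_solution[OF tr]])
    fix w' x' u'
    assume "w' \<in> admissible_controls b W" "(x', u') \<in> mild_solutions b T B F G Bop x0 u0 \<zeta> \<eta> w'"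
    then obtain z' where "trajectory x' u' z'" "w' = (\<lambda>t. control_part (z' t))"
      by (rule to_trajectory)
    then show "cost b l \<phi> \<zeta> \<eta> x u + control_cost b (\<lambda>t. control_part (z t))
        \<le> cost b l \<phi> \<zeta> \<eta> x' u' + control_cost b w'"
      using minimal by simp
  qed
qed

theorem theorem5p1:
  fixes b :: real
    and domA :: "'l::metric_space \<Rightarrow> 'e::{real_inner, banach, second_countable_topology} set"
    and A :: "'l \<Rightarrow> 'e \<Rightarrow> 'e"
    and T :: "'l \<Rightarrow> real \<Rightarrow> 'e \<Rightarrow>\<^sub>L 'e"
    and B :: "real \<Rightarrow> 'h::{real_inner, banach, second_countable_topology} \<Rightarrow> 'k::metric_space
                \<Rightarrow> 'h \<Rightarrow> 'h set"
    and F :: "real \<Rightarrow> 'e \<Rightarrow> 'h \<Rightarrow> 'l \<Rightarrow> 'e set"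
    and G :: "real \<Rightarrow> 'e \<Rightarrow> 'h \<Rightarrow> 'k \<Rightarrow> 'h set"
    and W :: "real \<Rightarrow> 'y::{real_inner, banach, second_countable_topology} set"
    and Bop :: "'y \<Rightarrow>\<^sub>L 'e"
    and x0 :: "'l \<Rightarrow> 'e"
    and u0 :: "'k \<Rightarrow> 'h"
    and l :: "real \<Rightarrow> 'e \<Rightarrow> 'h \<Rightarrow> 'l \<Rightarrow> 'k \<Rightarrow> real"
    and \<phi> :: "'e \<Rightarrow> 'h \<Rightarrow> 'l \<Rightarrow> 'k \<Rightarrow> real"
    and \<zeta> :: 'l
    and \<eta> :: 'k
  assumes "b > 0"
    and "\<And>\<zeta>'. linear_operator_on (domA \<zeta>') (A \<zeta>')"
    and "\<And>t u \<eta>'. t \<in> {0..b} \<Longrightarrow> maximal_monotone (B t u \<eta>')"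
    and "\<And>\<eta>'. u0 \<eta>' \<in> op_dom (B 0 (u0 \<eta>') \<eta>')"
    and "HA b domA A T"
    and "HB b B"
    and "HF b F"
    and "HG b G"
    and "HW b W"
    and "Hl b l"
    and "continuous_on UNIV (\<lambda>(x, u, \<zeta>', \<eta>'). \<phi> x u \<zeta>' \<eta>')"
  shows "\<exists>w_opt \<in> admissible_controls b W.
    min_cost b T B F G Bop x0 u0 l \<phi> \<zeta> \<eta> w_opt + ereal (control_cost b w_opt) =
      (INF w \<in> admissible_controls b W.
        min_cost b T B F G Bop x0 u0 l \<phi> \<zeta> \<eta> w + ereal (control_cost b w))"
proof (cases "\<exists>w\<in>admissible_controls b W. mild_solutions b T B F G Bop x0 u0 \<zeta> \<eta> w \<noteq> {}")
  case True
  obtain w x u where w: "w \<in> admissible_controls b W"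
    and "(x, u) \<in> mild_solutions b T B F G Bop x0 u0 \<zeta> \<eta> w"
    and "\<And>w' x' u'. w' \<in> admissible_controls b W \<Longrightarrow> (x', u') \<in> mild_solutions b T B F G Bop x0 u0 \<zeta> \<eta> w' \<Longrightarrow>
      cost b l \<phi> \<zeta> \<eta> x u + control_cost b w \<le> cost b l \<phi> \<zeta> \<eta> x' u' + control_cost b w'"
    by (rule optimal_mild_solution_exists[OF assms(1,3,5-11) True]) (assumption, rule that)
  then have "min_cost b T B F G Bop x0 u0 l \<phi> \<zeta> \<eta> w + ereal (control_cost b w) =
      (INF w\<in>admissible_controls b W. min_cost b T B F G Bop x0 u0 l \<phi> \<zeta> \<eta> w + ereal (control_cost b w))"
    unfolding min_cost_def case_prod_beta
    by (intro INF_add_attained[where s = "(x, u)"]) (auto simp: case_prod_beta)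
  with w show ?thesis
    by blast
next
  case False
  then have "min_cost b T B F G Bop x0 u0 l \<phi> \<zeta> \<eta> w = \<infinity>" if "w \<in> admissible_controls b W" for w
    using that by (simp add: min_cost_def top_ereal_def)
  moreover obtain w where "w \<in> admissible_controls b W"
    using admissible_controls_nonempty[OF assms(9)] by blast
  ultimately show ?thesis
    by (intro bexI[of _ w]) (auto simp: INF_constant top_ereal_def)
qed

end
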